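(* There exist a metric space $(X,d)$ of locally finite Hausdorff $2$-measure and a quasisymmetric homeomorphism $f\colon [0,1]^2 \rightarrow X$ (with $[0,1]^2$ carrying the Euclidean metric) which fails to be quasiconformal.
   Context: A homeomorphism $f\colon (X,d_X) \rightarrow (Y,d_Y)$ between metric spaces is quasisymmetric if there exists a homeomorphism $\eta\colon [0, \infty) \rightarrow [0, \infty)$ such that $$\frac{d_Y(f(x),f(y))}{d_Y(f(x),f(z))} \leq \eta\left( \frac{d_X(x,y)}{d_X(x,z)} \right)$$ for all triples of distinct points $x,y,z \in X$. Quasiconformality is understood in the geometric sense, via modulus of path families. For a metric space $Y$ of locally finite Hausdorff $2$-measure $\mathcal{H}^2$ and a family $\Gamma$ of paths in $Y$, the (conformal, i.e. $2$-)modulus is $\operatorname{Mod}(\Gamma) = \inf \int_Y \rho^2 \, d\mathcal{H}^2$, the infimum being over all Borel functions $\rho\colon Y \to [0,\infty]$ with $\int_\gamma \rho\, ds \geq 1$ for every locally rectifiable $\gamma \in \Gamma$. A homeomorphism $f\colon [0,1]^2 \to X$ is quasiconformal if there exists $K \geq 1$ such that $K^{-1}\operatorname{Mod}(\Gamma) \leq \operatorname{Mod}(f(\Gamma)) \leq K \operatorname{Mod}(\Gamma)$ for every family $\Gamma$ of paths in $[0,1]^2$, where $f(\Gamma) = \{f\circ\gamma : \gamma \in \Gamma\}$. *)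

theory Defs
  imports "HOL-Analysis.Analysis"
begin

section \<open>Hausdorff 2-measure\<close>

definition ediam :: "'a metric \<Rightarrow> 'a set \<Rightarrow> ennreal" where
  "ediam X A = (SUP (x, y)\<in>A \<times> A. ennreal (mdist X x y))"

text \<open>The factor \<open>pi / 4\<close> is the usual normalization (area of a disc in terms of its diameter),
  for which the Hausdorff 2-measure of the Euclidean plane is Lebesgue measure.\<close>

definition hausdorff2_pre :: "'a metric \<Rightarrow> real \<Rightarrow> 'a set \<Rightarrow> ennreal" where
  "hausdorff2_pre X \<delta> A =
     (INF U\<in>{U :: nat \<Rightarrow> 'a set. range U \<subseteq> Pow (mspace X) \<and> A \<subseteq> (\<Union>i. U i) \<and>
                (\<forall>i. ediam X (U i) \<le> ennreal \<delta>)}.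
        \<Sum>i. ennreal (pi / 4) * (ediam X (U i))\<^sup>2)"

definition hausdorff2_outer :: "'a metric \<Rightarrow> 'a set \<Rightarrow> ennreal" where
  "hausdorff2_outer X A = (SUP \<delta>\<in>{0<..}. hausdorff2_pre X \<delta> A)"

text \<open>Hausdorff outer measure is a metric outer measure, hence countably additive on the Borel
  sets; so \<^const>\<open>measure_of\<close> yields a measure on the Borel sets of \<open>X\<close> agreeing there with
  \<open>hausdorff2_outer X\<close>.\<close>

definition hausdorff2 :: "'a metric \<Rightarrow> 'a measure" where
  "hausdorff2 X = measure_of (mspace X) {U. openin (mtopology_of X) U} (hausdorff2_outer X)"

definition locally_finite_hausdorff2 :: "'a metric \<Rightarrow> bool" where
  "locally_finite_hausdorff2 X \<longleftrightarrow>
     (\<forall>x\<in>mspace X. \<exists>r>0. emeasure (hausdorff2 X) (mball_of X x r) < \<infinity>)"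


section \<open>Paths and line integrals\<close>

text \<open>A path is a pair \<open>(I, \<gamma>)\<close> of an arbitrary (not necessarily compact) interval of the real
  line and a map that is continuous on it; values of \<open>\<gamma>\<close> off \<open>I\<close> are irrelevant.\<close>

type_synonym 'a mpath = "real set \<times> (real \<Rightarrow> 'a)"

definition is_mpath :: "'a metric \<Rightarrow> 'a mpath \<Rightarrow> bool" where
  "is_mpath X = (\<lambda>(I, \<gamma>). is_interval I \<and> I \<noteq> {} \<and>
     continuous_map (top_of_set I) (mtopology_of X) \<gamma>)"

definition mlength :: "'a metric \<Rightarrow> (real \<Rightarrow> 'a) \<Rightarrow> real \<Rightarrow> real \<Rightarrow> ennreal" where
  "mlength X \<gamma> a b =
     (SUP ts\<in>{ts. sorted ts \<and> set ts \<subseteq> {a..b}}.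
        \<Sum>i<length ts - 1. ennreal (mdist X (\<gamma> (ts ! i)) (\<gamma> (ts ! Suc i))))"

definition locally_rectifiable :: "'a metric \<Rightarrow> 'a mpath \<Rightarrow> bool" where
  "locally_rectifiable X = (\<lambda>(I, \<gamma>). \<forall>a\<in>I. \<forall>b\<in>I. a \<le> b \<longrightarrow> mlength X \<gamma> a b < \<infinity>)"

text \<open>The arc-length parametrization of a rectifiable path on \<open>{a..b}\<close>. All parameters \<open>t\<close> at which
  the initial piece on \<open>{a..t}\<close> has length \<open>u\<close> have the same image, so the choice made by
  \<^const>\<open>inv_into\<close> does not matter.\<close>

definition arclength_param :: "'a metric \<Rightarrow> (real \<Rightarrow> 'a) \<Rightarrow> real \<Rightarrow> real \<Rightarrow> real \<Rightarrow> 'a" where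
  "arclength_param X \<gamma> a b u = \<gamma> (inv_into {a..b} (\<lambda>t. mlength X \<gamma> a t) (ennreal u))"

definition closed_line_integral ::
    "'a metric \<Rightarrow> (real \<Rightarrow> 'a) \<Rightarrow> real \<Rightarrow> real \<Rightarrow> ('a \<Rightarrow> ennreal) \<Rightarrow> ennreal" where
  "closed_line_integral X \<gamma> a b \<rho> =
     (\<integral>\<^sup>+u\<in>{0..enn2real (mlength X \<gamma> a b)}. \<rho> (arclength_param X \<gamma> a b u) \<partial>lborel)"

text \<open>For a locally rectifiable path, the line integral is the supremum over closed subpaths.\<close>

definition line_integral :: "'a metric \<Rightarrow> 'a mpath \<Rightarrow> ('a \<Rightarrow> ennreal) \<Rightarrow> ennreal" where
  "line_integral X = (\<lambda>(I, \<gamma>) \<rho>.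
     SUP (a, b)\<in>{(a, b). a \<in> I \<and> b \<in> I \<and> a \<le> b}. closed_line_integral X \<gamma> a b \<rho>)"


section \<open>Modulus\<close>

definition admissible :: "'a metric \<Rightarrow> 'a mpath set \<Rightarrow> ('a \<Rightarrow> ennreal) \<Rightarrow> bool" where
  "admissible X \<Gamma> \<rho> \<longleftrightarrow> \<rho> \<in> borel_measurable (hausdorff2 X) \<and>
     (\<forall>p\<in>\<Gamma>. locally_rectifiable X p \<longrightarrow> line_integral X p \<rho> \<ge> 1)"

definition modulus :: "'a metric \<Rightarrow> 'a mpath set \<Rightarrow> ennreal" where
  "modulus X \<Gamma> = (INF \<rho>\<in>{\<rho>. admissible X \<Gamma> \<rho>}. \<integral>\<^sup>+x. (\<rho> x)\<^sup>2 \<partial>hausdorff2 X)"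

definition path_image_family :: "('a \<Rightarrow> 'b) \<Rightarrow> 'a mpath set \<Rightarrow> 'b mpath set" where
  "path_image_family f \<Gamma> = (\<lambda>(I, \<gamma>). (I, f \<circ> \<gamma>)) ` \<Gamma>"


section \<open>Quasisymmetric and quasiconformal homeomorphisms\<close>

definition quasisymmetric :: "'a metric \<Rightarrow> 'b metric \<Rightarrow> ('a \<Rightarrow> 'b) \<Rightarrow> bool" where
  "quasisymmetric X Y f \<longleftrightarrow> homeomorphic_map (mtopology_of X) (mtopology_of Y) f \<and>
     (\<exists>\<eta> :: real \<Rightarrow> real. homeomorphic_map (top_of_set {0..}) (top_of_set {0..}) \<eta> \<and>
        (\<forall>x\<in>mspace X. \<forall>y\<in>mspace X. \<forall>z\<in>mspace X. x \<noteq> y \<and> x \<noteq> z \<and> y \<noteq> z \<longrightarrow>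
           mdist Y (f x) (f y) / mdist Y (f x) (f z) \<le> \<eta> (mdist X x y / mdist X x z)))"

definition quasiconformal :: "'a metric \<Rightarrow> 'b metric \<Rightarrow> ('a \<Rightarrow> 'b) \<Rightarrow> bool" where
  "quasiconformal X Y f \<longleftrightarrow> homeomorphic_map (mtopology_of X) (mtopology_of Y) f \<and>
     (\<exists>K::real. K \<ge> 1 \<and> (\<forall>\<Gamma>. (\<forall>p\<in>\<Gamma>. is_mpath X p) \<longrightarrow>
        ennreal (1 / K) * modulus X \<Gamma> \<le> modulus Y (path_image_family f \<Gamma>) \<and>
        modulus Y (path_image_family f \<Gamma>) \<le> ennreal K * modulus X \<Gamma>))"

text \<open>\<^const>\<open>dist\<close> on \<^typ>\<open>real \<times> real\<close> is the Euclidean distance.\<close>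

definition unit_square :: "(real \<times> real) metric" where
  "unit_square = submetric euclidean_metric ({0..1} \<times> {0..1})"

end

theory Submission
  imports Defs
begin

text \<open>
  The square is cut into \<open>512\<close>-adic cells, and a cell of level \<open>n\<close> is given the size
  \<open>256\<^sup>-\<^sup>k 512\<^sup>-\<^sup>n\<close>, where the exponent \<open>k\<close> increases by one in the interior of each cell, decreases
  by one in its frame, and stops at 0. The distance of two points is the infimum of the total size
  of chains of cells joining them. A chain crossing a cell passes its frame twice, where the cells
  have half its size, so finer chains are no shortcuts, and distances are comparable to the sizes of
  the cells. As the sizes decay geometrically and neighbouring cells have comparable sizes, the
  identity is quasisymmetric; it is Lipschitz because the exponents are nonnegative, so the
  Hausdorff measure is finite.

  Frames are thin, so the exponent is a random walk which drifts to infinity: the stopped cells fill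
  at most the fraction \<open>16\<^sup>-\<^sup>k\<close> of a cell of exponent \<open>k\<close>. Almost every horizontal segment has all of
  its new length on the stopped cells, where the metric is bi-Lipschitz to the Euclidean one. By the
  Cauchy-Schwarz inequality the horizontal segments of a cell of exponent \<open>k\<close>, a family of
  bounded modulus, have images of modulus at least a constant times \<open>16\<^sup>k\<close>.
\<close>

section \<open>Cells and their sizes\<close>

text \<open>Stopping at exponent 0 is what upsets the frames: a child of a stopped cell has 1/512 of
  its size whether or not it lies in the frame, so the cost of two halves fails there. The repair
  rests on two facts. Exponents of adjacent cells of one level differ by at most 2, so near a
  stopped cell they are at most 8; and eight frame levels in a row reduce such an exponent to 0.
  Hence every separating column of cells contains a thin slab in which sizes are Euclidean, and
  crossing that slab costs a fixed fraction of the column. The price is paid once and ends the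
  induction, so it does not accumulate over the levels. The subdivision number must make frames
  rare: with weight 16^-k the children of a cell of positive exponent have average weight (10140 *
  16 + 252004 / 16) / 512^2 < 11/16 times that of the parent. The walk starts at exponent 1 because
  0 is absorbing. The Hausdorff measure of the new metric is never computed. An upper bound by the
  Lipschitz constant gives finiteness, and a lower bound on the stopped set is all that the modulus
  estimate uses.\<close>

text \<open>The frame is five cells wide, so that everything within two cells of its third ring is still
  frame.\<close>

definition frame :: "int \<Rightarrow> bool" where
  "frame a \<longleftrightarrow> a mod 512 < 5 \<or> a mod 512 \<ge> 507"

text \<open>A cell of level \<open>n\<close> and exponent \<open>k\<close> has size \<open>256\<^sup>-\<^sup>k 512\<^sup>-\<^sup>n\<close>. Since
  \<open>256 = 512 / 2\<close>, a frame cell has half the size of its parent. Exponent 0 is absorbing, and the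
  metric is Euclidean up to constants on such a stopped cell.\<close>

primrec weight_exp :: "nat \<Rightarrow> int \<Rightarrow> int \<Rightarrow> nat" where
  "weight_exp 0 a b = 1"
| "weight_exp (Suc n) a b =
     (let k = weight_exp n (a div 512) (b div 512)
      in if frame a \<or> frame b then k - 1 else if k = 0 then 0 else Suc k)"

definition cell_index :: "nat \<Rightarrow> real \<Rightarrow> int" where
  "cell_index n t = \<lfloor>512 ^ n * t\<rfloor>"

text \<open>A Boolean index for the coordinates lets one argument in a direction \<open>c\<close>
  serve both the horizontal and the vertical case.\<close>

definition coord :: "bool \<Rightarrow> real \<times> real \<Rightarrow> real" where
  "coord c p = (if c then fst p else snd p)"

text \<open>Chebyshev distance of level \<open>n\<close> cells, expressed through points that
  represent them; \<open>near 1\<close> means that the closed cells touch, possibly only at a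
  corner.\<close>

definition near :: "int \<Rightarrow> nat \<Rightarrow> real \<times> real \<Rightarrow> real \<times> real \<Rightarrow> bool" where
  "near k n p q \<longleftrightarrow> (\<forall>c. \<bar>cell_index n (coord c p) - cell_index n (coord c q)\<bar> \<le> k)"

definition point_exp :: "nat \<Rightarrow> real \<times> real \<Rightarrow> nat" where
  "point_exp n p = weight_exp n (cell_index n (fst p)) (cell_index n (snd p))"

definition cell_size :: "nat \<Rightarrow> real \<times> real \<Rightarrow> real" where
  "cell_size n p = (1 / 256) ^ point_exp n p * (1 / 512) ^ n"

lemma cell_index_Suc_div: "cell_index (Suc n) t div 512 = cell_index n t"
proof -
  have "cell_index n t = \<lfloor>(512 ^ Suc n * t) / real_of_int 512\<rfloor>"
    by (simp add: cell_index_def)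
  also have "\<dots> = cell_index (Suc n) t div 512"
    unfolding cell_index_def by (rule floor_divide_real_eq_div) simp
  finally show ?thesis ..
qed

lemma cell_index_add_div: "cell_index (n + k) t div 512 ^ k = cell_index n t"
proof -
  have "cell_index n t = \<lfloor>(512 ^ (n + k) * t) / real_of_int (512 ^ k)\<rfloor>"
    by (simp add: cell_index_def power_add)
  also have "\<dots> = cell_index (n + k) t div 512 ^ k"
    unfolding cell_index_def by (rule floor_divide_real_eq_div) simp
  finally show ?thesis ..
qed

lemma point_exp_0 [simp]: "point_exp 0 p = 1"
  by (simp add: point_exp_def)

lemma point_exp_Suc:
  "point_exp (Suc n) p =
     (if \<exists>c. frame (cell_index (Suc n) (coord c p)) then point_exp n p - 1
      else if point_exp n p = 0 then 0 else Suc (point_exp n p))"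
proof -
  have "(\<exists>c. frame (cell_index (Suc n) (coord c p))) \<longleftrightarrow>
        frame (cell_index (Suc n) (fst p)) \<or> frame (cell_index (Suc n) (snd p))"
    unfolding coord_def by (metis (full_types))
  then show ?thesis
    by (simp add: point_exp_def Let_def cell_index_Suc_div)
qed

lemma point_exp_Suc_le: "point_exp (Suc n) p \<le> Suc (point_exp n p)" and point_exp_Suc_ge: "point_exp n p \<le> Suc (point_exp (Suc n) p)"
  by (auto simp: point_exp_Suc)

lemma point_exp_le: "point_exp (n + k) p \<le> point_exp n p + k"
  by (induction k) (auto intro: order_trans[OF point_exp_Suc_le])

lemma point_exp_le_zero: "point_exp n p = 0 \<Longrightarrow> point_exp (n + k) p = 0"
  by (induction k) (auto simp: point_exp_Suc)

lemma point_exp_stopped: "point_exp n p = 0 \<Longrightarrow> n \<le> m \<Longrightarrow> point_exp m p = 0"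
  using point_exp_le_zero[of n p "m - n"] by simp

lemma cell_size_pos [simp]: "0 < cell_size n p" and cell_size_nonneg [simp]: "0 \<le> cell_size n p"
  by (auto simp: cell_size_def)

lemma cell_size_le: "cell_size n p \<le> (1 / 512) ^ n"
proof -
  have "(1 / 256 :: real) ^ point_exp n p \<le> 1"
    by (rule power_le_one) auto
  from mult_right_mono[OF this, of "(1 / 512) ^ n"] show ?thesis
    by (simp add: cell_size_def)
qed

text \<open>The worst case is a frame child: its exponent drops by one, which multiplies the size by
  256, against the factor 1/512 of the level.\<close>

lemma cell_size_Suc_le: "cell_size (Suc n) p \<le> cell_size n p / 2"
proof (cases "point_exp n p = 0")
  case True
  then show ?thesis
    by (simp add: cell_size_def point_exp_Suc)
next
  case False
  define a where "a = point_exp n p - 1"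
  have a: "point_exp n p = Suc a" using False by (simp add: a_def)
  have "(1 / 256 :: real) ^ point_exp (Suc n) p \<le> (1 / 256) ^ a"
    by (rule power_decreasing) (use point_exp_Suc_ge[of n p] a in auto)
  then have "(1 / 256) ^ point_exp (Suc n) p * (1 / 512) ^ Suc n \<le> (1 / 256) ^ a * (1 / 512 :: real) ^ Suc n"
    by (rule mult_right_mono) auto
  then show ?thesis
    by (simp add: cell_size_def a)
qed

text \<open>Subtraction is truncated: at exponent 0 the exponent cannot drop and the child has 1/512
  of the size, hence the second hypothesis.\<close>

lemma cell_size_frame:
  assumes "frame (cell_index (Suc n) (coord c p))" "point_exp n p \<noteq> 0"
  shows "cell_size (Suc n) p = cell_size n p / 2"
proof -
  have "point_exp n p = Suc (point_exp (Suc n) p)"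
    using assms by (auto simp: point_exp_Suc)
  then show ?thesis
    by (simp add: cell_size_def)
qed

lemma cell_size_antimono: "n \<le> m \<Longrightarrow> cell_size m p \<le> cell_size n p"
proof (induction rule: dec_induct)
  case (step m)
  then show ?case using cell_size_Suc_le[of m p] cell_size_nonneg[of m p] by linarith
qed auto

lemma cell_size_add_le: "cell_size (n + k) p \<le> cell_size n p / 2 ^ k"
proof (induction k)
  case (Suc k)
  then show ?case using cell_size_Suc_le[of "n + k" p] by simp
qed auto

text \<open>131072 = 256 * 512 is the largest shrinking in one level, attained when the exponent
  increases.\<close>

lemma cell_size_le_add: "cell_size n p \<le> 131072 ^ k * cell_size (n + k) p"
proof (induction k)
  case (Suc k)
  have "(1 / 256 :: real) ^ Suc (point_exp (n + k) p) \<le> (1 / 256) ^ point_exp (Suc (n + k)) p"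
    by (rule power_decreasing) (use point_exp_Suc_le[of "n + k" p] in auto)
  then have "(1 / 256) ^ Suc (point_exp (n + k) p) * (1 / 512) ^ Suc (n + k)
      \<le> (1 / 256) ^ point_exp (Suc (n + k)) p * (1 / 512 :: real) ^ Suc (n + k)"
    by (rule mult_right_mono) auto
  then have "cell_size (n + k) p \<le> 131072 * cell_size (n + Suc k) p"
    by (simp add: cell_size_def)
  from order_trans[OF Suc mult_left_mono[OF this, of "131072 ^ k"]] show ?case
    by (simp add: mult_ac)
qed auto

lemma int_512_cases:
  fixes a :: int
  obtains m i where "a = 512 * m + i" "0 \<le> i" "i < 512" "a div 512 = m" "a mod 512 = i"
  by (rule that[of "a div 512" "a mod 512"]) simp_all

lemma div_512_diff:
  fixes a b k :: int
  assumes "\<bar>a - b\<bar> \<le> k" "k \<le> 512"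
  shows "\<bar>a div 512 - b div 512\<bar> \<le> 1"
proof -
  obtain m i where a: "a = 512 * m + i" "0 \<le> i" "i < 512" "a div 512 = m"
    by (rule int_512_cases)
  obtain n j where b: "b = 512 * n + j" "0 \<le> j" "j < 512" "b div 512 = n"
    by (rule int_512_cases)
  have "a - b \<le> 512" "b - a \<le> 512"
    using assms by linarith+
  then have "m - n < 2" "n - m < 2"
    unfolding a(1) b(1) using a(2,3) b(2,3) by linarith+
  then show ?thesis
    unfolding a(4) b(4) by linarith
qed

lemma frame_if_div_neq:
  fixes a b :: int
  assumes "\<bar>a - b\<bar> \<le> 1" "a div 512 \<noteq> b div 512"
  shows "frame a \<and> frame b"
proof -
  obtain m i where a: "a = 512 * m + i" "0 \<le> i" "i < 512" "a div 512 = m" "a mod 512 = i"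
    by (rule int_512_cases)
  obtain n j where b: "b = 512 * n + j" "0 \<le> j" "j < 512" "b div 512 = n" "b mod 512 = j"
    by (rule int_512_cases)
  have ab: "512 * m + i - (512 * n + j) \<le> 1" "512 * n + j - (512 * m + i) \<le> 1"
    using assms(1) unfolding a(1) b(1) by linarith+
  have "m \<noteq> n" using assms(2) unfolding a(4) b(4) .
  then have "m + 1 \<le> n \<or> n + 1 \<le> m" by linarith
  then have "(507 \<le> i \<and> j < 5) \<or> (i < 5 \<and> 507 \<le> j)"
  proof
    assume "m + 1 \<le> n"
    then have "507 \<le> i" "j < 5" using ab a(2,3) b(2,3) by linarith+
    then show ?thesis by simp
  next
    assume "n + 1 \<le> m"
    then have "i < 5" "507 \<le> j" using ab a(2,3) b(2,3) by linarith+
    then show ?thesis by simp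
  qed
  then show ?thesis
    unfolding frame_def a(5) b(5) by blast
qed

text \<open>Children of the same parent of exponent \<open>k\<close> have exponents between
  \<open>k - 1\<close> and \<open>k + 1\<close>. Adjacent cells with different parents lie on both
  sides of a parent boundary, hence both in frames, so the parents' exponents are lowered together
  and the difference given by the induction does not grow. Truncation at 0 can only reduce
  it.\<close>

lemma weight_exp_adjacent:
  assumes "\<bar>a - a'\<bar> \<le> 1" "\<bar>b - b'\<bar> \<le> 1"
  shows "\<bar>int (weight_exp n a b) - int (weight_exp n a' b')\<bar> \<le> 2"
  using assms
proof (induction n arbitrary: a b a' b')
  case 0
  then show ?case by simp
next
  case (Suc n)
  define K K' where "K = weight_exp n (a div 512) (b div 512)" and "K' = weight_exp n (a' div 512) (b' div 512)"
  define P P' where "P \<longleftrightarrow> frame a \<or> frame b" and "P' \<longleftrightarrow> frame a' \<or> frame b'"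
  have IH: "\<bar>int K - int K'\<bar> \<le> 2"
    unfolding K_def K'_def using Suc.prems by (intro Suc.IH div_512_diff[where k = 1]) auto
  have "K = K' \<or> (P \<and> P')"
    unfolding K_def K'_def P_def P'_def
    using Suc.prems frame_if_div_neq[of a a'] frame_if_div_neq[of b b'] by metis
  then have "\<bar>int (if P then K - 1 else if K = 0 then 0 else Suc K)
      - int (if P' then K' - 1 else if K' = 0 then 0 else Suc K')\<bar> \<le> 2"
  proof
    assume "K = K'"
    then show ?thesis by simp
  next
    assume "P \<and> P'"
    then show ?thesis using IH by simp
  qed
  then show ?case
    by (simp only: weight_exp.simps Let_def K_def K'_def P_def P'_def)
qed

lemma weight_exp_near:
  assumes "\<bar>a - a'\<bar> \<le> int k" "\<bar>b - b'\<bar> \<le> int k"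
  shows "\<bar>int (weight_exp n a b) - int (weight_exp n a' b')\<bar> \<le> 2 * int k"
  using assms
proof (induction k arbitrary: a b)
  case (Suc k)
  \<comment> \<open>One diagonal step reduces both coordinate differences at once, so
    \<open>k\<close> steps suffice in the plane.\<close>
  define a1 where "a1 = a - sgn (a - a')"
  define b1 where "b1 = b - sgn (b - b')"
  have "\<bar>int (weight_exp n a1 b1) - int (weight_exp n a' b')\<bar> \<le> 2 * int k"
    using Suc.prems by (intro Suc.IH) (auto simp: a1_def b1_def sgn_if)
  moreover have "\<bar>int (weight_exp n a b) - int (weight_exp n a1 b1)\<bar> \<le> 2"
    by (rule weight_exp_adjacent) (auto simp: a1_def b1_def sgn_if)
  ultimately show ?case by simp
qed auto

section \<open>Adjacency of cells across the levels\<close>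

lemma near_sym: "near k n p q \<Longrightarrow> near k n q p"
  by (simp add: near_def abs_minus_commute)

lemma near_refl [simp]: "0 \<le> k \<Longrightarrow> near k n p p"
  by (simp add: near_def)

lemma near_trans: "near k n p q \<Longrightarrow> near l n q r \<Longrightarrow> near (k + l) n p r"
proof -
  assume pq: "near k n p q" and qr: "near l n q r"
  show ?thesis
    unfolding near_def
  proof
    fix c
    have "\<bar>cell_index n (coord c p) - cell_index n (coord c q)\<bar> \<le> k" "\<bar>cell_index n (coord c q) - cell_index n (coord c r)\<bar> \<le> l"
      using pq qr by (auto simp: near_def)
    then show "\<bar>cell_index n (coord c p) - cell_index n (coord c r)\<bar> \<le> k + l" by linarith
  qed
qed

lemma near_mono: "near k n p q \<Longrightarrow> k \<le> l \<Longrightarrow> near l n p q"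
  unfolding near_def by (meson order_trans)

text \<open>Passing to the parents resets the constant to 1, so errors of a few cells do not add up
  when levels are coarsened.\<close>

lemma near_Suc_imp:
  assumes "near k (Suc n) p q" "k \<le> 512"
  shows "near 1 n p q"
  unfolding near_def
proof
  fix c
  have "\<bar>cell_index (Suc n) (coord c p) - cell_index (Suc n) (coord c q)\<bar> \<le> k"
    using assms(1) by (simp add: near_def)
  from div_512_diff[OF this assms(2)] show "\<bar>cell_index n (coord c p) - cell_index n (coord c q)\<bar> \<le> 1"
    by (simp only: cell_index_Suc_div)
qed

lemma near_antimono: "n \<le> m \<Longrightarrow> near 1 m p q \<Longrightarrow> near 1 n p q"
proof (induction rule: dec_induct)
  case (step m)
  from step.IH[OF near_Suc_imp[OF step.prems]] show ?case by simp
qed auto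

lemma point_exp_near:
  assumes "near (int k) n p q"
  shows "\<bar>int (point_exp n p) - int (point_exp n q)\<bar> \<le> 2 * int k"
proof -
  have "\<bar>cell_index n (fst p) - cell_index n (fst q)\<bar> \<le> int k" "\<bar>cell_index n (snd p) - cell_index n (snd q)\<bar> \<le> int k"
    using assms[unfolded near_def, rule_format, of True]
          assms[unfolded near_def, rule_format, of False]
    by (simp_all add: coord_def)
  then show ?thesis
    unfolding point_exp_def by (rule weight_exp_near)
qed

lemma cell_size_near:
  assumes "near (int k) n p q"
  shows "cell_size n p \<le> 256 ^ (2 * k) * cell_size n q"
proof -
  have "point_exp n q \<le> point_exp n p + 2 * k"
    using point_exp_near[OF assms] by linarith
  then have "(1 / 256 :: real) ^ (point_exp n p + 2 * k) \<le> (1 / 256) ^ point_exp n q"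
    by (intro power_decreasing) auto
  then have "(1 / 256 :: real) ^ point_exp n p \<le> 256 ^ (2 * k) * (1 / 256) ^ point_exp n q"
    by (simp add: power_add field_simps)
  from mult_right_mono[OF this, of "(1 / 512) ^ n"] show ?thesis
    by (simp add: cell_size_def mult.assoc)
qed

lemma cell_index_diff_le: "\<bar>s - t\<bar> \<le> (1 / 512) ^ n \<Longrightarrow> \<bar>cell_index n s - cell_index n t\<bar> \<le> 1"
proof -
  assume "\<bar>s - t\<bar> \<le> (1 / 512) ^ n"
  then have "512 ^ n * \<bar>s - t\<bar> \<le> 1"
    by (simp add: field_simps)
  then have "\<bar>512 ^ n * s - 512 ^ n * t\<bar> \<le> 1"
    by (simp add: abs_mult flip: right_diff_distrib)
  then show ?thesis unfolding cell_index_def by linarith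
qed

lemma diff_le_cell_index: "\<bar>cell_index n s - cell_index n t\<bar> \<le> 1 \<Longrightarrow> \<bar>s - t\<bar> \<le> 2 * (1 / 512) ^ n"
proof -
  assume "\<bar>cell_index n s - cell_index n t\<bar> \<le> 1"
  then have "\<bar>512 ^ n * s - 512 ^ n * t\<bar> \<le> 2"
    unfolding cell_index_def by linarith
  then have "512 ^ n * \<bar>s - t\<bar> \<le> 2"
    by (simp add: abs_mult flip: right_diff_distrib)
  then show ?thesis by (simp add: field_simps)
qed

text \<open>\<open>A\<close> constrains the points at which steps start but not the final point, so
  that a chain cut at its first exit from \<open>A\<close> is still a chain in \<open>A\<close>.
  \<open>L\<close> constrains the levels, which may vary from step to step. Each step pays for both
  of its cells; this makes the cost invariant under reversal.\<close>

inductive cell_chain :: "(real \<times> real) set \<Rightarrow> nat set \<Rightarrow> real \<times> real \<Rightarrow> real \<Rightarrow> real \<times> real \<Rightarrow> bool"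
  for A L where
  cell_chain_refl: "cell_chain A L p 0 p"
| cell_chain_step: "p \<in> A \<Longrightarrow> n \<in> L \<Longrightarrow> near 1 n p q \<Longrightarrow> cell_chain A L q r z \<Longrightarrow>
    cell_chain A L p (cell_size n p + cell_size n q + r) z"

lemma cell_chain_nonneg: "cell_chain A L p r q \<Longrightarrow> 0 \<le> r"
  by (induction rule: cell_chain.induct) (auto intro: add_nonneg_nonneg)

lemma cell_chain_mono: "cell_chain A L p r q \<Longrightarrow> A \<subseteq> A' \<Longrightarrow> L \<subseteq> L' \<Longrightarrow> cell_chain A' L' p r q"
proof (induction rule: cell_chain.induct)
  case (cell_chain_step p n q r z)
  show ?case by (rule cell_chain.cell_chain_step) (use cell_chain_step in auto)
qed (rule cell_chain_refl)

lemma cell_chain_trans: "cell_chain A L p r q \<Longrightarrow> cell_chain A L q s z \<Longrightarrow> cell_chain A L p (r + s) z"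
proof (induction rule: cell_chain.induct)
  case (cell_chain_step p n q r z')
  from cell_chain.cell_chain_step[OF cell_chain_step.hyps(1-3) cell_chain_step.IH[OF cell_chain_step.prems]]
  show ?case by (simp only: add.assoc)
qed simp

lemma cell_chain_single: "p \<in> A \<Longrightarrow> n \<in> L \<Longrightarrow> near 1 n p q \<Longrightarrow> cell_chain A L p (cell_size n p + cell_size n q) q"
  using cell_chain_step[OF _ _ _ cell_chain_refl, of p A n L q] by simp

lemma cell_chain_sym: "cell_chain UNIV L p r q \<Longrightarrow> cell_chain UNIV L q r p"
proof (induction rule: cell_chain.induct)
  case (cell_chain_step p n q r z)
  have "cell_chain UNIV L q (cell_size n q + cell_size n p) p"
    using near_sym[OF cell_chain_step.hyps(3)] cell_chain_step.hyps(2) by (rule cell_chain_single[OF UNIV_I, rotated])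
  from cell_chain_trans[OF cell_chain_step.IH this] show ?case
    by (simp add: algebra_simps)
qed (rule cell_chain_refl)

text \<open>A chain has finitely many steps and hence a finest level, which is what the induction in
  \<open>cell_chain_lower_bound\<close> runs on.\<close>

lemma cell_chain_bounded_level: "cell_chain A UNIV p r q \<Longrightarrow> \<exists>m. cell_chain A {..m} p r q"
proof (induction rule: cell_chain.induct)
  case (cell_chain_step p n q r z)
  then obtain m where "cell_chain A {..m} q r z" by blast
  then have "cell_chain A {..max m n} q r z" by (rule cell_chain_mono) auto
  then have "cell_chain A {..max m n} p (cell_size n p + cell_size n q + r) z"
    by (rule cell_chain.cell_chain_step[rotated 3]) (use cell_chain_step in auto)
  then show ?case ..
qed (auto intro: cell_chain_refl)

text \<open>The chain is cut at its first point outside \<open>A\<close>; the part discarded has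
  nonnegative cost.\<close>

lemma cell_chain_exit:
  assumes "cell_chain UNIV L p r z" "p \<in> A" "z \<notin> A"
  shows "\<exists>v r'. r' \<le> r \<and> cell_chain A L p r' v \<and> v \<notin> A"
  using assms
proof (induction rule: cell_chain.induct)
  case (cell_chain_step p n q r z)
  show ?case
  proof (cases "q \<in> A")
    case True
    then obtain v r' where "r' \<le> r" "cell_chain A L q r' v" "v \<notin> A"
      using cell_chain_step by blast
    then show ?thesis
      using cell_chain.cell_chain_step[OF cell_chain_step.prems(1) cell_chain_step.hyps(2,3), of r' v]
      by (intro exI[of _ v] exI[of _ "cell_size n p + cell_size n q + r'"]) simp
  next
    case False
    then show ?thesis
      using cell_chain_single[OF cell_chain_step.prems(1) cell_chain_step.hyps(2,3)] cell_chain_nonneg[OF cell_chain_step.hyps(4)]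
      by (intro exI[of _ q] exI[of _ "cell_size n p + cell_size n q"]) auto
  qed
qed auto

text \<open>A single step at a level outside \<open>L'\<close> already costs \<open>\<tau>\<close>
  through the cell at its starting point. This is how coarse levels are removed: they pay the whole
  bound at once.\<close>

lemma cell_chain_level_dichotomy:
  assumes "cell_chain A L p r v" "\<And>u l. u \<in> A \<Longrightarrow> l \<in> L \<Longrightarrow> l \<notin> L' \<Longrightarrow> \<tau> \<le> cell_size l u"
  shows "\<tau> \<le> r \<or> cell_chain A (L \<inter> L') p r v"
  using assms
proof (induction rule: cell_chain.induct)
  case (cell_chain_step p n q r z)
  have pos: "0 \<le> r" "0 < cell_size n q" "0 < cell_size n p" using cell_chain_step.hyps by (auto simp: cell_chain_nonneg)
  show ?case
  proof (cases "n \<in> L'")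
    case True
    have "\<tau> \<le> r \<or> cell_chain A (L \<inter> L') q r z"
      using cell_chain_step by blast
    then show ?thesis
    proof
      assume "\<tau> \<le> r"
      then have "\<tau> \<le> cell_size n p + cell_size n q + r" using pos by linarith
      then show ?thesis ..
    next
      assume "cell_chain A (L \<inter> L') q r z"
      then show ?thesis
        using cell_chain.cell_chain_step[OF cell_chain_step.hyps(1) _ cell_chain_step.hyps(3), of "L \<inter> L'" r z] True cell_chain_step.hyps(2)
        by blast
    qed
  next
    case False
    then have "\<tau> \<le> cell_size n p" using cell_chain_step by blast
    then have "\<tau> \<le> cell_size n p + cell_size n q + r" using pos by linarith
    then show ?thesis ..
  qed
qed (auto intro: cell_chain_refl)

text \<open>A discrete intermediate value theorem: an integer function that changes by at most 1
  along each step cannot jump over \<open>t\<close>. The chain is split at such a point, with the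
  cost divided accordingly.\<close>

lemma cell_chain_intermediate:
  fixes g :: "real \<times> real \<Rightarrow> int"
  assumes "cell_chain A L x r v"
    and "\<And>p q l. l \<in> L \<Longrightarrow> near 1 l p q \<Longrightarrow> \<bar>g p - g q\<bar> \<le> 1"
    and "g x \<le> t \<and> t \<le> g v \<or> g v \<le> t \<and> t \<le> g x"
  shows "\<exists>p r1 r2. cell_chain A L x r1 p \<and> cell_chain A L p r2 v \<and> r = r1 + r2 \<and> g p = t \<and> (p \<in> A \<or> p = v)"
  using assms
proof (induction rule: cell_chain.induct)
  case (cell_chain_refl p)
  then show ?case by (intro exI[of _ p] exI[of _ 0]) (auto intro: cell_chain.cell_chain_refl)
next
  case (cell_chain_step p n q r z)
  show ?case
  proof (cases "g p = t")
    case True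
    then show ?thesis
      using cell_chain_step.hyps(1) cell_chain_refl[of A L p] cell_chain.cell_chain_step[OF cell_chain_step.hyps(1-4)]
      by (intro exI[of _ p] exI[of _ 0] exI[of _ "cell_size n p + cell_size n q + r"]) simp
  next
    case False
    have "\<bar>g p - g q\<bar> \<le> 1" using cell_chain_step by blast
    then have "g q \<le> t \<and> t \<le> g z \<or> g z \<le> t \<and> t \<le> g q"
      using cell_chain_step.prems(2) False by linarith
    then obtain w r1 r2 where w: "cell_chain A L q r1 w" "cell_chain A L w r2 z" "r = r1 + r2" "g w = t" "w \<in> A \<or> w = z"
      using cell_chain_step by blast
    then show ?thesis
      using cell_chain.cell_chain_step[OF cell_chain_step.hyps(1-3) w(1)]
      by (intro exI[of _ w] exI[of _ "cell_size n p + cell_size n q + r1"] exI[of _ r2]) auto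
  qed
qed

text \<open>Telescoping: a function that is 1-Lipschitz along admissible steps bounds the cost from
  below.\<close>

lemma cell_chain_potential:
  fixes u :: "real \<times> real \<Rightarrow> real"
  assumes "cell_chain A L x r v"
    and "\<And>p q l. p \<in> A \<Longrightarrow> l \<in> L \<Longrightarrow> near 1 l p q \<Longrightarrow> \<bar>u p - u q\<bar> \<le> cell_size l p + cell_size l q"
  shows "\<bar>u x - u v\<bar> \<le> r"
  using assms
proof (induction rule: cell_chain.induct)
  case (cell_chain_step p n q r z)
  have "\<bar>u p - u q\<bar> \<le> cell_size n p + cell_size n q" "\<bar>u q - u z\<bar> \<le> r"
    using cell_chain_step by blast+
  then show ?case by linarith
qed auto

section \<open>Chains have no shortcuts\<close>

text \<open>Within eight levels an exponent of at most 8 becomes at most 16. So this constant times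
  \<open>(1 / 512) ^ n\<close> bounds from below the size of all cells of level \<open>n + 8\<close>
  close to a stopped cell of level \<open>n\<close>.\<close>

definition chain_const :: real where
  "chain_const = (1 / 512) ^ 8 * (1 / 256) ^ 16"

lemma chain_const_pos: "0 < chain_const" and chain_const_le_1: "chain_const \<le> 1"
  by (simp_all add: chain_const_def power_divide)

text \<open>The digits in direction \<open>c\<close> are 0 at the levels \<open>n + 1\<close> to
  \<open>n + 7\<close> and at most 4 at level \<open>n + 8\<close>. All of them belong to the frame,
  so the exponent drops eight times in a row.\<close>

lemma point_exp_slab:
  assumes "point_exp n p \<le> 8" "e * 512 ^ 8 \<le> cell_index (n + 8) (coord c p)" "cell_index (n + 8) (coord c p) \<le> e * 512 ^ 8 + 4"
  shows "point_exp (n + 8) p = 0"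
proof -
  have ixi: "cell_index (n + i) (coord c p) = cell_index (n + 8) (coord c p) div 512 ^ (8 - i)" if "i \<le> 8" for i
    using cell_index_add_div[of "n + i" "8 - i" "coord c p"] that by simp
  obtain d where d: "cell_index (n + 8) (coord c p) = e * 512 ^ 8 + d" "0 \<le> d" "d \<le> 4"
    using assms(2,3) by (intro that[of "cell_index (n + 8) (coord c p) - e * 512 ^ 8"]) auto
  have fr: "frame (cell_index (n + i) (coord c p))" if i: "1 \<le> i" "i \<le> 8" for i
  proof (cases "i = 8")
    case True
    have "e * 512 ^ 8 + d = d + 512 * (e * 512 ^ 7)"
      by simp
    then have "cell_index (n + 8) (coord c p) mod 512 = d mod 512"
      unfolding d(1) by (simp only: mod_mult_self2)
    then show ?thesis
      using d True by (simp add: frame_def)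
  next
    case False
    have pow: "(512::int) ^ 8 = 512 ^ i * 512 ^ (8 - i)"
      using i by (simp flip: power_add)
    have "(512::int) ^ 1 \<le> 512 ^ (8 - i)"
      using False i by (intro power_increasing) auto
    then have "d div 512 ^ (8 - i) = 0"
      using d by (intro div_pos_pos_trivial) auto
    then have "cell_index (n + i) (coord c p) = e * 512 ^ i"
      unfolding ixi[OF i(2)] d(1) pow by (simp flip: mult.assoc)
    moreover have "(512::int) dvd e * 512 ^ i"
      using i by simp
    ultimately show ?thesis
      by (simp add: frame_def)
  qed
  have "point_exp (n + i) p \<le> 8 - i" if "i \<le> 8" for i
    using that
  proof (induction i)
    case (Suc i)
    then show ?case using fr[of "Suc i"] by (auto simp: point_exp_Suc)
  qed (use assms in simp)
  from this[of 8] show ?thesis by simp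
qed

text \<open>A step shorter than the window cannot jump over it. If both ends lie outside, they are
  on the same side and the clamped value does not change; otherwise one end lies in the window and
  pays \<open>D\<close>, while the step has length at most \<open>2 * D\<close>. This is why the
  clamped coordinate is halved.\<close>

lemma clamp_diff_le:
  fixes a b s w D P Q :: real
  assumes "\<bar>a - b\<bar> \<le> 2 * D" "2 * D < w" "0 \<le> P" "0 \<le> Q"
    and "s \<le> a \<Longrightarrow> a < s + w \<Longrightarrow> P = D" "s \<le> b \<Longrightarrow> b < s + w \<Longrightarrow> Q = D"
  shows "\<bar>max s (min a (s + w)) / 2 - max s (min b (s + w)) / 2\<bar> \<le> P + Q"
proof -
  have D: "0 \<le> D" using assms(1) by linarith
  have "\<bar>max s (min a (s + w)) - max s (min b (s + w))\<bar> \<le> \<bar>a - b\<bar>"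
    by linarith
  then have le: "\<bar>max s (min a (s + w)) / 2 - max s (min b (s + w)) / 2\<bar> \<le> D"
    using assms(1) by (simp flip: diff_divide_distrib)
  consider "s \<le> a \<and> a < s + w" | "s \<le> b \<and> b < s + w"
    | "(a < s \<or> s + w \<le> a) \<and> (b < s \<or> s + w \<le> b)" by linarith
  then show ?thesis
  proof cases
    case 1
    then have "P = D" using assms(5) by simp
    then show ?thesis using le assms(4) by linarith
  next
    case 2
    then have "Q = D" using assms(6) by simp
    then show ?thesis using le assms(3) by linarith
  next
    case 3
    then have "a < s \<and> b < s \<or> s + w \<le> a \<and> s + w \<le> b"
      using assms(1,2) by linarith
    then have "max s (min a (s + w)) = max s (min b (s + w))"
      using D assms(2) by auto
    then show ?thesis using assms(3,4) by simp
  qed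
qed

text \<open>If a cell of weight one lies nearby, all weight exponents nearby are at most 8, so the slab
  of first digits zero eight levels further down consists of cells of weight one; the clamped
  coordinate is the potential which forces any chain across the slab to be long.\<close>

lemma cell_chain_cross_stopped:
  fixes e :: int
  assumes cell_chain: "cell_chain A L x r v" "A \<subseteq> {p. near 1 n x p}" "L \<subseteq> {n + 8..}"
    and j: "\<And>p. near 2 n x p \<Longrightarrow> point_exp n p \<le> 8"
    and cross: "cell_index n (coord c x) < e \<and> e < cell_index n (coord c v) \<or> cell_index n (coord c v) < e \<and> e < cell_index n (coord c x)"
  shows "(1 / 512) ^ (n + 8) \<le> r"
proof -
  define m where "m = n + 8"
  define s where "s = of_int e * (1 / 512 :: real) ^ n"
  \<comment> \<open>Five cells of level \<open>m\<close> are as wide as the frame, so the last digit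
    is at most 4 inside the slab. They are also wider than a step of any level from \<open>m\<close>
    on, which reaches at most two cells.\<close>
  define w where "w = 5 * (1 / 512 :: real) ^ m"
  define u where "u p = max s (min (coord c p) (s + w)) / 2" for p
  have w: "0 < w" "w \<le> (1 / 512) ^ n"
    by (simp_all add: w_def m_def power_add power_divide field_simps)
  have stopped: "cell_size l p = (1 / 512) ^ l"
    if p: "near 2 n x p" "s \<le> coord c p" "coord c p < s + w" and l: "m \<le> l" for p l
  proof -
    have "512 ^ m * s = of_int (e * 512 ^ 8)"
      by (simp add: s_def m_def power_add field_simps)
    moreover have "512 ^ m * w = 5"
      by (simp add: w_def field_simps)
    moreover have "512 ^ m * s \<le> 512 ^ m * coord c p" "512 ^ m * coord c p < 512 ^ m * (s + w)"
      using p by auto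
    ultimately have "of_int (e * 512 ^ 8) \<le> 512 ^ m * coord c p"
      "512 ^ m * coord c p < of_int (e * 512 ^ 8 + 5)"
      by (simp_all add: distrib_left)
    then have "e * 512 ^ 8 \<le> cell_index m (coord c p)" "cell_index m (coord c p) < e * 512 ^ 8 + 5"
      unfolding cell_index_def by (simp_all only: le_floor_iff floor_less_iff)
    then have "point_exp m p = 0"
      unfolding m_def using j[OF p(1)] by (intro point_exp_slab) auto
    then have "point_exp l p = 0"
      using l by (rule point_exp_stopped)
    then show ?thesis by (simp add: cell_size_def)
  qed
  have "\<bar>u x - u v\<bar> \<le> r"
  proof (rule cell_chain_potential[OF cell_chain(1)])
    fix p q l
    assume p: "p \<in> A" and l: "l \<in> L" and pq: "near 1 l p q"
    have m: "m \<le> l" using l cell_chain(3) by (auto simp: m_def)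
    have xp: "near 1 n x p" using p cell_chain(2) by auto
    have "near 1 n p q" by (rule near_antimono[OF _ pq]) (use m in \<open>simp add: m_def\<close>)
    from near_trans[OF xp this] have xq: "near 2 n x q" by simp
    have xp: "near 2 n x p" using near_mono[OF xp] by simp
    have diff: "\<bar>coord c p - coord c q\<bar> \<le> 2 * (1 / 512) ^ l"
      using pq by (intro diff_le_cell_index) (simp add: near_def)
    have "(1 / 512 :: real) ^ l \<le> (1 / 512) ^ m"
      using m by (intro power_decreasing) auto
    then have wl: "2 * (1 / 512) ^ l < w"
      unfolding w_def using zero_less_power[of "1 / 512 :: real" m] by linarith
    have nonneg: "0 \<le> cell_size l p" "0 \<le> cell_size l q" by auto
    have p_in: "s \<le> coord c p \<Longrightarrow> coord c p < s + w \<Longrightarrow> cell_size l p = (1 / 512) ^ l"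
      and q_in: "s \<le> coord c q \<Longrightarrow> coord c q < s + w \<Longrightarrow> cell_size l q = (1 / 512) ^ l"
      using stopped[OF xp _ _ m] stopped[OF xq _ _ m] by auto
    show "\<bar>u p - u q\<bar> \<le> cell_size l p + cell_size l q"
      unfolding u_def by (rule clamp_diff_le[OF diff wl nonneg p_in q_in])
  qed
  moreover have "\<bar>u x - u v\<bar> = w / 2"
  proof -
    have lt: "coord c p \<le> s" if "cell_index n (coord c p) < e" for p
    proof -
      have "512 ^ n * coord c p < of_int e"
        using that unfolding cell_index_def floor_less_iff by simp
      then show ?thesis by (simp add: s_def field_simps)
    qed
    have gt: "s + w \<le> coord c p" if "e < cell_index n (coord c p)" for p
    proof -
      have "of_int (e + 1) \<le> 512 ^ n * coord c p"
        using that unfolding cell_index_def by (simp only: flip: le_floor_iff)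
      then have "s + (1 / 512) ^ n \<le> coord c p" by (simp add: s_def field_simps)
      then show ?thesis using w by simp
    qed
    from cross show ?thesis
    proof
      assume "cell_index n (coord c x) < e \<and> e < cell_index n (coord c v)"
      then show ?thesis using lt[of x] gt[of v] w by (simp add: u_def add_divide_distrib)
    next
      assume "cell_index n (coord c v) < e \<and> e < cell_index n (coord c x)"
      then show ?thesis using lt[of v] gt[of x] w by (simp add: u_def add_divide_distrib)
    qed
  qed
  ultimately have "w / 2 \<le> r" by simp
  then show ?thesis
    unfolding w_def m_def using zero_less_power[of "1 / 512 :: real" "n + 8"] by linarith
qed

text \<open>Unless it meets a stopped cell, a chain leaving the block around \<open>x\<close> crosses both sides of
  the frame of a neighbouring cell. Each side costs half of \<open>\<tau>\<close> by induction, so that no factor is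
  lost from one level to the next.\<close>

lemma cell_chain_lower_bound:
  assumes "cell_chain UNIV {..n + k} x r z" "\<not> near 1 n x z"
    and "0 \<le> \<tau>" "\<And>p. near 2 n x p \<Longrightarrow> \<tau> \<le> cell_size n p"
  shows "chain_const * \<tau> \<le> r"
  using assms
proof (induction k arbitrary: n x r z \<tau>)
  case 0
  define A where "A = {p. near 1 n x p}"
  have "x \<in> A" "z \<notin> A" using 0 by (auto simp: A_def)
  then obtain v r' where v: "r' \<le> r" "cell_chain A {..n} x r' v" "v \<notin> A"
    using cell_chain_exit[of "{..n}" x r z A] 0 by auto
  have "\<tau> \<le> cell_size l u" if "u \<in> A" "l \<in> {..n}" for u l
    using 0(4)[of u] near_mono[of 1 n x u 2] cell_size_antimono[of l n u] that by (force simp: A_def)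
  then have "\<tau> \<le> r' \<or> cell_chain A ({..n} \<inter> {}) x r' v"
    using v(2) by (intro cell_chain_level_dichotomy)
  \<comment> \<open>No level is left for a step, so the chain would be trivial, although it leaves
    \<open>A\<close>.\<close>
  moreover have "\<not> cell_chain A ({..n} \<inter> {}) x r' v"
    using \<open>x \<in> A\<close> v(3) by (auto elim: cell_chain.cases)
  ultimately have "\<tau> \<le> r" using v(1) by linarith
  then show ?case
    using mult_right_mono[OF chain_const_le_1 0(3)] by linarith
next
  case (Suc k)
  note \<tau> = Suc.prems(3,4)
  have chain_const_\<tau>: "chain_const * \<tau> \<le> \<tau>"
    using mult_right_mono[OF chain_const_le_1 \<tau>(1)] by simp
  define A where "A = {p. near 1 n x p}"
  have A2: "near 2 n x p" if "p \<in> A" for p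
    using that near_mono[of 1 n x p 2] by (simp add: A_def)
  have "x \<in> A" "z \<notin> A" using Suc.prems by (auto simp: A_def)
  then obtain v r' where v: "r' \<le> r" "cell_chain A {..n + Suc k} x r' v" "v \<notin> A"
    using cell_chain_exit[of "{..n + Suc k}" x r z A] Suc.prems by auto
  define L where "L = {..n + Suc k} \<inter> {n<..}"
  have "\<tau> \<le> cell_size l u" if "u \<in> A" "l \<notin> {n<..}" for u l
    using \<tau>(2)[OF A2[OF that(1)]] cell_size_antimono[of l n u] that by force
  then have "\<tau> \<le> r' \<or> cell_chain A L x r' v"
    unfolding L_def using v(2) by (intro cell_chain_level_dichotomy)
  then show ?case
  proof
    assume "\<tau> \<le> r'"
    then show ?thesis using chain_const_\<tau> v(1) by linarith
  next
    assume cell_chain: "cell_chain A L x r' v"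
    define G where "G c p = cell_index n (coord c p)" for c p
    define g where "g c p = cell_index (Suc n) (coord c p)" for c p
    have gG: "512 * G c p \<le> g c p" "g c p \<le> 512 * G c p + 511" for c p
    proof -
      obtain m i where "g c p = 512 * m + i" "0 \<le> i" "i < 512" "g c p div 512 = m"
        by (rule int_512_cases)
      moreover have "g c p div 512 = G c p"
        unfolding G_def g_def by (rule cell_index_Suc_div)
      ultimately show "512 * G c p \<le> g c p" "g c p \<le> 512 * G c p + 511"
        by linarith+
    qed
    from v(3) obtain c where c: "\<not> \<bar>G c x - G c v\<bar> \<le> 1"
      by (auto simp: A_def near_def G_def)
    define e where "e = (if G c x < G c v then G c x + 1 else G c x - 1)"
    have e: "G c x < e \<and> e < G c v \<or> G c v < e \<and> e < G c x"
      using c by (auto simp: e_def)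
    have "chain_const * \<tau> \<le> r'"
    proof (cases "\<exists>y. near 2 n x y \<and> point_exp n y = 0")
      case True
      then obtain y where y: "near 2 n x y" "point_exp n y = 0" by blast
      \<comment> \<open>\<open>p\<close> and \<open>y\<close> are both within two cells of
        \<open>x\<close>, hence within four of each other, and each cell accounts for at most 2 in
        the exponent.\<close>
      have j: "point_exp n p \<le> 8" if "near 2 n x p" for p
        using point_exp_near[of 4 n p y] near_trans[OF near_sym[OF that] y(1)] y(2) by simp
      have "chain_const * \<tau> \<le> cell_size l u" if "u \<in> A" "l \<notin> {n + 8..}" for u l
      proof -
        have "point_exp (n + 8) u \<le> 16"
          using point_exp_le[of n 8 u] j[OF A2[OF that(1)]] by simp
        then have "(1 / 256 :: real) ^ 16 * (1 / 512) ^ (n + 8) \<le> cell_size (n + 8) u"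
          unfolding cell_size_def by (intro mult_right_mono power_decreasing) auto
        also have "\<dots> \<le> cell_size l u"
          using that by (intro cell_size_antimono) auto
        finally have *: "chain_const * (1 / 512) ^ n \<le> cell_size l u"
          by (simp add: chain_const_def power_add mult_ac)
        have "\<tau> \<le> (1 / 512) ^ n"
          using \<tau>(2)[of x] cell_size_le[of n x] by simp
        then have "chain_const * \<tau> \<le> chain_const * (1 / 512) ^ n"
          using chain_const_pos by (intro mult_left_mono) auto
        with * show ?thesis by linarith
      qed
      with cell_chain have "chain_const * \<tau> \<le> r' \<or> cell_chain A (L \<inter> {n + 8..}) x r' v"
        by (intro cell_chain_level_dichotomy)
      then show ?thesis
      proof
        assume "cell_chain A (L \<inter> {n + 8..}) x r' v"
        then have "(1 / 512) ^ (n + 8) \<le> r'"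
          by (rule cell_chain_cross_stopped[where c = c and e = e])
            (use e j in \<open>auto simp: A_def G_def\<close>)
        moreover have "chain_const * \<tau> \<le> (1 / 512) ^ 8 * (1 / 512) ^ n"
        proof (rule mult_mono)
          show "chain_const \<le> (1 / 512) ^ 8" by (simp add: chain_const_def power_divide)
          show "\<tau> \<le> (1 / 512) ^ n" using \<tau>(2)[of x] cell_size_le[of n x] by simp
        qed (use \<tau>(1) in auto)
        ultimately show ?thesis by (simp add: power_add mult.commute)
      qed
    next
      case False
      \<comment> \<open>The indices 2 and 509 are the third rings on the two sides of column
        \<open>e\<close>; \<open>t True\<close> is the one closer to \<open>x\<close>. A distance of
        two cells from these rings stays within the digits 0 to 4 or 507 to 511, so the
        neighbourhood needed for the induction hypothesis consists of frame cells.\<close>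
      define t where "t up = 512 * e + (if up = (G c x < G c v) then 2 else 509)" for up
      have step: "\<bar>g c p - g c q\<bar> \<le> 1" if "l \<in> L" "near 1 l p q" for p q l
      proof -
        have "near 1 (Suc n) p q"
          by (rule near_antimono[OF _ that(2)]) (use that(1) in \<open>auto simp: L_def\<close>)
        then show ?thesis by (simp add: near_def g_def)
      qed
      have pay: "\<tau> / 2 \<le> cell_size (Suc n) y"
        if p: "p \<in> A" "g c p = t up" and y: "near 2 (Suc n) p y" for p y up
      proof -
        have "near 1 n p y" by (rule near_Suc_imp[OF y]) simp
        with p have xy: "near 2 n x y"
          using near_trans[of 1 n x p 1 y] by (simp add: A_def)
        have "\<bar>g c y - t up\<bar> \<le> 2"
          using y p(2) unfolding near_def g_def by (metis abs_minus_commute)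
        then obtain i where i: "g c y = 512 * e + i" "0 \<le> i \<and> i < 5 \<or> 507 \<le> i \<and> i < 512"
          by (intro that[of "g c y - 512 * e"]) (auto simp: t_def split: if_splits)
        then have "g c y mod 512 = i"
          by (auto simp: i(1))
        with i(2) have "frame (g c y)"
          by (auto simp: frame_def)
        moreover have "point_exp n y \<noteq> 0"
          using False xy by metis
        ultimately have "cell_size (Suc n) y = cell_size n y / 2"
          unfolding g_def by (rule cell_size_frame)
        with \<tau>(2)[OF xy] show ?thesis by simp
      qed
      have ord: "g c x \<le> t True \<and> t True \<le> g c v \<or> g c v \<le> t True \<and> t True \<le> g c x"
        "t True \<le> t False \<and> t False \<le> g c v \<or> g c v \<le> t False \<and> t False \<le> t True"
        and far: "\<bar>t True - t False\<bar> > 1" "\<bar>t False - g c v\<bar> > 1" "\<bar>t True - g c v\<bar> > 1"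
        using e gG[of c x] gG[of c v] by (auto simp: t_def)
      obtain p r1 r2 where p: "cell_chain A L x r1 p" "cell_chain A L p r2 v" "r' = r1 + r2" "g c p = t True"
        "p \<in> A \<or> p = v"
        using cell_chain_intermediate[OF cell_chain, of "g c" "t True"] step ord(1) by blast
      obtain q s1 s2 where q: "cell_chain A L p s1 q" "cell_chain A L q s2 v" "r2 = s1 + s2" "g c q = t False"
        "q \<in> A \<or> q = v"
        using cell_chain_intermediate[OF p(2), of "g c" "t False"] step ord(2)[folded p(4)] by blast
      have pA: "p \<in> A" and qA: "q \<in> A"
        using p(4,5) q(4,5) far by auto
      have L: "cell_chain UNIV {..Suc n + k} a s b" if "cell_chain A L a s b" for a s b
        by (rule cell_chain_mono[OF that]) (auto simp: L_def)
      have "chain_const * (\<tau> / 2) \<le> s1"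
        by (rule Suc.IH[OF L[OF q(1)]])
          (use \<tau>(1) pay[OF pA p(4)] far(1) p(4) q(4) in \<open>auto simp: near_def g_def intro: exI[of _ c]\<close>)
      moreover have "chain_const * (\<tau> / 2) \<le> s2"
        by (rule Suc.IH[OF L[OF q(2)]])
          (use \<tau>(1) pay[OF qA q(4)] far(2) q(4) in \<open>auto simp: near_def g_def intro: exI[of _ c]\<close>)
      moreover have "0 \<le> r1" using p(1) by (rule cell_chain_nonneg)
      ultimately show ?thesis using p(3) q(3) by (simp add: field_simps)
    qed
    then show ?thesis using v(1) by linarith
  qed
qed

section \<open>The chain metric\<close>

abbreviation square :: "(real \<times> real) set" where
  "square \<equiv> {0..1} \<times> {0..1}"

text \<open>Chains may run through the whole plane. This creates no shortcuts, since
  \<open>cell_chain_lower_bound\<close> speaks of all such chains.\<close>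

definition chain_dist :: "real \<times> real \<Rightarrow> real \<times> real \<Rightarrow> real" where
  "chain_dist p q = Inf {r. cell_chain UNIV UNIV p r q}"

definition sup_dist :: "real \<times> real \<Rightarrow> real \<times> real \<Rightarrow> real" where
  "sup_dist p q = max \<bar>fst p - fst q\<bar> \<bar>snd p - snd q\<bar>"

text \<open>The factor 256^4 is the possible loss in size from a cell to those within two cells of
  it, over which \<open>cell_chain_lower_bound\<close> takes the minimum.\<close>

definition dist_const :: real where
  "dist_const = chain_const / 256 ^ 4"

lemma dist_const_pos: "0 < dist_const"
  using chain_const_pos by (simp add: dist_const_def)

lemma sup_dist_nonneg [simp]: "0 \<le> sup_dist p q"
  by (simp add: sup_dist_def)

lemma sup_dist_le_dist: "sup_dist p q \<le> dist p q"
  unfolding sup_dist_def dist_prod_def dist_real_def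
  using real_sqrt_sum_squares_ge1[of "\<bar>fst p - fst q\<bar>" "\<bar>snd p - snd q\<bar>"]
    real_sqrt_sum_squares_ge2[of "\<bar>snd p - snd q\<bar>" "\<bar>fst p - fst q\<bar>"] by simp

lemma dist_le_sup_dist: "dist p q \<le> 2 * sup_dist p q"
proof -
  have "dist p q \<le> \<bar>fst p - fst q\<bar> + \<bar>snd p - snd q\<bar>"
    unfolding dist_prod_def dist_real_def by (rule sqrt_sum_squares_le_sum) auto
  moreover have "\<bar>fst p - fst q\<bar> \<le> sup_dist p q" "\<bar>snd p - snd q\<bar> \<le> sup_dist p q"
    by (simp_all add: sup_dist_def)
  ultimately show ?thesis by linarith
qed

lemma coord_diff_le_sup_dist: "\<bar>coord c p - coord c q\<bar> \<le> sup_dist p q"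
  by (simp add: coord_def sup_dist_def)

lemma near_if_sup_dist_le: "sup_dist p q \<le> (1 / 512) ^ n \<Longrightarrow> near 1 n p q"
  unfolding near_def using order_trans[OF coord_diff_le_sup_dist] cell_index_diff_le by blast

lemma sup_dist_le_if_near:
  assumes "near 1 n p q"
  shows "sup_dist p q \<le> 2 * (1 / 512) ^ n"
proof -
  have "\<bar>coord c p - coord c q\<bar> \<le> 2 * (1 / 512) ^ n" for c
    using assms by (intro diff_le_cell_index) (simp add: near_def)
  from this[of True] this[of False] show ?thesis
    by (simp add: sup_dist_def coord_def)
qed

lemma sup_dist_square: "p \<in> square \<Longrightarrow> q \<in> square \<Longrightarrow> sup_dist p q \<le> 1"
  by (auto simp: sup_dist_def)

lemma near_0_square: "p \<in> square \<Longrightarrow> q \<in> square \<Longrightarrow> near 1 0 p q"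
  using sup_dist_square by (intro near_if_sup_dist_le) simp

lemma chain_dist_le: "cell_chain UNIV UNIV p r q \<Longrightarrow> chain_dist p q \<le> r"
  unfolding chain_dist_def by (rule cInf_lower) (auto intro!: bdd_belowI[of _ 0] dest: cell_chain_nonneg)

lemma chain_dist_le_near: "near 1 n p q \<Longrightarrow> chain_dist p q \<le> cell_size n p + cell_size n q"
  by (intro chain_dist_le cell_chain_single) auto

lemma cell_chain_square: "p \<in> square \<Longrightarrow> q \<in> square \<Longrightarrow> \<exists>r. cell_chain UNIV UNIV p r q"
  using cell_chain_single[of p UNIV 0 UNIV q] near_0_square by blast

lemma le_chain_dist:
  assumes "p \<in> square" "q \<in> square" "\<And>r. cell_chain UNIV UNIV p r q \<Longrightarrow> c \<le> r"
  shows "c \<le> chain_dist p q"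
  unfolding chain_dist_def using cell_chain_square[OF assms(1,2)] assms(3) by (intro cInf_greatest) auto

lemma chain_dist_nonneg: "p \<in> square \<Longrightarrow> q \<in> square \<Longrightarrow> 0 \<le> chain_dist p q"
  by (intro le_chain_dist cell_chain_nonneg)

lemma chain_dist_sym: "chain_dist p q = chain_dist q p"
  unfolding chain_dist_def by (metis cell_chain_sym)

lemma chain_dist_triangle:
  assumes "p \<in> square" "q \<in> square" "z \<in> square"
  shows "chain_dist p z \<le> chain_dist p q + chain_dist q z"
proof -
  have "chain_dist p z - s \<le> chain_dist p q" if s: "cell_chain UNIV UNIV q s z" for s
    using assms chain_dist_le[OF cell_chain_trans[OF _ s]] by (intro le_chain_dist) (auto simp: algebra_simps)
  then have "chain_dist p z - chain_dist p q \<le> chain_dist q z"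
    using assms by (intro le_chain_dist) (auto simp: algebra_simps)
  then show ?thesis by simp
qed

text \<open>65537 = 1 + 256^2, as the adjacent cell is at most 256^2 times as large.\<close>

lemma chain_dist_upper:
  assumes "near 1 n p q"
  shows "chain_dist p q \<le> 65537 * cell_size n p"
  using chain_dist_le_near[OF assms] cell_size_near[of 1 n q p] near_sym[OF assms] by simp

text \<open>The converse to \<open>chain_dist_upper\<close>. As sizes at consecutive levels are
  comparable too, the distance is determined up to a constant by the level at which the two points
  cease to be near.\<close>

lemma chain_dist_lower:
  assumes "p \<in> square" "q \<in> square" "\<not> near 1 n p q"
  shows "dist_const * cell_size n p \<le> chain_dist p q"
proof (rule le_chain_dist[OF assms(1,2)])
  fix r assume "cell_chain UNIV UNIV p r q"
  then obtain m where "cell_chain UNIV {..m} p r q"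
    using cell_chain_bounded_level by blast
  then have "cell_chain UNIV {..n + m} p r q"
    by (rule cell_chain_mono) auto
  moreover have "cell_size n p / 256 ^ 4 \<le> cell_size n z" if "near 2 n p z" for z
    using cell_size_near[of 2 n p z] that by simp
  ultimately have "chain_const * (cell_size n p / 256 ^ 4) \<le> r"
    using assms(3) by (intro cell_chain_lower_bound) auto
  then show "dist_const * cell_size n p \<le> r" by (simp add: dist_const_def)
qed

lemma chain_dist_same: "p \<in> square \<Longrightarrow> chain_dist p p = 0"
  using chain_dist_nonneg[of p p] chain_dist_le[OF cell_chain_refl] by (intro antisym) auto

lemma first_far_level:
  assumes "near 1 n p q" "p \<noteq> q"
  obtains m where "n \<le> m" "near 1 m p q" "\<not> near 1 (Suc m) p q"
proof -
  have "0 < sup_dist p q"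
    using assms(2) by (auto simp: sup_dist_def prod_eq_iff)
  then have "0 < sup_dist p q / 2" by simp
  from real_arch_pow_inv[OF this, of "1 / 512"] obtain k where "(1 / 512) ^ k < sup_dist p q / 2"
    by auto
  then have k: "\<not> near 1 k p q" using sup_dist_le_if_near[of k p q] by auto
  define l where "l = (LEAST l. \<not> near 1 l p q)"
  have l: "\<not> near 1 l p q" unfolding l_def using k by (rule LeastI)
  have "n < l"
  proof (rule ccontr)
    assume "\<not> n < l"
    then show False using near_antimono[of l n p q] assms(1) l by simp
  qed
  then obtain m where m: "l = Suc m" "n \<le> m" by (cases l) auto
  have "near 1 m p q"
    using not_less_Least[of m "\<lambda>l. \<not> near 1 l p q"] m(1) unfolding l_def by simp
  with that m l show thesis by blast
qed

lemma level_of_sup_dist: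
  assumes "0 < sup_dist p q" "sup_dist p q \<le> 1"
  obtains n where "(1 / 512) ^ Suc n < sup_dist p q" "sup_dist p q \<le> (1 / 512) ^ n"
proof -
  obtain k where k: "(1 / 512) ^ k < sup_dist p q"
    using real_arch_pow_inv[OF assms(1), of "1 / 512"] by auto
  define l where "l = (LEAST l. (1 / 512) ^ l < sup_dist p q)"
  have l: "(1 / 512) ^ l < sup_dist p q" unfolding l_def using k by (rule LeastI)
  moreover have "l \<noteq> 0" using l assms(2) by (intro notI) simp
  then obtain n where n: "l = Suc n" by (cases l) auto
  moreover have "\<not> (1 / 512) ^ n < sup_dist p q"
    using not_less_Least[of n "\<lambda>l. (1 / 512) ^ l < sup_dist p q"] n unfolding l_def by simp
  ultimately show thesis using that by simp
qed

lemma sup_dist_pos: "p \<noteq> q \<Longrightarrow> 0 < sup_dist p q"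
  by (auto simp: sup_dist_def prod_eq_iff)

lemma chain_dist_pos:
  assumes "p \<in> square" "q \<in> square" "p \<noteq> q"
  shows "0 < chain_dist p q"
proof -
  obtain m where "\<not> near 1 (Suc m) p q"
    using first_far_level[OF near_0_square] assms by blast
  from chain_dist_lower[OF assms(1,2) this] show ?thesis
    using mult_pos_pos[OF dist_const_pos cell_size_pos[of "Suc m" p]] by linarith
qed

lemma chain_dist_le_sup_dist:
  assumes "p \<in> square" "q \<in> square"
  shows "chain_dist p q \<le> 1024 * sup_dist p q"
proof (cases "p = q")
  case True
  then show ?thesis using assms by (simp add: chain_dist_same)
next
  case False
  obtain n where n: "(1 / 512) ^ Suc n < sup_dist p q" "sup_dist p q \<le> (1 / 512) ^ n"
    using level_of_sup_dist[OF sup_dist_pos[OF False] sup_dist_square] assms by blast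
  have "chain_dist p q \<le> cell_size n p + cell_size n q"
    by (intro chain_dist_le_near near_if_sup_dist_le n)
  also have "\<dots> \<le> (1 / 512) ^ n + (1 / 512) ^ n"
    by (intro add_mono cell_size_le)
  finally show ?thesis using n(1) by simp
qed

text \<open>From level \<open>n\<close> on the cells of \<open>p\<close> have Euclidean size, so the
  bound of \<open>chain_dist_lower\<close> becomes Euclidean. The factor 1024 = 2 * 512 accounts for
  two cells and one level.\<close>

lemma sup_dist_le_chain_dist_stopped:
  assumes "p \<in> square" "q \<in> square" "point_exp n p = 0" "near 1 n p q"
  shows "dist_const / 1024 * sup_dist p q \<le> chain_dist p q"
proof (cases "p = q")
  case True
  then show ?thesis using assms by (simp add: chain_dist_same sup_dist_def)
next
  case False
  obtain m where m: "n \<le> m" "near 1 m p q" "\<not> near 1 (Suc m) p q"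
    using first_far_level[OF assms(4) False] .
  have "point_exp (Suc m) p = 0"
    using assms(3) m(1) by (auto intro: point_exp_stopped)
  then have cell_size: "cell_size (Suc m) p = (1 / 512) ^ Suc m" by (simp add: cell_size_def)
  have "dist_const / 1024 * sup_dist p q \<le> dist_const / 1024 * (2 * (1 / 512) ^ m)"
    using dist_const_pos sup_dist_le_if_near[OF m(2)] by (intro mult_left_mono) auto
  also have "\<dots> = dist_const * cell_size (Suc m) p" by (simp add: cell_size)
  also have "\<dots> \<le> chain_dist p q" by (rule chain_dist_lower[OF assms(1,2) m(3)])
  finally show ?thesis .
qed


text \<open>The locale \<open>Metric_space\<close> demands nonnegativity off the carrier as well,
  hence the extension by 0.\<close>

definition chain_dist0 :: "real \<times> real \<Rightarrow> real \<times> real \<Rightarrow> real" where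
  "chain_dist0 p q = (if p \<in> square \<and> q \<in> square then chain_dist p q else 0)"

lemma Metric_space_chain_dist0: "Metric_space square chain_dist0"
proof
  show "0 \<le> chain_dist0 p q" for p q
    by (auto simp: chain_dist0_def intro: chain_dist_nonneg)
  show "chain_dist0 p q = chain_dist0 q p" for p q
    by (simp add: chain_dist0_def chain_dist_sym conj_commute)
  show "chain_dist0 p q = 0 \<longleftrightarrow> p = q" if "p \<in> square" "q \<in> square" for p q
    using that chain_dist_pos[of p q] chain_dist_same[of p] unfolding chain_dist0_def by (metis less_irrefl)
  show "chain_dist0 p z \<le> chain_dist0 p q + chain_dist0 q z" if "p \<in> square" "q \<in> square" "z \<in> square" for p q z
    using that chain_dist_triangle[of p q z] unfolding chain_dist0_def by simp
qed

definition chain_space :: "(real \<times> real) metric" where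
  "chain_space = metric (square, chain_dist0)"

lemma mspace_chain_space [simp]: "mspace chain_space = square"
  unfolding chain_space_def by (rule Metric_space.mspace_metric[OF Metric_space_chain_dist0])

lemma mdist_chain_space: "p \<in> square \<Longrightarrow> q \<in> square \<Longrightarrow> mdist chain_space p q = chain_dist p q"
  unfolding chain_space_def by (simp only: Metric_space.mdist_metric[OF Metric_space_chain_dist0] chain_dist0_def if_True simp_thms)

lemma mspace_unit_square [simp]: "mspace unit_square = square"
  and mdist_unit_square [simp]: "mdist unit_square = dist"
  and mtopology_unit_square [simp]: "mtopology_of unit_square = top_of_set square"
  by (simp_all add: unit_square_def mtopology_of_submetric)

text \<open>One direction is the Lipschitz bound. For the other, a point closer to \<open>x\<close>
  than \<open>dist_const * cell_size n x\<close> must be near \<open>x\<close> at level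
  \<open>n\<close>; the radius depends on \<open>x\<close>, which suffices for the topology.\<close>

lemma mtopology_chain_space [simp]: "mtopology_of chain_space = top_of_set square"
  unfolding topology_eq
proof
  fix U
  interpret cd: Metric_space square chain_dist0 by (rule Metric_space_chain_dist0)
  have small: "\<exists>r>0. \<forall>y\<in>square. chain_dist x y < r \<longrightarrow> dist x y < e" if x: "x \<in> square" and e: "0 < e" for x e
  proof -
    have "0 < e / 4" using e by simp
    from real_arch_pow_inv[OF this, of "1 / 512"] obtain n where n: "(1 / 512) ^ n < e / 4"
      by auto
    have "dist x y < e" if y: "y \<in> square" "chain_dist x y < dist_const * cell_size n x" for y
    proof -
      have "near 1 n x y" using chain_dist_lower[OF x y(1), of n] y(2) by force
      then show ?thesis using n sup_dist_le_if_near dist_le_sup_dist[of x y] by fastforce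
    qed
    then show ?thesis
      using mult_pos_pos[OF dist_const_pos cell_size_pos[of n x]] by blast
  qed
  have small': "dist x y < r / 1024 \<Longrightarrow> chain_dist x y < r" if "x \<in> square" "y \<in> square" for x y r
    using chain_dist_le_sup_dist[OF that] sup_dist_le_dist[of x y] by simp
  have mb: "cd.mball x r = {y\<in>square. chain_dist x y < r}" if "x \<in> square" for x r
    using that by (auto simp: cd.mball_def chain_dist0_def)
  have "openin cd.mtopology U \<longleftrightarrow> U \<subseteq> square \<and> (\<forall>x\<in>U. \<exists>r>0. \<forall>y\<in>square. chain_dist x y < r \<longrightarrow> y \<in> U)"
    unfolding cd.openin_mtopology using mb by (smt (verit) Collect_subset mem_Collect_eq subset_iff)
  also have "\<dots> \<longleftrightarrow> U \<subseteq> square \<and> (\<forall>x\<in>U. \<exists>e>0. \<forall>y\<in>square. dist y x < e \<longrightarrow> y \<in> U)"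
  proof (intro conj_cong refl ball_cong iffI)
    fix x assume U: "U \<subseteq> square" and x: "x \<in> U"
    then have xs: "x \<in> square" by blast
    { assume "\<exists>r>0. \<forall>y\<in>square. chain_dist x y < r \<longrightarrow> y \<in> U"
      then obtain r where "r > 0" "\<forall>y\<in>square. chain_dist x y < r \<longrightarrow> y \<in> U" by blast
      then show "\<exists>e>0. \<forall>y\<in>square. dist y x < e \<longrightarrow> y \<in> U"
        using small'[OF xs, of _ r] by (intro exI[of _ "r / 1024"]) (auto simp: dist_commute) }
    { assume "\<exists>e>0. \<forall>y\<in>square. dist y x < e \<longrightarrow> y \<in> U"
      then obtain e where "e > 0" "\<forall>y\<in>square. dist y x < e \<longrightarrow> y \<in> U" by blast
      then show "\<exists>r>0. \<forall>y\<in>square. chain_dist x y < r \<longrightarrow> y \<in> U"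
        using small[OF xs, of e] by (metis dist_commute) }
  qed
  also have "\<dots> \<longleftrightarrow> openin (top_of_set square) U"
    by (simp add: openin_euclidean_subtopology_iff)
  finally show "openin (mtopology_of chain_space) U \<longleftrightarrow> openin (top_of_set square) U"
    by (simp add: chain_space_def)
qed

section \<open>Control function and quasisymmetry\<close>

lemma homeomorphic_map_half_line:
  fixes h :: "real \<Rightarrow> real"
  assumes cont: "continuous_on UNIV h" and mono: "strict_mono h" and "h 0 = 0" and surj: "surj h"
  shows "homeomorphic_map (top_of_set {0..}) (top_of_set {0..}) h"
proof -
  have inj: "inj h" using mono by (rule strict_mono_imp_inj_on)
  have hg: "h (inv h y) = y" for y using surj by (rule surj_f_inv_f)
  have gh: "inv h (h x) = x" for x using inj by simp
  have g_mono: "inv h x \<le> inv h y" if "x \<le> y" for x y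
    using that hg strict_mono_less_eq[OF mono] by metis
  have "continuous_on UNIV (inv h)"
    by (rule continuous_onI_mono) (use g_mono inj_imp_surj_inv[OF inj] in auto)
  moreover have "0 \<le> h x \<longleftrightarrow> 0 \<le> x" for x
    using strict_mono_less_eq[OF mono, of 0 x] assms(3) by simp
  moreover have "0 \<le> inv h y \<longleftrightarrow> 0 \<le> y" for y
    using calculation(2)[of "inv h y"] hg by simp
  ultimately have "homeomorphic_maps (top_of_set {0..}) (top_of_set {0..}) h (inv h)"
    using cont hg gh by (auto simp: homeomorphic_maps_def intro: continuous_on_subset)
  then show ?thesis by (auto simp: homeomorphic_map_maps)
qed

text \<open>Sizes at least halve from level to level while Euclidean scales shrink by 512 = 2^9,
  whence the ninth root for small ratios. They shrink by at most 131072 < 512^2, whence the square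
  for large ones. The sum dominates both cases. The slack 2^20 = 4 * 512^2 absorbs the rounding of
  ratios to levels. Writing the square as \<open>t * \<bar>t\<bar>\<close> makes the function odd
  and increasing on the whole line, so that it is onto by the intermediate value theorem.\<close>

definition qs_eta :: "real \<Rightarrow> real" where
  "qs_eta t = (65537 / dist_const) * (root 9 (2 ^ 20 * t) + (2 ^ 20 * t) * \<bar>2 ^ 20 * t\<bar>)"

lemma homeomorphic_qs_eta: "homeomorphic_map (top_of_set {0..}) (top_of_set {0..}) qs_eta"
proof (rule homeomorphic_map_half_line)
  have C: "0 < 65537 / dist_const" using dist_const_pos by simp
  show cont: "continuous_on UNIV qs_eta"
    unfolding qs_eta_def by (intro continuous_intros)
  have sq: "a * \<bar>a\<bar> < b * \<bar>b\<bar>" if "a < b" for a b :: real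
  proof (cases "0 \<le> a")
    case True
    then show ?thesis using that by (simp add: mult_strict_mono')
  next
    case False
    show ?thesis
    proof (cases "0 \<le> b")
      case True
      have "a * \<bar>a\<bar> < 0" using False by (intro mult_neg_pos) auto
      also have "0 \<le> b * \<bar>b\<bar>" using True by simp
      finally show ?thesis .
    next
      case False
      then have "(- b) * (- b) < (- a) * (- a)" using that by (intro mult_strict_mono') auto
      then show ?thesis using False that by simp
    qed
  qed
  show "strict_mono qs_eta"
    unfolding qs_eta_def
    by (intro strict_monoI mult_strict_left_mono[OF _ C] add_strict_mono real_root_less_mono sq) auto
  show "qs_eta 0 = 0" by (simp add: qs_eta_def)
  have odd: "qs_eta (- t) = - qs_eta t" for t
    unfolding qs_eta_def by (simp add: real_root_minus algebra_simps)
  have big: "\<exists>b\<ge>0. y \<le> qs_eta b" if "0 \<le> y" for y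
  proof -
    define b where "b = y * dist_const / 65537 + 1"
    have b: "1 \<le> b" using that dist_const_pos by (simp add: b_def)
    have "y = (65537 / dist_const) * (b - 1)" using dist_const_pos by (simp add: b_def)
    also have "\<dots> \<le> qs_eta b"
      unfolding qs_eta_def
    proof (rule mult_left_mono)
      have "b - 1 \<le> b" by simp
      also have "b \<le> (2 ^ 20 * b) * 1" using b by simp
      also have "\<dots> \<le> (2 ^ 20 * b) * \<bar>2 ^ 20 * b\<bar>" using b by (intro mult_left_mono) auto
      also have "\<dots> \<le> root 9 (2 ^ 20 * b) + (2 ^ 20 * b) * \<bar>2 ^ 20 * b\<bar>" using b by simp
      finally show "b - 1 \<le> \<dots>" .
    qed (use C in simp)
    finally show ?thesis using b by (intro exI[of _ b]) auto
  qed
  show "surj qs_eta"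
    unfolding surj_def
  proof
    fix y :: real
    obtain b where b: "b \<ge> 0" "\<bar>y\<bar> \<le> qs_eta b" using big[of "\<bar>y\<bar>"] by auto
    have "\<exists>x\<ge>- b. x \<le> b \<and> qs_eta x = y"
      by (rule IVT') (use b odd[of b] in \<open>auto intro: continuous_on_subset[OF cont]\<close>)
    then show "\<exists>x. y = qs_eta x" by blast
  qed
qed

text \<open>Both distances are compared with sizes of cells containing the common point
  \<open>x\<close>. Only the difference of the two levels then matters, and \<open>t\<close>
  determines that difference up to a bounded error.\<close>

lemma chain_dist_ratio:
  assumes "x \<in> square" "y \<in> square" "z \<in> square" "x \<noteq> y" "x \<noteq> z"
  shows "chain_dist x y / chain_dist x z \<le> qs_eta (dist x y / dist x z)"
proof -
  define t where "t = dist x y / dist x z"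
  obtain n where n: "(1 / 512) ^ Suc n < sup_dist x y" "sup_dist x y \<le> (1 / 512) ^ n"
    by (rule level_of_sup_dist[OF sup_dist_pos[OF assms(4)] sup_dist_square[OF assms(1,2)]])
  obtain m where m: "near 1 m x z" "\<not> near 1 (Suc m) x z"
    by (rule first_far_level[OF near_0_square[OF assms(1,3)] assms(5)])
  have up: "chain_dist x y \<le> 65537 * cell_size n x"
    by (intro chain_dist_upper near_if_sup_dist_le n)
  have low: "dist_const * cell_size (Suc m) x \<le> chain_dist x z"
    using assms m(2) by (intro chain_dist_lower)
  have "chain_dist x y / chain_dist x z \<le> (65537 * cell_size n x) / (dist_const * cell_size (Suc m) x)"
    using up low dist_const_pos assms by (intro frac_le) (auto simp: chain_dist_nonneg)
  then have ratio: "chain_dist x y / chain_dist x z \<le> 65537 / dist_const * (cell_size n x / cell_size (Suc m) x)"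
    by simp
  have dz: "dist x z \<le> 4 * (1 / 512) ^ m" "0 < dist x z"
    using sup_dist_le_if_near[OF m(1)] dist_le_sup_dist[of x z] assms by auto
  have "(1 / 512) ^ Suc n / (4 * (1 / 512) ^ m) \<le> t"
    unfolding t_def using n(1) sup_dist_le_dist[of x y] dz by (intro frac_le) auto
  then have t: "512 ^ Suc m / 512 ^ n \<le> 2 ^ 20 * t"
    by (simp add: field_simps)
  then have t0: "0 < 2 ^ 20 * t"
    by (rule less_le_trans[rotated]) simp
  have nonneg: "0 \<le> root 9 (2 ^ 20 * t)" "0 \<le> (2 ^ 20 * t) * \<bar>2 ^ 20 * t\<bar>"
    using t0 by (simp_all add: real_root_ge_zero)
  have "cell_size n x / cell_size (Suc m) x \<le> root 9 (2 ^ 20 * t) + (2 ^ 20 * t) * \<bar>2 ^ 20 * t\<bar>"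
  proof (cases "Suc m \<le> n")
    case True
    then obtain k where k: "n = Suc m + k" using le_Suc_ex by blast
    have "cell_size n x / cell_size (Suc m) x \<le> (1 / 2) ^ k"
      using cell_size_add_le[of "Suc m" k x] unfolding k by (simp add: field_simps)
    also have "(1 / 2 :: real) ^ k = root 9 (((1 / 2) ^ k) ^ 9)"
      by (simp add: real_root_power_cancel)
    also have "((1 / 2 :: real) ^ k) ^ 9 = ((1 / 2) ^ 9) ^ k"
      by (simp add: power_mult[symmetric] mult.commute)
    also have "\<dots> = 512 ^ Suc m / 512 ^ n"
      by (simp add: k power_add field_simps)
    also have "root 9 \<dots> \<le> root 9 (2 ^ 20 * t)"
      using t by (intro real_root_le_mono) auto
    finally show ?thesis using nonneg by linarith
  next
    case False
    then obtain k where k: "Suc m = n + k" using le_Suc_ex[of n "Suc m"] by auto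
    have "cell_size n x / cell_size (Suc m) x \<le> 131072 ^ k"
      using cell_size_le_add[of n x k] unfolding k by (simp add: field_simps)
    also have "\<dots> \<le> (512 * 512) ^ k"
      by (intro power_mono) auto
    also have "\<dots> = (512 ^ Suc m / 512 ^ n) * (512 ^ Suc m / 512 ^ n)"
      unfolding k by (simp add: power_add flip: power_mult_distrib)
    also have "\<dots> \<le> (2 ^ 20 * t) * (2 ^ 20 * t)"
      using t t0 by (intro mult_mono) auto
    also have "\<dots> = (2 ^ 20 * t) * \<bar>2 ^ 20 * t\<bar>"
      using t0 by simp
    finally show ?thesis using nonneg by linarith
  qed
  then have "65537 / dist_const * (cell_size n x / cell_size (Suc m) x) \<le> qs_eta t"
    unfolding qs_eta_def using dist_const_pos by (intro mult_left_mono) auto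
  with ratio show ?thesis by (simp add: t_def)
qed

lemma quasisymmetric_chain_space: "quasisymmetric unit_square chain_space id"
  unfolding quasisymmetric_def
proof (intro conjI exI[of _ qs_eta] ballI impI)
  show "homeomorphic_map (mtopology_of unit_square) (mtopology_of chain_space) id"
    by (simp add: homeomorphic_map_id)
  show "homeomorphic_map (top_of_set {0..}) (top_of_set {0..}) qs_eta"
    by (rule homeomorphic_qs_eta)
qed (auto simp: mdist_chain_space intro: chain_dist_ratio)

section \<open>The Hausdorff measure as a measure\<close>

lemma outer_measure_space_subadditive:
  assumes "outer_measure_space (Pow M) f" "A \<subseteq> M" "B \<subseteq> M"
  shows "f (A \<union> B) \<le> f A + f B"
proof -
  interpret sigma_algebra M "Pow M" by (rule sigma_algebra_Pow)
  have "subadditive (Pow M) f"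
    using assms(1) unfolding outer_measure_space_def by (intro countably_subadditive_subadditive) auto
  then have "f (A \<union> (B - A)) \<le> f A + f (B - A)"
    by (rule subadditiveD) (use assms(2,3) in auto)
  also have "f (B - A) \<le> f B"
    using assms unfolding outer_measure_space_def by (intro increasingD[of "Pow M" f]) auto
  finally show ?thesis by simp
qed

lemma ennreal_suminf_tail_le:
  fixes a :: "nat \<Rightarrow> ennreal"
  assumes "(\<Sum>k. a k) < \<infinity>" "0 < e"
  shows "\<exists>n. (\<Sum>k. a (k + n)) \<le> ennreal e"
proof -
  define r where "r k = enn2real (a k)" for k
  have a: "a k = ennreal (r k)" for k
    using ennreal_suminf_lessD[of a \<infinity> k] assms(1) by (simp add: r_def)
  have r0: "0 \<le> r k" for k by (simp add: r_def)
  have summ: "summable r"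
    using assms(1) r0 by (intro summable_suminf_not_top) (simp_all add: a)
  from suminf_exist_split[OF assms(2) summ] obtain N where "norm (\<Sum>i. r (i + N)) < e"
    by blast
  moreover have "(\<Sum>k. a (k + N)) = ennreal (\<Sum>i. r (i + N))"
    unfolding a using r0 summable_ignore_initial_segment[OF summ] by (intro suminf_ennreal2) auto
  ultimately show ?thesis by (intro exI[of _ N]) (auto intro: ennreal_leI)
qed

text \<open>Caratheodory's criterion: the points of \<open>T \<inter> U\<close> are layered by their distance to the
  complement of \<open>U\<close>; every second layer is separated, so the outer measures of the layers
  are summable.\<close>

lemma metric_outer_measure_open:
  fixes f :: "'a set \<Rightarrow> ennreal"
  assumes oms: "outer_measure_space (Pow (mspace X)) f"
    and add: "\<And>A B e. A \<subseteq> mspace X \<Longrightarrow> B \<subseteq> mspace X \<Longrightarrow> 0 < e \<Longrightarrow>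
      (\<And>a b. a \<in> A \<Longrightarrow> b \<in> B \<Longrightarrow> e \<le> mdist X a b) \<Longrightarrow> f A + f B \<le> f (A \<union> B)"
    and U: "openin (mtopology_of X) U"
  shows "U \<in> lambda_system (mspace X) (Pow (mspace X)) f"
proof -
  interpret Metric_space "mspace X" "mdist X" by (rule Metric_space_mspace_mdist)
  let ?M = "mspace X"
  have UM: "U \<subseteq> ?M" using openin_subset[OF U] by simp
  have f0: "f {} = 0" and inc: "A \<subseteq> B \<Longrightarrow> B \<subseteq> ?M \<Longrightarrow> f A \<le> f B" for A B
    using oms by (auto simp: outer_measure_space_def positive_def increasing_def)
  have csub: "f (\<Union>i. A i) \<le> (\<Sum>i. f (A i))"
    if "range A \<subseteq> Pow ?M" "disjoint_family A" for A :: "nat \<Rightarrow> 'a set"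
  proof -
    have "(\<Union>i. A i) \<in> Pow ?M" using that(1) by blast
    then show ?thesis
      using oms that unfolding outer_measure_space_def countably_subadditive_def by blast
  qed
  have main: "f (T \<inter> U) + f (T - U) \<le> f T" if T: "T \<subseteq> ?M" for T
  proof (cases "f T = \<infinity>")
    case False
    define D where "D n = {x \<in> T \<inter> U. \<forall>y\<in>?M - U. 1 / real (Suc n) \<le> mdist X x y}" for n
    have DT: "D n \<subseteq> T \<inter> U" for n by (auto simp: D_def)
    have D_mono: "D n \<subseteq> D m" if "n \<le> m" for n m
    proof -
      have "1 / real (Suc m) \<le> 1 / real (Suc n)"
        using that by (intro divide_left_mono) auto
      then show ?thesis unfolding D_def using order_trans by blast
    qed
    have D_Un: "\<exists>n. x \<in> D n" if x: "x \<in> T \<inter> U" for x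
    proof -
      have "openin mtopology U" using U by (simp add: mtopology_of_def)
      then obtain r where r: "0 < r" "mball x r \<subseteq> U"
        using x by (auto simp: openin_mtopology)
      obtain n where n: "1 / real (Suc n) < r"
        by (rule nat_approx_posE[OF r(1)])
      have "1 / real (Suc n) \<le> mdist X x y" if y: "y \<in> ?M - U" for y
      proof (rule ccontr)
        assume "\<not> 1 / real (Suc n) \<le> mdist X x y"
        then have "y \<in> mball x r" using n x y UM by auto
        then show False using r(2) y by blast
      qed
      then show ?thesis using x by (auto simp: D_def)
    qed
    have D_out: "f (D n) + f (T - U) \<le> f T" for n
    proof -
      have "f (D n) + f (T - U) \<le> f (D n \<union> (T - U))"
        by (rule add[of _ _ "1 / real (Suc n)"]) (use T in \<open>auto simp: D_def\<close>)
      also have "\<dots> \<le> f T" by (rule inc) (use T in \<open>auto simp: D_def\<close>)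
      finally show ?thesis .
    qed
    \<comment> \<open>A point outside \<open>D (Suc n)\<close> is closer than 1/(n+2) to the
      complement of \<open>U\<close>, while points of \<open>D n\<close> keep a distance of at least
      1/(n+1); the triangle inequality leaves the difference as a gap.\<close>
    have sep: "f A + f B \<le> f (A \<union> B)" if A: "A \<subseteq> D n" and B: "B \<subseteq> T \<inter> U - D (Suc n)" for A B n
    proof (rule add[of _ _ "1 / real (Suc n) - 1 / real (Suc (Suc n))"])
      have "1 / real (Suc (Suc n)) < 1 / real (Suc n)"
        by (intro divide_strict_left_mono) auto
      then show "0 < 1 / real (Suc n) - 1 / real (Suc (Suc n))" by simp
      fix a b assume ab: "a \<in> A" "b \<in> B"
      then have "b \<in> T \<inter> U" "b \<notin> D (Suc n)" using B by auto
      then have "\<not> (\<forall>y\<in>?M - U. 1 / real (Suc (Suc n)) \<le> mdist X b y)"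
        unfolding D_def by blast
      then obtain y where y: "y \<in> ?M - U" "mdist X b y < 1 / real (Suc (Suc n))"
        using not_le by blast
      have "1 / real (Suc n) \<le> mdist X a y" using ab(1) A y(1) by (auto simp: D_def)
      also have "\<dots> \<le> mdist X a b + mdist X b y"
        using ab A B y T D_def by (intro triangle) auto
      finally show "1 / real (Suc n) - 1 / real (Suc (Suc n)) \<le> mdist X a b"
        using y(2) by linarith
    qed (use A B T D_def in auto)
    define R where "R k = D (Suc k) - D k" for k
    have R_disjoint: "disjoint_family (\<lambda>k. R (k + n))" for n
      unfolding disjoint_family_on_def
    proof (intro ballI impI)
      fix k l :: nat assume "k \<noteq> l"
      then have "D (Suc (k + n)) \<subseteq> D (l + n) \<or> D (Suc (l + n)) \<subseteq> D (k + n)"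
        using D_mono[of "Suc (k + n)" "l + n"] D_mono[of "Suc (l + n)" "k + n"] by linarith
      then show "R (k + n) \<inter> R (l + n) = {}" unfolding R_def by blast
    qed
    \<comment> \<open>Layers of equal parity leave one index between them, so the union of the
      earlier ones lies in some \<open>D k\<close> whose successor \<open>D (Suc k)\<close> is
      disjoint from the next layer, and \<open>sep\<close> applies.\<close>
    have half: "(\<Sum>k<m. f (R (2 * k + c))) \<le> f (\<Union>k<m. R (2 * k + c))" for m c
    proof (induction m)
      case (Suc m)
      show ?case
      proof (cases m)
        case 0
        then show ?thesis by (simp add: lessThan_Suc)
      next
        case (Suc l)
        have "(\<Union>k<m. R (2 * k + c)) \<subseteq> D (2 * l + c + 1)"
        proof (rule UN_least)
          fix k assume "k \<in> {..<m}"
          then have "D (Suc (2 * k + c)) \<subseteq> D (2 * l + c + 1)" using Suc by (intro D_mono) auto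
          then show "R (2 * k + c) \<subseteq> D (2 * l + c + 1)" by (auto simp: R_def)
        qed
        moreover have "R (2 * m + c) \<subseteq> T \<inter> U - D (Suc (2 * l + c + 1))"
          using Suc DT by (auto simp: R_def)
        ultimately have "f (\<Union>k<m. R (2 * k + c)) + f (R (2 * m + c))
            \<le> f ((\<Union>k<m. R (2 * k + c)) \<union> R (2 * m + c))"
          by (rule sep)
        from order_trans[OF add_right_mono[OF Suc.IH] this] show ?thesis
          by (simp add: lessThan_Suc Un_commute add.commute)
      qed
    qed (simp add: f0)
    have RT: "(\<Union>k\<in>K. R (g k)) \<subseteq> T" for K and g :: "nat \<Rightarrow> nat"
      using DT by (auto simp: R_def)
    have Rn: "(\<Union>k. R (k + n)) \<subseteq> T" for n
      using DT by (auto simp: R_def)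
    have half': "(\<Sum>k<m. f (R (2 * k + c))) \<le> f T" for m c
      using half inc[OF RT T] by (rule order_trans)
    have "(\<Sum>k<n. f (R k)) \<le> 2 * f T" for n
    proof -
      have "(\<Sum>k<2 * m. f (R k)) = (\<Sum>k<m. f (R (2 * k + 0))) + (\<Sum>k<m. f (R (2 * k + 1)))" for m
        by (induction m) (simp_all add: algebra_simps)
      then have "(\<Sum>k<2 * n. f (R k)) \<le> 2 * f T"
        using add_mono[OF half'[of 0 n] half'[of 1 n]] by (simp add: mult_2)
      moreover have "(\<Sum>k<n. f (R k)) \<le> (\<Sum>k<2 * n. f (R k))"
        by (intro sum_mono2) auto
      ultimately show ?thesis by (rule order_trans[rotated])
    qed
    then have "(\<Sum>k. f (R k)) \<le> 2 * f T"
      by (intro suminf_le_const) auto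
    moreover have "2 * f T < \<infinity>" using False by (simp add: ennreal_mult_less_top less_top)
    ultimately have fin: "(\<Sum>k. f (R k)) < \<infinity>" by (rule le_less_trans)
    show ?thesis
    proof (rule ennreal_le_epsilon)
      fix e :: real assume "0 < e"
      then obtain n where n: "(\<Sum>k. f (R (k + n))) \<le> ennreal e"
        using ennreal_suminf_tail_le[OF fin] by blast
      have "T \<inter> U \<subseteq> D n \<union> (\<Union>k. R (k + n))"
      proof
        fix x assume x: "x \<in> T \<inter> U"
        define m where "m = (LEAST m. x \<in> D m)"
        have m: "x \<in> D m" unfolding m_def using D_Un[OF x] by (rule LeastI_ex)
        show "x \<in> D n \<union> (\<Union>k. R (k + n))"
        proof (cases "m \<le> n")
          case True
          then show ?thesis using m D_mono by blast
        next
          case False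
          then obtain k where k: "m = Suc (k + n)" using less_imp_Suc_add[of n m] by (auto simp: add.commute)
          have "x \<notin> D (k + n)"
            using not_less_Least[of "k + n" "\<lambda>m. x \<in> D m"] k unfolding m_def by simp
          then show ?thesis using m k by (auto simp: R_def)
        qed
      qed
      then have "f (T \<inter> U) \<le> f (D n \<union> (\<Union>k. R (k + n)))"
        using Rn[of n] DT[of n] T by (intro inc) auto
      also have "\<dots> \<le> f (D n) + f (\<Union>k. R (k + n))"
        using Rn[of n] DT[of n] T
        by (intro outer_measure_space_subadditive[OF oms]) auto
      also have "f (\<Union>k. R (k + n)) \<le> (\<Sum>k. f (R (k + n)))"
        using RT T R_disjoint[of n] by (intro csub) (auto simp: R_def D_def)
      also have "\<dots> \<le> ennreal e" by (rule n)
      finally have "f (T \<inter> U) \<le> f (D n) + ennreal e" by simp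
      then have "f (T \<inter> U) + f (T - U) \<le> f (D n) + ennreal e + f (T - U)"
        by (rule add_right_mono)
      also have "\<dots> = (f (D n) + f (T - U)) + ennreal e" by (simp add: ac_simps)
      also have "\<dots> \<le> f T + ennreal e" by (intro add_right_mono D_out)
      finally show "f (T \<inter> U) + f (T - U) \<le> f T + ennreal e" .
    qed
  qed simp
  have "f (U \<inter> T) + f ((?M - U) \<inter> T) = f T" if T: "T \<subseteq> ?M" for T
  proof (rule antisym)
    have eq: "(?M - U) \<inter> T = T - U" using T by blast
    show "f (U \<inter> T) + f ((?M - U) \<inter> T) \<le> f T"
      using main[OF T] unfolding eq by (simp add: Int_commute)
    have "f T = f (U \<inter> T \<union> (T - U))" by (rule arg_cong[where f = f]) blast
    also have "\<dots> \<le> f (U \<inter> T) + f (T - U)"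
      using T UM by (intro outer_measure_space_subadditive[OF oms]) auto
    finally show "f T \<le> f (U \<inter> T) + f ((?M - U) \<inter> T)" unfolding eq .
  qed
  then show ?thesis using UM by (auto simp: lambda_system_def)
qed

section \<open>Hausdorff content and the Hausdorff outer measure\<close>

lemma ediam_empty [simp]: "ediam X {} = 0"
  by (simp add: ediam_def bot_ennreal)

lemma ediam_leI: "(\<And>x y. x \<in> A \<Longrightarrow> y \<in> A \<Longrightarrow> ennreal (mdist X x y) \<le> c) \<Longrightarrow> ediam X A \<le> c"
  unfolding ediam_def by (intro SUP_least) auto

lemma mdist_le_ediam: "x \<in> A \<Longrightarrow> y \<in> A \<Longrightarrow> ennreal (mdist X x y) \<le> ediam X A"
  unfolding ediam_def by (intro SUP_upper2[of "(x, y)"]) auto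

lemma hausdorff2_pre_le:
  assumes "range U \<subseteq> Pow (mspace X)" "A \<subseteq> (\<Union>i. U i)" "\<And>i. ediam X (U i) \<le> ennreal \<delta>"
  shows "hausdorff2_pre X \<delta> A \<le> (\<Sum>i. ennreal (pi / 4) * (ediam X (U i))\<^sup>2)"
  unfolding hausdorff2_pre_def using assms by (intro INF_lower) auto

lemma hausdorff2_pre_mono: "A \<subseteq> B \<Longrightarrow> hausdorff2_pre X \<delta> A \<le> hausdorff2_pre X \<delta> B"
  unfolding hausdorff2_pre_def by (intro INF_superset_mono) auto

lemma hausdorff2_pre_antimono: "\<delta> \<le> \<delta>' \<Longrightarrow> hausdorff2_pre X \<delta>' A \<le> hausdorff2_pre X \<delta> A"
  unfolding hausdorff2_pre_def
  by (intro INF_superset_mono) (auto intro: order_trans ennreal_leI)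

lemma hausdorff2_pre_empty: "hausdorff2_pre X \<delta> {} = 0"
  using hausdorff2_pre_le[of "\<lambda>_. {}" X "{}" \<delta>] by simp

lemma hausdorff2_pre_Union:
  "hausdorff2_pre X \<delta> (\<Union>i. A i) \<le> (\<Sum>n. hausdorff2_pre X \<delta> (A n))"
proof (rule ennreal_le_epsilon)
  fix e :: real assume "0 < e" and fin: "(\<Sum>n. hausdorff2_pre X \<delta> (A n)) < top"
  let ?g = "\<lambda>U. ennreal (pi / 4) * (ediam X U)\<^sup>2"
  let ?P = "\<lambda>U n. range U \<subseteq> Pow (mspace X) \<and> A n \<subseteq> (\<Union>i. U i) \<and> (\<forall>i. ediam X (U i) \<le> ennreal \<delta>)"
  have "\<exists>U. ?P U n \<and> (\<Sum>i. ?g (U i)) \<le> hausdorff2_pre X \<delta> (A n) + e * (1 / 2) ^ Suc n" for n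
  proof -
    have "hausdorff2_pre X \<delta> (A n) < hausdorff2_pre X \<delta> (A n) + e * (1 / 2) ^ Suc n"
      using ennreal_suminf_lessD[OF fin, of n] \<open>0 < e\<close> by auto
    then obtain U where "?P U n" "(\<Sum>i. ?g (U i)) < hausdorff2_pre X \<delta> (A n) + e * (1 / 2) ^ Suc n"
      by (subst (asm) (1) hausdorff2_pre_def) (auto simp del: ennreal_suminf_cmult simp: INF_less_iff)
    then show ?thesis by (intro exI[of _ U] conjI[OF _ less_imp_le])
  qed
  then obtain U where U: "\<And>n. ?P (U n) n"
    "\<And>n. (\<Sum>i. ?g (U n i)) \<le> hausdorff2_pre X \<delta> (A n) + e * (1 / 2) ^ Suc n"
    by metis
  define V where "V = case_prod U \<circ> prod_decode"
  have "hausdorff2_pre X \<delta> (\<Union>i. A i) \<le> (\<Sum>i. ?g (V i))"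
  proof (rule hausdorff2_pre_le)
    show "range V \<subseteq> Pow (mspace X)" using U(1) by (fastforce simp: V_def split: prod.split)
    show "ediam X (V i) \<le> ennreal \<delta>" for i using U(1) by (simp add: V_def split: prod.split)
    show "(\<Union>i. A i) \<subseteq> (\<Union>i. V i)"
    proof
      fix x assume "x \<in> (\<Union>i. A i)"
      then obtain n i where "x \<in> U n i" using U(1) by blast
      then have "x \<in> V (prod_encode (n, i))" by (simp add: V_def)
      then show "x \<in> (\<Union>i. V i)" by blast
    qed
  qed
  also have "\<dots> = (\<Sum>n. \<Sum>i. ?g (U n i))"
    using suminf_ennreal_2dimen[of "\<lambda>n. \<Sum>i. ?g (U n i)" "\<lambda>(n, i). ?g (U n i)"]
    by (simp add: V_def split_beta)
  also have "\<dots> \<le> (\<Sum>n. hausdorff2_pre X \<delta> (A n) + e * (1 / 2) ^ Suc n)"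
    using U(2) by (intro suminf_le) auto
  also have "\<dots> = (\<Sum>n. hausdorff2_pre X \<delta> (A n)) + (\<Sum>n. ennreal e * ennreal ((1 / 2) ^ Suc n))"
    using \<open>0 < e\<close> by (subst suminf_add[symmetric])
      (auto simp del: ennreal_suminf_cmult simp add: ennreal_mult[symmetric])
  also have "\<dots> = (\<Sum>n. hausdorff2_pre X \<delta> (A n)) + e"
    unfolding ennreal_suminf_cmult
    by (subst suminf_ennreal_eq[OF zero_le_power power_half_series]) auto
  finally show "hausdorff2_pre X \<delta> (\<Union>i. A i) \<le> (\<Sum>n. hausdorff2_pre X \<delta> (A n)) + e" .
qed

text \<open>A covering set of diameter at most \<open>\<delta>\<close> cannot meet both
  \<open>A\<close> and \<open>B\<close>. Emptying the members that miss \<open>A\<close>,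
  respectively \<open>B\<close>, splits the cover without using any member twice.\<close>

lemma hausdorff2_pre_separated:
  assumes sep: "\<And>a b. a \<in> A \<Longrightarrow> b \<in> B \<Longrightarrow> e \<le> mdist X a b" and "0 \<le> \<delta>" "\<delta> < e"
  shows "hausdorff2_pre X \<delta> A + hausdorff2_pre X \<delta> B \<le> hausdorff2_pre X \<delta> (A \<union> B)"
  unfolding hausdorff2_pre_def[of X \<delta> "A \<union> B"]
proof (rule INF_greatest)
  let ?g = "\<lambda>U. ennreal (pi / 4) * (ediam X U)\<^sup>2"
  fix U :: "nat \<Rightarrow> _"
  assume "U \<in> {U. range U \<subseteq> Pow (mspace X) \<and> A \<union> B \<subseteq> (\<Union>i. U i) \<and> (\<forall>i. ediam X (U i) \<le> ennreal \<delta>)}"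
  then have U: "range U \<subseteq> Pow (mspace X)" "A \<union> B \<subseteq> (\<Union>i. U i)" "\<And>i. ediam X (U i) \<le> ennreal \<delta>"
    by auto
  define V where "V C i = (if U i \<inter> C = {} then {} else U i)" for C i
  have pre: "hausdorff2_pre X \<delta> C \<le> (\<Sum>i. ?g (V C i))" if "C \<subseteq> A \<union> B" for C
  proof (rule hausdorff2_pre_le)
    show "range (V C) \<subseteq> Pow (mspace X)" using U(1) by (auto simp: V_def)
    show "C \<subseteq> (\<Union>i. V C i)"
    proof
      fix x assume "x \<in> C"
      then obtain i where "x \<in> U i" using U(2) \<open>C \<subseteq> A \<union> B\<close> by blast
      with \<open>x \<in> C\<close> have "x \<in> V C i" by (auto simp: V_def)
      then show "x \<in> (\<Union>i. V C i)" by blast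
    qed
    show "ediam X (V C i) \<le> ennreal \<delta>" for i using U(3) by (simp add: V_def)
  qed
  have split: "?g (V A i) + ?g (V B i) \<le> ?g (U i)" for i
  proof -
    have "U i \<inter> A = {} \<or> U i \<inter> B = {}"
    proof (rule ccontr)
      assume "\<not> (U i \<inter> A = {} \<or> U i \<inter> B = {})"
      then obtain a b where ab: "a \<in> U i" "a \<in> A" "b \<in> U i" "b \<in> B" by blast
      then have "ennreal e \<le> ennreal (mdist X a b)" by (intro ennreal_leI sep)
      also have "\<dots> \<le> ennreal \<delta>" using mdist_le_ediam[OF ab(1,3)] U(3) by (rule order_trans)
      finally show False using assms(2,3) by simp
    qed
    then show ?thesis by (auto simp: V_def)
  qed
  have "hausdorff2_pre X \<delta> A + hausdorff2_pre X \<delta> B \<le> (\<Sum>i. ?g (V A i)) + (\<Sum>i. ?g (V B i))"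
    by (intro add_mono pre) auto
  also have "\<dots> = (\<Sum>i. ?g (V A i) + ?g (V B i))"
    by (intro suminf_add) auto
  also have "\<dots> \<le> (\<Sum>i. ?g (U i))"
    using split by (intro suminf_le) auto
  finally show "hausdorff2_pre X \<delta> A + hausdorff2_pre X \<delta> B \<le> (\<Sum>i. ?g (U i))" .
qed

lemma hausdorff2_pre_le_outer: "0 < \<delta> \<Longrightarrow> hausdorff2_pre X \<delta> A \<le> hausdorff2_outer X A"
  unfolding hausdorff2_outer_def by (intro SUP_upper) auto

lemma outer_measure_space_hausdorff2:
  "outer_measure_space (Pow (mspace X)) (hausdorff2_outer X)"
  unfolding outer_measure_space_def positive_def increasing_def countably_subadditive_def
proof (intro conjI ballI allI impI)
  show "hausdorff2_outer X {} = 0"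
    by (simp add: hausdorff2_outer_def hausdorff2_pre_empty)
  show "hausdorff2_outer X A \<le> hausdorff2_outer X B" if "A \<subseteq> B" for A B
    unfolding hausdorff2_outer_def using that by (intro SUP_mono' hausdorff2_pre_mono)
  show "hausdorff2_outer X (\<Union>i. A i) \<le> (\<Sum>i. hausdorff2_outer X (A i))" for A :: "nat \<Rightarrow> _"
    unfolding hausdorff2_outer_def[of X "\<Union>i. A i"]
  proof (rule SUP_least)
    fix \<delta> :: real assume "\<delta> \<in> {0<..}"
    then show "hausdorff2_pre X \<delta> (\<Union>i. A i) \<le> (\<Sum>i. hausdorff2_outer X (A i))"
      by (intro order_trans[OF hausdorff2_pre_Union] suminf_le hausdorff2_pre_le_outer) auto
  qed
qed

text \<open>Contents increase as the scale decreases, so both suprema may be taken along a common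
  scale, and this scale may be assumed to lie below \<open>e\<close>.\<close>

lemma hausdorff2_outer_separated:
  assumes "0 < e" "\<And>a b. a \<in> A \<Longrightarrow> b \<in> B \<Longrightarrow> e \<le> mdist X a b"
  shows "hausdorff2_outer X A + hausdorff2_outer X B \<le> hausdorff2_outer X (A \<union> B)"
proof -
  have "hausdorff2_outer X A + hausdorff2_outer X B =
      (SUP \<delta>\<in>{0<..}. hausdorff2_pre X \<delta> A + hausdorff2_pre X \<delta> B)"
    unfolding hausdorff2_outer_def
  proof (rule SUP_add_directed_ennreal[symmetric])
    fix a b :: real assume "a \<in> {0<..}" "b \<in> {0<..}"
    then show "\<exists>c\<in>{0<..}. hausdorff2_pre X a A + hausdorff2_pre X b B
        \<le> hausdorff2_pre X c A + hausdorff2_pre X c B"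
      by (intro bexI[of _ "min a b"] add_mono hausdorff2_pre_antimono) auto
  qed
  also have "\<dots> \<le> hausdorff2_outer X (A \<union> B)"
  proof (rule SUP_least)
    fix \<delta> :: real assume \<delta>: "\<delta> \<in> {0<..}"
    define \<epsilon> where "\<epsilon> = min \<delta> (e / 2)"
    have \<epsilon>: "0 < \<epsilon>" "\<epsilon> \<le> \<delta>" "\<epsilon> < e" using \<delta> assms(1) by (auto simp: \<epsilon>_def)
    have "hausdorff2_pre X \<delta> A + hausdorff2_pre X \<delta> B \<le> hausdorff2_pre X \<epsilon> A + hausdorff2_pre X \<epsilon> B"
      by (intro add_mono hausdorff2_pre_antimono \<epsilon>)
    also have "\<dots> \<le> hausdorff2_pre X \<epsilon> (A \<union> B)"
      using assms(2) \<epsilon> by (intro hausdorff2_pre_separated) auto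
    also have "\<dots> \<le> hausdorff2_outer X (A \<union> B)"
      using \<epsilon> by (intro hausdorff2_pre_le_outer)
    finally show "hausdorff2_pre X \<delta> A + hausdorff2_pre X \<delta> B \<le> hausdorff2_outer X (A \<union> B)" .
  qed
  finally show ?thesis .
qed

text \<open>Without this fact \<open>measure_of\<close> would fall back to the zero measure, and
  \<open>hausdorff2\<close> would carry no information.\<close>

lemma measure_space_hausdorff2:
  "measure_space (mspace X) (sigma_sets (mspace X) {U. openin (mtopology_of X) U}) (hausdorff2_outer X)"
proof -
  let ?L = "lambda_system (mspace X) (Pow (mspace X)) (hausdorff2_outer X)"
  have L: "measure_space (mspace X) ?L (hausdorff2_outer X)"
    by (rule sigma_algebra.caratheodory_lemma[OF sigma_algebra_Pow outer_measure_space_hausdorff2])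
  have op: "{U. openin (mtopology_of X) U} \<subseteq> ?L"
  proof
    fix U assume "U \<in> {U. openin (mtopology_of X) U}"
    then have "openin (mtopology_of X) U" by simp
    then show "U \<in> ?L"
      by (rule metric_outer_measure_open[OF outer_measure_space_hausdorff2, rotated])
        (rule hausdorff2_outer_separated)
  qed
  have sub: "{U. openin (mtopology_of X) U} \<subseteq> Pow (mspace X)"
    using openin_subset[of "mtopology_of X"] by auto
  have "sigma_algebra (mspace X) ?L" using L by (simp add: measure_space_def)
  then have "sigma_sets (mspace X) {U. openin (mtopology_of X) U} \<subseteq> ?L"
    using op by (rule sigma_algebra.sigma_sets_subset)
  then show ?thesis
    by (intro measure_down[OF L] sigma_algebra_sigma_sets sub)
qed

lemma openin_subset_Pow: "{U. openin (mtopology_of X) U} \<subseteq> Pow (mspace X)"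
  using openin_subset[of "mtopology_of X"] by auto

lemma space_hausdorff2 [simp]: "space (hausdorff2 X) = mspace X"
  unfolding hausdorff2_def by (rule space_measure_of[OF openin_subset_Pow])

lemma sets_hausdorff2: "sets (hausdorff2 X) = sigma_sets (mspace X) {U. openin (mtopology_of X) U}"
  unfolding hausdorff2_def by (rule sets_measure_of[OF openin_subset_Pow])

lemma emeasure_hausdorff2:
  assumes "A \<in> sets (hausdorff2 X)"
  shows "emeasure (hausdorff2 X) A = hausdorff2_outer X A"
proof (rule emeasure_measure_of[OF hausdorff2_def openin_subset_Pow])
  show "A \<in> sets (hausdorff2 X)" by (rule assms)
qed (use measure_space_hausdorff2[of X] in \<open>auto simp: measure_space_def sets_hausdorff2\<close>)

section \<open>Hausdorff measure against Lebesgue measure\<close>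

lemma interval_subset_pieces:
  fixes a t x :: real
  assumes "a \<le> x" "x \<le> a + real n * t" "0 \<le> t" "0 < n"
  shows "\<exists>i<n. a + real i * t \<le> x \<and> x \<le> a + real i * t + t"
  using assms
proof (induction n)
  case (Suc n)
  show ?case
  proof (cases "n = 0 \<or> a + real n * t \<le> x")
    case True
    then show ?thesis using Suc.prems by (intro exI[of _ n]) (auto simp: algebra_simps)
  next
    case False
    then obtain i where "i < n" "a + real i * t \<le> x" "x \<le> a + real i * t + t"
      using Suc by force
    then show ?thesis by (intro exI[of _ i]) auto
  qed
qed auto

text \<open>Cutting the box into \<open>k * k\<close> equal boxes makes the diameters as small as
  desired, while the sum of their squares stays at most \<open>C\<^sup>2 * h\<^sup>2\<close>; the
  normalizing factor \<open>pi / 4\<close> is estimated by 1.\<close>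

lemma hausdorff2_outer_box:
  fixes X :: "(real \<times> real) metric"
  assumes sub: "{a..a + h} \<times> {b..b + h} \<subseteq> mspace X" and h: "0 \<le> h" and C: "0 \<le> C"
    and le: "\<And>p q. p \<in> {a..a + h} \<times> {b..b + h} \<Longrightarrow> q \<in> {a..a + h} \<times> {b..b + h} \<Longrightarrow>
      mdist X p q \<le> C * sup_dist p q"
  shows "hausdorff2_outer X ({a..a + h} \<times> {b..b + h}) \<le> ennreal (C\<^sup>2 * h\<^sup>2)"
  unfolding hausdorff2_outer_def
proof (rule SUP_least)
  fix \<delta> :: real assume "\<delta> \<in> {0<..}"
  then have \<delta>: "0 < \<delta>" by simp
  let ?Q = "{a..a + h} \<times> {b..b + h}"
  obtain k :: nat where k: "C * h / \<delta> < real k"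
    using reals_Archimedean2 by blast
  have "0 \<le> C * h / \<delta>" using \<delta> h C by simp
  then have k0: "0 < k" using k by (intro gr0I) auto
  define t where "t = h / real k"
  have t: "0 \<le> t" "real k * t = h" using h k0 by (simp_all add: t_def)
  have Ct: "C * t \<le> \<delta>" using k k0 \<delta> by (simp add: t_def field_simps)
  define P where "P i j = {a + real i * t..a + real i * t + t} \<times> {b + real j * t..b + real j * t + t}" for i j
  define U where "U i = (if i < k * k then P (i div k) (i mod k) else {})" for i
  have P_sub: "P i j \<subseteq> ?Q" if "i < k" "j < k" for i j
  proof -
    have step: "0 \<le> real n * t \<and> real n * t + t \<le> h" if "n < k" for n
    proof -
      have "real (Suc n) * t \<le> real k * t" using that t(1) by (intro mult_right_mono) auto
      then show ?thesis using t by (simp add: algebra_simps)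
    qed
    have "0 \<le> real i * t" "real i * t + t \<le> h" "0 \<le> real j * t" "real j * t + t \<le> h"
      using step that by blast+
    then have "{a + real i * t..a + real i * t + t} \<subseteq> {a..a + h}"
      "{b + real j * t..b + real j * t + t} \<subseteq> {b..b + h}"
      by (auto simp del: zero_le_mult_iff)
    then show ?thesis unfolding P_def by blast
  qed
  have U_sub: "U i \<subseteq> ?Q" for i
    using P_sub[of "i div k" "i mod k"] k0 by (auto simp: U_def less_mult_imp_div_less)
  have diam: "ediam X (U i) \<le> ennreal (C * t)" for i
  proof (rule ediam_leI)
    fix p q assume pq: "p \<in> U i" "q \<in> U i"
    then have "sup_dist p q \<le> t" by (auto simp: U_def P_def sup_dist_def split: if_splits)
    then have "mdist X p q \<le> C * t"
      using le[of p q] U_sub pq C by (meson mult_left_mono order_trans subsetD)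
    then show "ennreal (mdist X p q) \<le> ennreal (C * t)" by (rule ennreal_leI)
  qed
  have "hausdorff2_pre X \<delta> ?Q \<le> (\<Sum>i. ennreal (pi / 4) * (ediam X (U i))\<^sup>2)"
  proof (rule hausdorff2_pre_le)
    show "range U \<subseteq> Pow (mspace X)" using U_sub sub by blast
    show "ediam X (U i) \<le> ennreal \<delta>" for i using diam Ct by (meson ennreal_leI order_trans)
    show "?Q \<subseteq> (\<Union>i. U i)"
    proof
      fix p assume "p \<in> ?Q"
      then have p: "a \<le> fst p" "fst p \<le> a + real k * t" "b \<le> snd p" "snd p \<le> b + real k * t"
        using t by auto
      obtain i where i: "i < k" "a + real i * t \<le> fst p" "fst p \<le> a + real i * t + t"
        using interval_subset_pieces[OF p(1,2) t(1) k0] by blast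
      obtain j where j: "j < k" "b + real j * t \<le> snd p" "snd p \<le> b + real j * t + t"
        using interval_subset_pieces[OF p(3,4) t(1) k0] by blast
      have "i * k + j < k * k"
      proof -
        have "i * k + j < Suc i * k" using j(1) by simp
        also have "\<dots> \<le> k * k" using i(1) by (intro mult_right_mono) auto
        finally show ?thesis .
      qed
      then have "p \<in> U (i * k + j)"
        using i j k0 by (auto simp: U_def P_def mem_Times_iff)
      then show "p \<in> (\<Union>i. U i)" by blast
    qed
  qed
  also have "\<dots> = (\<Sum>i<k * k. ennreal (pi / 4) * (ediam X (U i))\<^sup>2)"
    by (rule suminf_finite) (auto simp: U_def)
  also have "\<dots> \<le> (\<Sum>i<k * k. ennreal ((C * t)\<^sup>2))"
  proof (rule sum_mono)
    fix i
    have "ennreal (pi / 4) * (ediam X (U i))\<^sup>2 \<le> ennreal 1 * (ennreal (C * t))\<^sup>2"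
      using pi_less_4 diam by (intro mult_mono ennreal_leI power_mono) auto
    then show "ennreal (pi / 4) * (ediam X (U i))\<^sup>2 \<le> ennreal ((C * t)\<^sup>2)"
      using C t by (simp add: ennreal_power)
  qed
  also have "\<dots> = ennreal (real (k * k) * (C * t)\<^sup>2)"
    by (simp add: ennreal_of_nat_eq_real_of_nat ennreal_mult)
  also have "real (k * k) * (C * t)\<^sup>2 = C\<^sup>2 * h\<^sup>2"
    using k0 by (simp add: t_def power2_eq_square)
  finally show "hausdorff2_pre X \<delta> ?Q \<le> ennreal (C\<^sup>2 * h\<^sup>2)" .
qed

lemma emeasure_lborel_box2:
  assumes "0 \<le> r"
  shows "emeasure lborel ({x - r..x + r} \<times> {y - r..y + r :: real}) = ennreal (4 * r\<^sup>2)"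
proof -
  have "emeasure (lborel \<Otimes>\<^sub>M lborel) ({x - r..x + r} \<times> {y - r..y + r :: real})
      = emeasure lborel {x - r..x + r} * emeasure lborel {y - r..y + r}"
    by (rule lborel.emeasure_pair_measure_Times) auto
  then show ?thesis
    using assms by (simp add: lborel_prod power2_eq_square flip: ennreal_mult)
qed

text \<open>The part of \<open>A\<close> in a covering set of diameter \<open>D\<close> lies in a
  Euclidean square of side \<open>2 * D / c\<close>. The factor 1/8 times its area is
  \<open>D\<^sup>2 / 2\<close> after multiplication by \<open>c\<^sup>2\<close>, which is below the
  Hausdorff weight \<open>pi / 4 * D\<^sup>2\<close>. The scale 1 is enough, since any one scale
  bounds the supremum from below.\<close>

lemma lborel_le_hausdorff2_outer:
  fixes X :: "(real \<times> real) metric"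
  assumes A: "A \<subseteq> mspace X" and c: "0 < c"
    and le: "\<And>p q. p \<in> A \<Longrightarrow> q \<in> A \<Longrightarrow> c * sup_dist p q \<le> mdist X p q"
  shows "ennreal (c\<^sup>2 / 8) * emeasure lborel A \<le> hausdorff2_outer X A"
proof -
  have "ennreal (c\<^sup>2 / 8) * emeasure lborel A \<le> hausdorff2_pre X 1 A"
    unfolding hausdorff2_pre_def
  proof (rule INF_greatest)
    fix U :: "nat \<Rightarrow> _"
    assume "U \<in> {U. range U \<subseteq> Pow (mspace X) \<and> A \<subseteq> (\<Union>i. U i) \<and> (\<forall>i. ediam X (U i) \<le> ennreal 1)}"
    then have U: "A \<subseteq> (\<Union>i. U i)" "\<And>i. ediam X (U i) \<le> ennreal 1" by auto
    define D where "D i = enn2real (ediam X (U i))" for i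
    have D: "ediam X (U i) = ennreal (D i)" "0 \<le> D i" for i
      using le_less_trans[OF U(2)[of i] ennreal_less_top] by (simp_all add: D_def)
    define p where "p i = (SOME p. p \<in> A \<inter> U i)" for i
    define r where "r i = D i / c" for i
    have r: "0 \<le> r i" for i using D c by (simp add: r_def)
    define B where "B i = {fst (p i) - r i..fst (p i) + r i} \<times> {snd (p i) - r i..snd (p i) + r i}" for i
    have "A \<subseteq> (\<Union>i. B i)"
    proof
      fix q assume q: "q \<in> A"
      then obtain i where i: "q \<in> U i" using U(1) by blast
      then have p: "p i \<in> A \<inter> U i" unfolding p_def some_in_eq using q by auto
      have "ennreal (mdist X (p i) q) \<le> ennreal (D i)"
        using mdist_le_ediam[of "p i" "U i" q X] p i D(1)[of i] by simp
      then have "c * sup_dist (p i) q \<le> D i"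
        using le[of "p i" q] p q D(2)[of i] by simp
      then have "sup_dist (p i) q \<le> r i" using c by (simp add: r_def field_simps)
      then have "q \<in> B i" by (auto simp: B_def sup_dist_def mem_Times_iff)
      then show "q \<in> (\<Union>i. B i)" by blast
    qed
    moreover have B_meas: "B i \<in> sets lborel" for i
      unfolding B_def by (simp add: borel_closed closed_Times)
    ultimately have "emeasure lborel A \<le> emeasure lborel (\<Union>i. B i)"
      by (intro emeasure_mono sets.countable_UN) auto
    also have "\<dots> \<le> (\<Sum>i. emeasure lborel (B i))"
      using B_meas by (intro emeasure_subadditive_countably) auto
    also have "\<dots> = (\<Sum>i. ennreal (4 * (r i)\<^sup>2))"
      unfolding B_def using r by (simp add: emeasure_lborel_box2)
    finally have "ennreal (c\<^sup>2 / 8) * emeasure lborel A \<le> ennreal (c\<^sup>2 / 8) * (\<Sum>i. ennreal (4 * (r i)\<^sup>2))"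
      by (intro mult_left_mono) auto
    also have "\<dots> = (\<Sum>i. ennreal (c\<^sup>2 / 8) * ennreal (4 * (r i)\<^sup>2))"
      by simp
    also have "\<dots> \<le> (\<Sum>i. ennreal (pi / 4) * (ediam X (U i))\<^sup>2)"
    proof (rule suminf_le)
      fix i
      have "c\<^sup>2 / 8 * (4 * (r i)\<^sup>2) = (D i)\<^sup>2 / 2"
        using c by (simp add: r_def power_divide)
      also have "\<dots> \<le> pi / 4 * (D i)\<^sup>2"
        using mult_right_mono[of "1 / 2" "pi / 4" "(D i)\<^sup>2"] pi_gt3 by simp
      finally show "ennreal (c\<^sup>2 / 8) * ennreal (4 * (r i)\<^sup>2) \<le> ennreal (pi / 4) * (ediam X (U i))\<^sup>2"
        unfolding D(1) using D(2)[of i] by (simp add: ennreal_power ennreal_leI flip: ennreal_mult)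
    qed auto
    finally show "ennreal (c\<^sup>2 / 8) * emeasure lborel A \<le> (\<Sum>i. ennreal (pi / 4) * (ediam X (U i))\<^sup>2)" .
  qed
  also have "\<dots> \<le> hausdorff2_outer X A"
    by (rule hausdorff2_pre_le_outer) simp
  finally show ?thesis .
qed

lemma locally_finite_chain_space: "locally_finite_hausdorff2 chain_space"
proof -
  have "hausdorff2_outer chain_space ({0..0 + 1} \<times> {0..0 + 1}) \<le> ennreal (1024\<^sup>2 * 1\<^sup>2)"
    by (rule hausdorff2_outer_box) (auto simp: mdist_chain_space intro!: chain_dist_le_sup_dist)
  then have *: "hausdorff2_outer chain_space square < \<infinity>"
    by (auto simp: less_top[symmetric] top_unique)
  have "emeasure (hausdorff2 chain_space) A < \<infinity>" for A
  proof -
    have "emeasure (hausdorff2 chain_space) A \<le> emeasure (hausdorff2 chain_space) (space (hausdorff2 chain_space))"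
      by (rule emeasure_space)
    also have "\<dots> = hausdorff2_outer chain_space square"
      using emeasure_hausdorff2[OF sets.top, of chain_space] by simp
    finally show ?thesis using * by (rule le_less_trans)
  qed
  then show ?thesis
    unfolding locally_finite_hausdorff2_def by (auto intro: exI[of _ 1])
qed

text \<open>Both metrics induce the Euclidean topology on the square, so a density measurable for
  either Hausdorff measure is Borel in the usual sense, and Lebesgue integration applies to
  it.\<close>

lemma sets_hausdorff2_top_of_set:
  fixes S :: "'a::topological_space set"
  assumes "mspace X = S" "mtopology_of X = top_of_set S" "S \<in> sets borel"
  shows "sets (hausdorff2 X) = sets (restrict_space borel S)"
proof -
  have "{U. openin (top_of_set S) U} = (\<inter>) S ` {U. open U}"
    by (auto simp: openin_open)
  then have "sets (hausdorff2 X) = sigma_sets S ((\<inter>) S ` {U. open U})"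
    by (simp add: sets_hausdorff2 assms(1,2))
  also have "\<dots> = (\<inter>) S ` sigma_sets UNIV {U. open U}"
    using assms(3) by (intro sigma_sets_Int[symmetric]) (auto simp: borel_def)
  also have "\<dots> = sets (restrict_space borel S)"
    by (simp add: sets_restrict_space borel_def)
  finally show ?thesis .
qed

section \<open>The stopped set\<close>

definition cell :: "nat \<Rightarrow> int \<Rightarrow> int \<Rightarrow> (real \<times> real) set" where
  "cell n a b = {p. cell_index n (fst p) = a \<and> cell_index n (snd p) = b}"

definition stopped :: "(real \<times> real) set" where
  "stopped = {p. \<exists>n. point_exp n p = 0}"

lemma cell_index_eq_iff: "cell_index n t = a \<longleftrightarrow> of_int a / 512 ^ n \<le> t \<and> t < (of_int a + 1) / 512 ^ n"
  unfolding cell_index_def floor_eq_iff by (auto simp: field_simps)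

lemma cell_eq:
  "cell n a b = {of_int a / 512 ^ n..<(of_int a + 1) / 512 ^ n} \<times> {of_int b / 512 ^ n..<(of_int b + 1) / 512 ^ n}"
  by (auto simp: cell_def cell_index_eq_iff)

lemma measurable_cell_index [measurable]: "cell_index n \<in> borel \<rightarrow>\<^sub>M count_space UNIV"
  unfolding cell_index_def by measurable

lemma measurable_point_exp [measurable]: "point_exp n \<in> borel \<rightarrow>\<^sub>M count_space UNIV"
proof -
  have "(\<lambda>p. weight_exp n (cell_index n (fst p)) (cell_index n (snd p))) \<in> borel \<Otimes>\<^sub>M borel \<rightarrow>\<^sub>M count_space UNIV"
    by measurable
  then show ?thesis by (simp add: point_exp_def[abs_def] borel_prod)
qed

lemma cell_measurable [measurable]: "cell n a b \<in> sets borel"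
proof -
  have "{of_int a / 512 ^ n..<(of_int a + 1) / 512 ^ n} \<times> {of_int b / 512 ^ n..<(of_int b + 1) / 512 ^ n}
      \<in> sets (borel \<Otimes>\<^sub>M borel :: (real \<times> real) measure)"
    by measurable
  then show ?thesis by (simp only: cell_eq borel_prod)
qed

lemma stopped_measurable [measurable]: "stopped \<in> sets borel"
  unfolding stopped_def by measurable

lemma emeasure_cell: "emeasure lborel (cell n a b) = ennreal ((1 / 512) ^ n * (1 / 512) ^ n)"
proof -
  have side: "emeasure lborel {of_int c / 512 ^ n..<(of_int c + 1) / 512 ^ n :: real} = ennreal ((1 / 512) ^ n)" for c
    by (subst emeasure_lborel_Ico) (auto simp: field_simps)
  have "emeasure (lborel \<Otimes>\<^sub>M lborel) (cell n a b)
      = emeasure lborel {of_int a / 512 ^ n..<(of_int a + 1) / 512 ^ n :: real}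
        * emeasure lborel {of_int b / 512 ^ n..<(of_int b + 1) / 512 ^ n :: real}"
    unfolding cell_eq by (rule lborel.emeasure_pair_measure_Times) auto
  then show ?thesis
    unfolding side lborel_prod by (simp only: ennreal_mult[symmetric] zero_le_power zero_le_divide_1_iff zero_le_numeral)
qed

lemma indicator_cell:
  "(indicator (cell n a b) p :: ennreal) =
    (\<Sum>(d, e)\<in>{0..<512} \<times> {0..<512}. indicator (cell (Suc n) (512 * a + d) (512 * b + e)) p)"
proof -
  define d e where "d = cell_index (Suc n) (fst p) mod 512" and "e = cell_index (Suc n) (snd p) mod 512"
  have de: "d \<in> {0..<512}" "e \<in> {0..<512}" by (simp_all add: d_def e_def)
  have eq: "p \<in> cell (Suc n) (512 * a + d') (512 * b + e') \<longleftrightarrow>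
      p \<in> cell n a b \<and> d' = d \<and> e' = e" if "d' \<in> {0..<512}" "e' \<in> {0..<512}" for d' e'
  proof -
    have split: "x = 512 * c + i \<longleftrightarrow> x div 512 = c \<and> x mod 512 = i" if "i \<in> {0..<512}" for x c i :: int
      using that by auto
    show ?thesis
      using split[OF that(1)] split[OF that(2)]
      by (auto simp: cell_def d_def e_def cell_index_Suc_div)
  qed
  have "(\<Sum>(d', e')\<in>{0..<512} \<times> {0..<512}.
      (indicator (cell (Suc n) (512 * a + d') (512 * b + e')) p :: ennreal))
      = (\<Sum>q\<in>{0..<512} \<times> {0..<512}. if q = (d, e) then indicator (cell n a b) p else 0)"
    by (rule sum.cong) (auto simp: eq indicator_def split: prod.splits)
  also have "\<dots> = indicator (cell n a b) p"
    using de by (simp add: sum.delta)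
  finally show ?thesis ..
qed

lemma frame_mult_add: "frame (512 * a + d) \<longleftrightarrow> frame d"
  by (simp add: frame_def)

lemma sum_frame:
  fixes x y :: real
  shows "(\<Sum>(d, e)\<in>{0..<512} \<times> {0..<512}. if frame d \<or> frame e then x else y) = 10140 * x + 252004 * y"
proof -
  let ?D = "{0..<512::int}" let ?I = "{5..<507::int}"
  have fr: "frame d \<longleftrightarrow> d \<notin> ?I" if "d \<in> ?D" for d
    using that by (auto simp: frame_def)
  have "(\<Sum>(d, e)\<in>?D \<times> ?D. if frame d \<or> frame e then x else y)
      = (\<Sum>q\<in>?D \<times> ?D. if q \<in> ?I \<times> ?I then y else x)"
  proof (rule sum.cong)
    fix q assume "q \<in> ?D \<times> ?D"
    then obtain d e where "q = (d, e)" "d \<in> ?D" "e \<in> ?D" by blast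
    then show "(case q of (d, e) \<Rightarrow> if frame d \<or> frame e then x else y) = (if q \<in> ?I \<times> ?I then y else x)"
      using fr by (simp only: prod.case mem_Sigma_iff) simp
  qed simp
  also have "\<dots> = (\<Sum>q\<in>?I \<times> ?I. y) + (\<Sum>q\<in>?D \<times> ?D - ?I \<times> ?I. x)"
  proof -
    have "?D \<times> ?D \<inter> {q. q \<in> ?I \<times> ?I} = ?I \<times> ?I" "?D \<times> ?D \<inter> - {q. q \<in> ?I \<times> ?I} = ?D \<times> ?D - ?I \<times> ?I"
      by auto
    then show ?thesis by (simp add: sum.If_cases)
  qed
  also have "card (?D \<times> ?D - ?I \<times> ?I) = 10140"
    by (subst card_Diff_subset) (auto simp: card_cartesian_product)
  then have "(\<Sum>q\<in>?I \<times> ?I. y) + (\<Sum>q\<in>?D \<times> ?D - ?I \<times> ?I. x) = 10140 * x + 252004 * y"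
    by (simp add: card_cartesian_product)
  finally show ?thesis .
qed

text \<open>Exactly \<open>512\<^sup>2 - 502\<^sup>2 = 10140\<close> of the \<open>512\<^sup>2\<close> children of a cell are frame cells. They are
  so rare that \<open>16\<^sup>-\<^sup>k\<close> is a supermartingale for the exponent \<open>k\<close>, which even decays
  geometrically off the stopped cells.\<close>

definition exp_weight :: "bool \<Rightarrow> nat \<Rightarrow> real" where
  "exp_weight c j = (if c \<and> j = 0 then 0 else (1 / 16) ^ j)"

text \<open>At positive exponents the average over the children is below 11/16 of the parent's
  weight in either case. At exponent 0 the flag decides: the weight stays 1, which forces rate 1, or
  has been set to 0.\<close>

definition exp_weight_rate :: "bool \<Rightarrow> real" where
  "exp_weight_rate c = (if c then 11 / 16 else 1)"

lemma exp_weight_nonneg [simp]: "0 \<le> exp_weight c j"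
  by (simp add: exp_weight_def)

lemma sum_children:
  "(\<Sum>(d, e)\<in>{0..<512} \<times> {0..<512}. exp_weight c (weight_exp (Suc n) (512 * a + d) (512 * b + e)))
    \<le> exp_weight_rate c * 512\<^sup>2 * exp_weight c (weight_exp n a b)"
proof -
  define j where "j = weight_exp n a b"
  have "(\<Sum>(d, e)\<in>{0..<512} \<times> {0..<512}. exp_weight c (weight_exp (Suc n) (512 * a + d) (512 * b + e)))
      = (\<Sum>(d, e)\<in>{0..<512} \<times> {0..<512}. if frame d \<or> frame e then exp_weight c (j - 1)
          else exp_weight c (if j = 0 then 0 else Suc j))"
    by (rule sum.cong) (auto simp: Let_def frame_mult_add j_def)
  also have "\<dots> = 10140 * exp_weight c (j - 1) + 252004 * exp_weight c (if j = 0 then 0 else Suc j)"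
    by (rule sum_frame)
  also have "\<dots> \<le> exp_weight_rate c * 512\<^sup>2 * exp_weight c j"
  proof (cases j)
    case 0
    then show ?thesis by (simp add: exp_weight_def exp_weight_rate_def)
  next
    case (Suc i)
    have "exp_weight c i \<le> (1 / 16) ^ i" "0 \<le> (1 / 16 :: real) ^ i" by (simp_all add: exp_weight_def)
    then have "10140 * exp_weight c i + 252004 * ((1 / 16) ^ i / 256) \<le> 11 / 16 * 262144 * ((1 / 16) ^ i / 16)"
      by linarith
    moreover have "(1 / 16 :: real) ^ Suc (Suc i) = (1 / 16) ^ i / 256" "(1 / 16 :: real) ^ Suc i = (1 / 16) ^ i / 16"
      "(512 :: real)\<^sup>2 = 262144"
      by simp_all
    ultimately have "10140 * exp_weight c i + 252004 * (1 / 16) ^ Suc (Suc i) \<le> 11 / 16 * 512\<^sup>2 * (1 / 16) ^ Suc i"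
      by (simp only:)
    also have "\<dots> \<le> exp_weight_rate c * 512\<^sup>2 * (1 / 16) ^ Suc i"
      by (intro mult_right_mono) (auto simp: exp_weight_rate_def)
    finally show ?thesis using Suc by (simp add: exp_weight_def)
  qed
  finally show ?thesis by (simp add: j_def)
qed

text \<open>The recursion is on the first level below the cell: the cell is split into its children,
  the induction hypothesis is applied to each with one level fewer, and \<open>sum_children\<close>
  averages the results. This is why the cell is left arbitrary in the induction.\<close>

lemma nn_integral_cell_exp_weight:
  "(\<integral>\<^sup>+p. ennreal (exp_weight c (point_exp (n + k) p)) * indicator (cell n a b) p \<partial>lborel)
    \<le> ennreal (exp_weight_rate c ^ k * (1 / 512) ^ n * (1 / 512) ^ n * exp_weight c (weight_exp n a b))"
proof (induction k arbitrary: n a b)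
  case 0
  have "(\<integral>\<^sup>+p. ennreal (exp_weight c (point_exp (n + 0) p)) * indicator (cell n a b) p \<partial>lborel)
      = (\<integral>\<^sup>+p. ennreal (exp_weight c (weight_exp n a b)) * indicator (cell n a b) p \<partial>lborel)"
    by (intro nn_integral_cong) (auto simp: cell_def point_exp_def indicator_def)
  also have "\<dots> = ennreal (exp_weight c (weight_exp n a b)) * emeasure lborel (cell n a b)"
    by (rule nn_integral_cmult_indicator) simp
  finally show ?case
    by (simp add: emeasure_cell mult.commute mult.left_commute flip: ennreal_mult)
next
  case (Suc k)
  let ?D = "{0..<512::int} \<times> {0..<512::int}"
  have "(\<integral>\<^sup>+p. ennreal (exp_weight c (point_exp (n + Suc k) p)) * indicator (cell n a b) p \<partial>lborel)
      = (\<integral>\<^sup>+p. (\<Sum>(d, e)\<in>?D. ennreal (exp_weight c (point_exp (Suc n + k) p)) *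
            indicator (cell (Suc n) (512 * a + d) (512 * b + e)) p) \<partial>lborel)"
    by (rule nn_integral_cong, subst indicator_cell)
      (simp only: sum_distrib_left case_prod_unfold add_Suc_right add_Suc)
  also have "\<dots> = (\<Sum>(d, e)\<in>?D. \<integral>\<^sup>+p. ennreal (exp_weight c (point_exp (Suc n + k) p)) *
            indicator (cell (Suc n) (512 * a + d) (512 * b + e)) p \<partial>lborel)"
    unfolding case_prod_unfold by (rule nn_integral_sum) measurable
  also have "\<dots> \<le> (\<Sum>(d, e)\<in>?D. ennreal (exp_weight_rate c ^ k * (1 / 512) ^ Suc n * (1 / 512) ^ Suc n
      * exp_weight c (weight_exp (Suc n) (512 * a + d) (512 * b + e))))"
    unfolding case_prod_unfold by (intro sum_mono Suc.IH)
  also have "\<dots> = ennreal (\<Sum>(d, e)\<in>?D. exp_weight_rate c ^ k * (1 / 512) ^ Suc n * (1 / 512) ^ Suc n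
      * exp_weight c (weight_exp (Suc n) (512 * a + d) (512 * b + e)))"
    unfolding case_prod_unfold by (intro sum_ennreal mult_nonneg_nonneg) (auto simp: exp_weight_rate_def)
  also have "\<dots> = ennreal (exp_weight_rate c ^ k * (1 / 512) ^ Suc n * (1 / 512) ^ Suc n *
      (\<Sum>(d, e)\<in>?D. exp_weight c (weight_exp (Suc n) (512 * a + d) (512 * b + e))))"
    unfolding case_prod_unfold sum_distrib_left ..
  also have "\<dots> \<le> ennreal (exp_weight_rate c ^ k * (1 / 512) ^ Suc n * (1 / 512) ^ Suc n *
      (exp_weight_rate c * 512\<^sup>2 * exp_weight c (weight_exp n a b)))"
    by (intro ennreal_leI mult_left_mono sum_children mult_nonneg_nonneg) (auto simp: exp_weight_rate_def)
  also have "exp_weight_rate c ^ k * (1 / 512) ^ Suc n * (1 / 512) ^ Suc n * (exp_weight_rate c * 512\<^sup>2 * exp_weight c (weight_exp n a b))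
      = exp_weight_rate c ^ Suc k * (1 / 512) ^ n * (1 / 512) ^ n * exp_weight c (weight_exp n a b)"
    by (simp add: power2_eq_square)
  finally show ?case .
qed

text \<open>The maximal inequality for the supermartingale 16^-k: the weight is 1 on a stopped cell,
  so its mean bounds the area stopped by a given level. Absorption makes these sets increase, and
  the bound passes to their union.\<close>

lemma emeasure_stopped_cell:
  "emeasure lborel (stopped \<inter> cell n a b)
    \<le> ennreal ((1 / 512) ^ n * (1 / 512) ^ n * (1 / 16) ^ weight_exp n a b)"
proof -
  let ?A = "\<lambda>k. {p. point_exp (n + k) p = 0} \<inter> cell n a b"
  have eq: "stopped \<inter> cell n a b = (\<Union>k. ?A k)"
  proof (intro equalityI subsetI)
    fix p assume p: "p \<in> stopped \<inter> cell n a b"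
    then obtain m where "point_exp m p = 0" by (auto simp: stopped_def)
    then have "point_exp (n + m) p = 0" by (rule point_exp_stopped) simp
    with p show "p \<in> (\<Union>k. ?A k)" by blast
  qed (auto simp: stopped_def)
  have "emeasure lborel (\<Union>k. ?A k) = (SUP k. emeasure lborel (?A k))"
  proof (rule SUP_emeasure_incseq[symmetric])
    show "incseq ?A"
      by (rule incseq_SucI) (auto intro: point_exp_stopped)
    show "range ?A \<subseteq> sets lborel" by (auto intro!: sets.Int)
  qed
  also have "\<dots> \<le> ennreal ((1 / 512) ^ n * (1 / 512) ^ n * (1 / 16) ^ weight_exp n a b)"
  proof (rule SUP_least)
    fix k
    have "emeasure lborel (?A k) = (\<integral>\<^sup>+p. indicator (?A k) p \<partial>lborel)"
      by (rule nn_integral_indicator[symmetric]) (auto intro!: sets.Int)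
    also have "\<dots> \<le> (\<integral>\<^sup>+p. ennreal (exp_weight False (point_exp (n + k) p)) * indicator (cell n a b) p \<partial>lborel)"
      by (intro nn_integral_mono) (auto simp: indicator_def exp_weight_def)
    also have "\<dots> \<le> ennreal ((1 / 512) ^ n * (1 / 512) ^ n * (1 / 16) ^ weight_exp n a b)"
      using nn_integral_cell_exp_weight[of False n k a b] by (simp add: exp_weight_rate_def exp_weight_def)
    finally show "emeasure lborel (?A k) \<le> ennreal ((1 / 512) ^ n * (1 / 512) ^ n * (1 / 16) ^ weight_exp n a b)" .
  qed
  finally show ?thesis by (simp add: eq)
qed

text \<open>As 256^-k is at most 16^-k, this bounds the horizontal length that unstopped cells of
  level \<open>m\<close> contribute on the line of height \<open>y\<close>.\<close>

definition unstopped_weight :: "nat \<Rightarrow> real \<Rightarrow> ennreal" where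
  "unstopped_weight m y = (\<integral>\<^sup>+x. ennreal (exp_weight True (point_exp m (x, y))) * indicator {0..<1} x \<partial>lborel)"

lemma measurable_pair_point_exp [measurable]:
  "(\<lambda>(x, y). ennreal (exp_weight c (point_exp m (x, y))) * indicator {0..<1} x * indicator {0..<1} y)
    \<in> borel_measurable (lborel \<Otimes>\<^sub>M lborel)"
proof -
  have "(\<lambda>p. ennreal (exp_weight c (point_exp m p)) * indicator {0..<1} (fst p) * indicator {0..<1} (snd p))
      \<in> borel_measurable (borel \<Otimes>\<^sub>M borel)"
    using measurable_point_exp[of m] unfolding borel_prod[symmetric] by measurable
  then show ?thesis by (simp add: split_beta)
qed

text \<open>The integrals over \<open>y\<close> decay like (11/16)^m, so the sum over
  \<open>m\<close> is integrable and therefore finite almost everywhere. Summability is stronger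
  than the convergence to 0 for which it serves, but it follows at once.\<close>

lemma AE_unstopped_weight_summable:
  "AE y in lborel. y \<in> {0..<1} \<longrightarrow> (\<Sum>m. unstopped_weight m y) < \<infinity>"
proof -
  let ?f = "\<lambda>m (x, y). ennreal (exp_weight True (point_exp m (x, y))) * indicator {0..<1} x * indicator {0..<1} y"
  have inner: "(\<integral>\<^sup>+x. ?f m (x, y) \<partial>lborel) = unstopped_weight m y * indicator {0..<1} y" for m y
    unfolding unstopped_weight_def by (simp add: nn_integral_multc indicator_def)
  have meas: "(\<lambda>y. unstopped_weight m y * indicator {0..<1} y) \<in> borel_measurable lborel" for m
  proof -
    have "(\<lambda>(y, x). ?f m (x, y)) \<in> borel_measurable (lborel \<Otimes>\<^sub>M lborel)"
      using measurable_compose[OF measurable_pair_swap' measurable_pair_point_exp] by (simp add: split_beta)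
    from lborel.borel_measurable_nn_integral[OF this] show ?thesis
      unfolding inner[symmetric] .
  qed
  have bound: "(\<integral>\<^sup>+y. unstopped_weight m y * indicator {0..<1} y \<partial>lborel) \<le> ennreal ((11 / 16) ^ m)" for m
  proof -
    have "(\<integral>\<^sup>+y. unstopped_weight m y * indicator {0..<1} y \<partial>lborel) = (\<integral>\<^sup>+p. ?f m p \<partial>(lborel \<Otimes>\<^sub>M lborel))"
      unfolding inner[symmetric] by (rule lborel_pair.nn_integral_snd) measurable
    also have "\<dots> = (\<integral>\<^sup>+p. ennreal (exp_weight True (point_exp (0 + m) p)) * indicator (cell 0 0 0) p \<partial>lborel)"
      unfolding lborel_prod by (intro nn_integral_cong) (auto simp: cell_eq indicator_def)
    also have "\<dots> \<le> ennreal ((11 / 16) ^ m * (1 / 16))"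
      using nn_integral_cell_exp_weight[of True 0 m 0 0] by (simp add: exp_weight_rate_def exp_weight_def)
    also have "\<dots> \<le> ennreal ((11 / 16) ^ m)"
      by (intro ennreal_leI) simp
    finally show ?thesis .
  qed
  have "(\<integral>\<^sup>+y. (\<Sum>m. unstopped_weight m y * indicator {0..<1} y) \<partial>lborel)
      = (\<Sum>m. \<integral>\<^sup>+y. unstopped_weight m y * indicator {0..<1} y \<partial>lborel)"
    by (rule nn_integral_suminf) (rule meas)
  also have "\<dots> \<le> (\<Sum>m. ennreal ((11 / 16) ^ m))"
    using bound by (intro suminf_le) auto
  also have "\<dots> = ennreal (\<Sum>m. (11 / 16) ^ m)"
    by (rule suminf_ennreal2) (auto intro!: summable_geometric)
  finally have "(\<integral>\<^sup>+y. (\<Sum>m. unstopped_weight m y * indicator {0..<1} y) \<partial>lborel) \<noteq> \<infinity>"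
    by (auto simp: top_unique)
  moreover have "(\<lambda>y. \<Sum>m. unstopped_weight m y * indicator {0..<1} y) \<in> borel_measurable lborel"
    by (rule borel_measurable_suminf_order) (rule meas)
  ultimately have "AE y in lborel. (\<Sum>m. unstopped_weight m y * indicator {0..<1} y) \<noteq> \<infinity>"
    by (rule nn_integral_PInf_AE[rotated])
  then show ?thesis
    by eventually_elim (auto simp: less_top indicator_def)
qed

section \<open>Line integrals along dominated paths\<close>

text \<open>An inequality on a generating family of intervals does not extend by uniqueness of
  measures alone. The difference of the distribution functions is increasing, so it defines a
  measure \<open>\<kappa>\<close>; uniqueness then gives \<open>\<mu> = \<nu> + \<kappa>\<close> on
  all Borel sets.\<close>

lemma Ioc_measure_le:
  fixes \<nu> \<mu> :: "real measure" and f g :: "real \<Rightarrow> real"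
  assumes sets: "sets \<nu> = sets borel" "sets \<mu> = sets borel"
    and cont: "continuous_on UNIV f" "continuous_on UNIV g"
    and \<nu>: "\<And>u v. u \<le> v \<Longrightarrow> emeasure \<nu> {u<..v} = ennreal (f v - f u)"
    and \<mu>: "\<And>u v. u \<le> v \<Longrightarrow> emeasure \<mu> {u<..v} = ennreal (g v - g u)"
    and mono: "\<And>u v. u \<le> v \<Longrightarrow> f u \<le> f v" "\<And>u v. u \<le> v \<Longrightarrow> f v - f u \<le> g v - g u"
  shows "\<nu> \<le> \<mu>"
proof -
  define \<kappa> where "\<kappa> = interval_measure (\<lambda>x. g x - f x)"
  have \<kappa>: "emeasure \<kappa> {u<..v} = ennreal ((g v - f v) - (g u - f u))" if "u \<le> v" for u v
    unfolding \<kappa>_def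
  proof (rule emeasure_interval_measure_Ioc[OF that])
    show "g x - f x \<le> g y - f y" if "x \<le> y" for x y using mono(2)[OF that] by simp
    have "continuous_on UNIV (\<lambda>x. g x - f x)" using cont by (intro continuous_intros)
    then show "continuous (at_right x) (\<lambda>x. g x - f x)" for x
      by (auto simp: continuous_on_eq_continuous_at intro: continuous_at_imp_continuous_within)
  qed
  have sets_\<kappa>: "sets \<kappa> = sets borel" by (simp add: \<kappa>_def)
  define N where "N = measure_of UNIV (sets borel) (\<lambda>A. emeasure \<nu> A + emeasure \<kappa> A)"
  have sets_N: "sets N = sets borel"
    unfolding N_def using sets.sigma_sets_eq[of borel] by (simp add: sets_measure_of)
  have N: "emeasure N A = emeasure \<nu> A + emeasure \<kappa> A" if "A \<in> sets borel" for A
    unfolding N_def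
  proof (rule emeasure_measure_of_sigma)
    show "sigma_algebra UNIV (sets borel :: real set set)"
      using sets.sigma_algebra_axioms[of "borel :: real measure"] by simp
    show "positive (sets borel) (\<lambda>A. emeasure \<nu> A + emeasure \<kappa> A)"
      by (simp add: positive_def)
    show "countably_additive (sets borel) (\<lambda>A. emeasure \<nu> A + emeasure \<kappa> A)"
    proof (rule countably_additiveI)
      fix A :: "nat \<Rightarrow> real set"
      assume A: "range A \<subseteq> sets borel" "disjoint_family A" "(\<Union>i. A i) \<in> sets borel"
      have "(\<Sum>i. emeasure \<nu> (A i) + emeasure \<kappa> (A i)) = (\<Sum>i. emeasure \<nu> (A i)) + (\<Sum>i. emeasure \<kappa> (A i))"
        by (rule suminf_add[symmetric]) auto
      also have "\<dots> = emeasure \<nu> (\<Union>i. A i) + emeasure \<kappa> (\<Union>i. A i)"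
        using A sets sets_\<kappa> by (simp add: suminf_emeasure)
      finally show "(\<Sum>i. emeasure \<nu> (A i) + emeasure \<kappa> (A i)) = emeasure \<nu> (\<Union>i. A i) + emeasure \<kappa> (\<Union>i. A i)" .
    qed
    show "A \<in> sets borel" by (rule that)
  qed
  have "\<mu> = N"
  proof (rule measure_eqI_generator_eq)
    let ?E = "range (\<lambda>(a, b). {a<..b :: real})"
    show "Int_stable ?E"
    proof (rule Int_stableI)
      fix A B assume "A \<in> ?E" "B \<in> ?E"
      then obtain a b c d where "A = {a<..b}" "B = {c<..d}" by auto
      then have "A \<inter> B = (\<lambda>(a, b). {a<..b}) (max a c, min b d)"
        by simp
      then show "A \<inter> B \<in> ?E" by (rule image_eqI) simp
    qed
    show "?E \<subseteq> Pow UNIV" by simp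
    show "emeasure \<mu> A = emeasure N A" if A: "A \<in> ?E" for A
    proof -
      from A obtain u v where A: "A = {u<..v}" by auto
      show ?thesis
      proof (cases "u \<le> v")
        case True
        then show ?thesis
          using mono[OF True] by (simp add: A N \<nu> \<mu> \<kappa> flip: ennreal_plus)
      qed (simp add: A N)
    qed
    have "sets borel = sigma_sets UNIV ?E"
      by (subst borel_sigma_sets_Ioc) (simp add: sets_measure_of)
    then show "sets \<mu> = sigma_sets UNIV ?E" "sets N = sigma_sets UNIV ?E"
      using sets(2) sets_N by simp_all
    show "range (\<lambda>n. {- real n<..real n}) \<subseteq> ?E" by auto
    show "(\<Union>n. {- real n<..real n}) = UNIV"
    proof (intro equalityI subsetI UNIV_I)
      fix x :: real
      obtain n where "\<bar>x\<bar> < real n" using reals_Archimedean2 by blast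
      then show "x \<in> (\<Union>n. {- real n<..real n})" by (intro UN_I[of n]) auto
    qed
    show "emeasure \<mu> {- real n<..real n} \<noteq> \<infinity>" for n by (simp add: \<mu>)
  qed
  then show ?thesis
    using sets sets_N N by (subst le_measure) auto
qed

section \<open>Arc length of paths dominated by an integral\<close>

fun polygon_length :: "'a metric \<Rightarrow> (real \<Rightarrow> 'a) \<Rightarrow> real list \<Rightarrow> real" where
  "polygon_length X \<gamma> (s # t # ts) = mdist X (\<gamma> s) (\<gamma> t) + polygon_length X \<gamma> (t # ts)"
| "polygon_length X \<gamma> _ = 0"

lemma polygon_length_nonneg [simp]: "0 \<le> polygon_length X \<gamma> ts"
  by (induction X \<gamma> ts rule: polygon_length.induct) auto

lemma sum_eq_polygon_length: "(\<Sum>i<length ts - 1. ennreal (mdist X (\<gamma> (ts ! i)) (\<gamma> (ts ! Suc i)))) = ennreal (polygon_length X \<gamma> ts)"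
proof (induction X \<gamma> ts rule: polygon_length.induct)
  case (1 X \<gamma> s t ts)
  then show ?case by (simp add: sum.lessThan_Suc_shift del: sum.lessThan_Suc)
qed auto

lemma mlength_eq_SUP: "mlength X \<gamma> a b = (SUP ts\<in>{ts. sorted ts \<and> set ts \<subseteq> {a..b}}. ennreal (polygon_length X \<gamma> ts))"
  unfolding mlength_def sum_eq_polygon_length ..

lemma polygon_length_le_mlength: "sorted ts \<Longrightarrow> set ts \<subseteq> {a..b} \<Longrightarrow> ennreal (polygon_length X \<gamma> ts) \<le> mlength X \<gamma> a b"
  unfolding mlength_eq_SUP by (intro SUP_upper) auto

lemma polygon_length_append_insert:
  assumes "\<gamma> ` (set xs \<union> {t} \<union> set ys) \<subseteq> mspace X"
  shows "polygon_length X \<gamma> (xs @ ys) \<le> polygon_length X \<gamma> (xs @ [t]) + polygon_length X \<gamma> (t # ys)"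
  using assms
proof (induction X \<gamma> xs rule: polygon_length.induct)
  case ("2_1" X \<gamma>)
  then show ?case by (cases ys) auto
next
  case ("2_2" X \<gamma> s)
  interpret Metric_space "mspace X" "mdist X" by (rule Metric_space_mspace_mdist)
  show ?case
  proof (cases ys)
    case (Cons y zs)
    then show ?thesis using triangle[of "\<gamma> s" "\<gamma> t" "\<gamma> y"] "2_2" by simp
  qed simp
qed auto

lemma polygon_length_snoc2: "polygon_length X \<gamma> (xs @ [s, t]) = polygon_length X \<gamma> (xs @ [s]) + mdist X (\<gamma> s) (\<gamma> t)"
  by (induction X \<gamma> xs rule: polygon_length.induct) auto

lemma polygon_length_snoc_ge: "polygon_length X \<gamma> xs \<le> polygon_length X \<gamma> (xs @ [t])"
  by (induction X \<gamma> xs rule: polygon_length.induct) auto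

lemma sorted_split_at:
  fixes t :: real
  shows "sorted ts \<Longrightarrow> \<exists>xs ys. ts = xs @ ys \<and> (\<forall>x\<in>set xs. x \<le> t) \<and> (\<forall>y\<in>set ys. t \<le> y)"
proof (induction ts)
  case (Cons s ts)
  show ?case
  proof (cases "s \<le> t")
    case True
    from Cons obtain xs ys where "ts = xs @ ys" "\<forall>x\<in>set xs. x \<le> t" "\<forall>y\<in>set ys. t \<le> y" by auto
    then show ?thesis using True by (intro exI[of _ "s # xs"] exI[of _ ys]) auto
  next
    case False
    then show ?thesis using Cons.prems by (intro exI[of _ "[]"] exI[of _ "s # ts"]) auto
  qed
qed auto

text \<open>The increments of the path are bounded by those of \<open>m\<close>, whose Stieltjes
  measure has the density \<open>w\<close>. Thus arc length is dominated by \<open>w\<close> as a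
  measure although the metric derivative is never formed. Injectivity makes arc length strictly
  increasing, so that it can be inverted; the Lipschitz bound on \<open>m\<close> provides
  continuity.\<close>

locale dominated_path =
  fixes X :: "'a metric" and \<gamma> :: "real \<Rightarrow> 'a" and a b :: real and m :: "real \<Rightarrow> real"
    and w :: "real \<Rightarrow> ennreal" and C :: real
  assumes ab: "a \<le> b"
    and \<gamma>: "\<And>t. t \<in> {a..b} \<Longrightarrow> \<gamma> t \<in> mspace X"
    and inj: "inj_on \<gamma> {a..b}"
    and dom: "\<And>u v. a \<le> u \<Longrightarrow> u \<le> v \<Longrightarrow> v \<le> b \<Longrightarrow> mdist X (\<gamma> u) (\<gamma> v) \<le> m v - m u"
    and m_mono: "\<And>u v. u \<le> v \<Longrightarrow> m u \<le> m v"
    and m_Lipschitz: "\<And>u v. u \<le> v \<Longrightarrow> m v - m u \<le> C * (v - u)"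
    and w_meas: "w \<in> borel_measurable borel"
    and m_eq: "\<And>u v. u \<le> v \<Longrightarrow> ennreal (m v - m u) = (\<integral>\<^sup>+t. w t * indicator {u<..v} t \<partial>lborel)"
begin

lemma polygon_length_le:
  assumes "sorted ts" "set ts \<subseteq> {u..v}" "a \<le> u" "u \<le> v" "v \<le> b"
  shows "polygon_length X \<gamma> ts \<le> m v - m u"
  using assms
proof (induction ts arbitrary: u)
  case (Cons s ts)
  show ?case
  proof (cases ts)
    case Nil
    then show ?thesis using m_mono[OF Cons.prems(4)] by simp
  next
    case (Cons t zs)
    have "polygon_length X \<gamma> ts \<le> m v - m t"
    proof (rule Cons.IH)
      show "set ts \<subseteq> {t..v}" using Cons.prems Cons by auto
    qed (use Cons.prems Cons in auto)
    moreover have "mdist X (\<gamma> s) (\<gamma> t) \<le> m t - m s"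
      using Cons.prems Cons by (intro dom) auto
    moreover have "m u \<le> m s" using Cons.prems by (intro m_mono) auto
    ultimately show ?thesis by (simp add: Cons)
  qed
qed (use m_mono in auto)

definition S :: "real \<Rightarrow> real" where
  "S t = enn2real (mlength X \<gamma> a t)"

lemma mlength_le: "t \<in> {a..b} \<Longrightarrow> mlength X \<gamma> a t \<le> ennreal (m t - m a)"
  unfolding mlength_eq_SUP by (intro SUP_least ennreal_leI polygon_length_le) auto

lemma mlength_eq_S: "t \<in> {a..b} \<Longrightarrow> mlength X \<gamma> a t = ennreal (S t)"
  unfolding S_def using le_less_trans[OF mlength_le ennreal_less_top] by (intro ennreal_enn2real[symmetric]) auto

lemma S_nonneg [simp]: "0 \<le> S t"
  by (simp add: S_def)

lemma S_a [simp]: "S a = 0"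
  using mlength_le[of a] ab by (simp add: S_def)

text \<open>A polygon on \<open>{a..v}\<close> does not get shorter when the vertex \<open>u\<close>
  is inserted. Its part before \<open>u\<close> is at most \<open>S u\<close>, and its part after
  \<open>u\<close> is bounded by the increment of \<open>m\<close>.\<close>

lemma S_diff_le:
  assumes "a \<le> u" "u \<le> v" "v \<le> b"
  shows "S v - S u \<le> m v - m u"
proof -
  have "mlength X \<gamma> a v \<le> ennreal (S u + (m v - m u))"
    unfolding mlength_eq_SUP
  proof (rule SUP_least)
    fix ts assume "ts \<in> {ts. sorted ts \<and> set ts \<subseteq> {a..v}}"
    then have ts: "sorted ts" "set ts \<subseteq> {a..v}" by auto
    obtain xs ys where xy: "ts = xs @ ys" "\<forall>x\<in>set xs. x \<le> u" "\<forall>y\<in>set ys. u \<le> y"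
      using sorted_split_at[OF ts(1)] by blast
    have "ennreal (polygon_length X \<gamma> (xs @ [u])) \<le> mlength X \<gamma> a u"
      using ts xy assms by (intro polygon_length_le_mlength) (auto simp: sorted_append)
    then have "polygon_length X \<gamma> (xs @ [u]) \<le> S u"
      using assms by (simp add: mlength_eq_S)
    moreover have "polygon_length X \<gamma> (u # ys) \<le> m v - m u"
      using ts xy assms by (intro polygon_length_le) (auto simp: sorted_append)
    moreover have "polygon_length X \<gamma> (xs @ ys) \<le> polygon_length X \<gamma> (xs @ [u]) + polygon_length X \<gamma> (u # ys)"
    proof (rule polygon_length_append_insert)
      have "set xs \<union> {u} \<union> set ys \<subseteq> {a..b}" using ts(2) xy(1) assms by auto
      then show "\<gamma> ` (set xs \<union> {u} \<union> set ys) \<subseteq> mspace X" using \<gamma> by blast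
    qed
    ultimately show "ennreal (polygon_length X \<gamma> ts) \<le> ennreal (S u + (m v - m u))"
      unfolding xy(1) by (intro ennreal_leI) linarith
  qed
  then have "ennreal (S v) \<le> ennreal (S u + (m v - m u))"
    using assms by (simp add: mlength_eq_S)
  moreover have "0 \<le> S u + (m v - m u)"
    using m_mono[OF assms(2)] by (intro add_nonneg_nonneg) auto
  ultimately have "S v \<le> S u + (m v - m u)"
    by (subst (asm) ennreal_le_iff) auto
  then show ?thesis by simp
qed

lemma S_diff_ge:
  assumes "a \<le> u" "u \<le> v" "v \<le> b"
  shows "S u + mdist X (\<gamma> u) (\<gamma> v) \<le> S v"
proof -
  have "mlength X \<gamma> a u \<le> ennreal (S v - mdist X (\<gamma> u) (\<gamma> v))"
    unfolding mlength_eq_SUP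
  proof (rule SUP_least)
    fix ts assume "ts \<in> {ts. sorted ts \<and> set ts \<subseteq> {a..u}}"
    then have ts: "sorted ts" "set ts \<subseteq> {a..u}" by auto
    have "ennreal (polygon_length X \<gamma> (ts @ [u, v])) \<le> mlength X \<gamma> a v"
      using ts assms by (intro polygon_length_le_mlength) (force simp: sorted_append)+
    then have "polygon_length X \<gamma> (ts @ [u, v]) \<le> S v"
      using assms by (simp add: mlength_eq_S)
    then show "ennreal (polygon_length X \<gamma> ts) \<le> ennreal (S v - mdist X (\<gamma> u) (\<gamma> v))"
      using polygon_length_snoc_ge[of X \<gamma> ts u] by (intro ennreal_leI) (simp add: polygon_length_snoc2)
  qed
  then have le: "ennreal (S u) \<le> ennreal (S v - mdist X (\<gamma> u) (\<gamma> v))"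
    using assms by (simp add: mlength_eq_S)
  have "ennreal (polygon_length X \<gamma> [u, v]) \<le> mlength X \<gamma> a v"
    using assms by (intro polygon_length_le_mlength) auto
  then have "mdist X (\<gamma> u) (\<gamma> v) \<le> S v"
    using assms by (simp add: mlength_eq_S)
  with le show ?thesis by (subst (asm) ennreal_le_iff) auto
qed

lemma S_strict_mono: "a \<le> u \<Longrightarrow> u < v \<Longrightarrow> v \<le> b \<Longrightarrow> S u < S v"
proof -
  assume uv: "a \<le> u" "u < v" "v \<le> b"
  have "\<gamma> u \<noteq> \<gamma> v"
    using inj uv by (auto dest: inj_onD)
  then have "mdist X (\<gamma> u) (\<gamma> v) \<noteq> 0"
    using \<gamma> uv by (subst mdist_zero) auto
  then have "0 < mdist X (\<gamma> u) (\<gamma> v)"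
    using mdist_nonneg[of X "\<gamma> u" "\<gamma> v"] by linarith
  then show "S u < S v" using S_diff_ge[of u v] uv by simp
qed

lemma S_mono: "a \<le> u \<Longrightarrow> u \<le> v \<Longrightarrow> v \<le> b \<Longrightarrow> S u \<le> S v"
  using S_strict_mono[of u v] by (cases "u = v") auto

text \<open>Composition with \<open>clamp\<close> extends functions on \<open>{a..b}\<close> to the
  line by constants, as required for \<open>Ioc_measure_le\<close>.\<close>

definition clamp :: "real \<Rightarrow> real" where
  "clamp x = max a (min b x)"

lemma clamp: "a \<le> clamp x" "clamp x \<le> b" and clamp_mono: "x \<le> y \<Longrightarrow> clamp x \<le> clamp y"
  and clamp_id: "x \<in> {a..b} \<Longrightarrow> clamp x = x"
  and clamp_diff: "x \<le> y \<Longrightarrow> clamp y - clamp x \<le> y - x"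
  using ab by (auto simp: clamp_def)

lemma C_nonneg: "0 \<le> C"
  using m_Lipschitz[of 0 1] m_mono[of 0 1] by simp

lemma continuous_clamp:
  fixes h :: "real \<Rightarrow> real"
  assumes "\<And>u v. a \<le> u \<Longrightarrow> u \<le> v \<Longrightarrow> v \<le> b \<Longrightarrow> h u \<le> h v"
    and "\<And>u v. a \<le> u \<Longrightarrow> u \<le> v \<Longrightarrow> v \<le> b \<Longrightarrow> h v - h u \<le> m v - m u"
  shows "continuous_on UNIV (\<lambda>x. h (clamp x))"
proof -
  have 1: "\<bar>h (clamp y) - h (clamp x)\<bar> \<le> C * \<bar>y - x\<bar>" if "x \<le> y" for x y
  proof -
    have "h (clamp x) \<le> h (clamp y)" "h (clamp y) - h (clamp x) \<le> m (clamp y) - m (clamp x)"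
      using clamp clamp_mono[OF that] by (auto intro!: assms)
    moreover have "m (clamp y) - m (clamp x) \<le> C * (clamp y - clamp x)"
      by (intro m_Lipschitz clamp_mono that)
    moreover have "\<dots> \<le> C * (y - x)"
      by (intro mult_left_mono clamp_diff that C_nonneg)
    ultimately show ?thesis using that by simp
  qed
  have "C-lipschitz_on UNIV (\<lambda>x. h (clamp x))"
  proof (rule lipschitz_onI)
    show "dist (h (clamp x)) (h (clamp y)) \<le> C * dist x y" for x y
      using 1[of x y] 1[of y x] by (cases "x \<le> y") (auto simp: dist_real_def abs_minus_commute)
  qed (rule C_nonneg)
  then show ?thesis by (rule lipschitz_on_continuous_on)
qed

definition T :: "real \<Rightarrow> real" where
  "T x = inv_into {a..b} (\<lambda>t. mlength X \<gamma> a t) (ennreal x)"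

lemma T_in_S_T:
  assumes "x \<in> {0..S b}"
  shows "T x \<in> {a..b}" "S (T x) = x"
proof -
  have "continuous_on {a..b} (\<lambda>x. S (clamp x))"
    by (rule continuous_on_subset[OF continuous_clamp[OF S_mono S_diff_le]]) auto
  moreover have "S (clamp a) \<le> x" "x \<le> S (clamp b)" using assms clamp_id ab by simp_all
  ultimately obtain t where t: "a \<le> t" "t \<le> b" "S (clamp t) = x"
    using IVT'[of "\<lambda>x. S (clamp x)" a x b] ab by blast
  then have "ennreal x = mlength X \<gamma> a t"
    using clamp_id[of t] by (simp add: mlength_eq_S)
  then have img: "ennreal x \<in> (\<lambda>t. mlength X \<gamma> a t) ` {a..b}"
    using t by auto
  show in_ab: "T x \<in> {a..b}" unfolding T_def using img by (rule inv_into_into)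
  have "mlength X \<gamma> a (T x) = ennreal x"
    unfolding T_def using img by (rule f_inv_into_f)
  then show "S (T x) = x" using assms by (simp add: S_def)
qed

lemma T_mono: "mono_on {0..S b} T"
proof (rule mono_onI)
  fix x y assume "x \<in> {0..S b}" "y \<in> {0..S b}" "x \<le> y"
  then show "T x \<le> T y"
    using T_in_S_T[of x] T_in_S_T[of y] S_strict_mono[of "T y" "T x"] by force
qed

lemma T_measurable: "T \<in> restrict_space lborel {0..S b} \<rightarrow>\<^sub>M borel"
  using borel_measurable_mono_on_fnc[OF T_mono] by (simp cong: measurable_cong_sets add: sets_restrict_space)

text \<open>The image of Lebesgue measure under the inverse of \<open>S\<close> is the Stieltjes
  measure of \<open>S\<close>: the preimage of an interval lies between an open and a closed
  interval with the same end points.\<close>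

lemma emeasure_distr_T:
  assumes "u \<le> v"
  shows "emeasure (distr (restrict_space lborel {0..S b}) borel T) {u<..v} = ennreal (S (clamp v) - S (clamp u))"
proof -
  let ?A = "{x \<in> {0..S b}. u < T x \<and> T x \<le> v}"
  have eq: "T -` {u<..v} \<inter> space (restrict_space lborel {0..S b}) = ?A"
    by (auto simp: space_restrict_space)
  have A: "?A \<in> sets (restrict_space lborel {0..S b})"
    using measurable_sets[OF T_measurable, of "{u<..v}"] unfolding eq by simp
  then have A_lborel: "?A \<in> sets lborel"
    by (auto simp: sets_restrict_space)
  have "emeasure (distr (restrict_space lborel {0..S b}) borel T) {u<..v} = emeasure lborel ?A"
  proof -
    have "emeasure (distr (restrict_space lborel {0..S b}) borel T) {u<..v} = emeasure (restrict_space lborel {0..S b}) ?A"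
      using emeasure_distr[OF T_measurable, of "{u<..v}"] unfolding eq by simp
    also have "\<dots> = emeasure lborel ?A"
      by (rule emeasure_restrict_space) auto
    finally show ?thesis .
  qed
  also have "\<dots> = ennreal (S (clamp v) - S (clamp u))"
  proof (rule antisym)
    have uv: "S (clamp u) \<le> S (clamp v)"
      using clamp clamp_mono[OF assms] by (intro S_mono) auto
    have T: "clamp (T x) = T x" "S (T x) = x" if "x \<in> {0..S b}" for x
      using T_in_S_T[OF that] clamp_id by auto
    have "?A \<subseteq> {S (clamp u)..S (clamp v)}"
    proof
      fix x assume "x \<in> ?A"
      then have x: "x \<in> {0..S b}" "u < T x" "T x \<le> v" by auto
      have "S (clamp u) \<le> S (clamp (T x))" "S (clamp (T x)) \<le> S (clamp v)"
        using clamp clamp_mono[of u "T x"] clamp_mono[of "T x" v] x(2,3) by (auto intro!: S_mono)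
      then show "x \<in> {S (clamp u)..S (clamp v)}" using T[OF x(1)] by simp
    qed
    then have "emeasure lborel ?A \<le> emeasure lborel {S (clamp u)..S (clamp v)}"
      by (rule emeasure_mono) simp
    then show "emeasure lborel ?A \<le> ennreal (S (clamp v) - S (clamp u))"
      using uv by simp
    have "{S (clamp u)<..<S (clamp v)} \<subseteq> ?A"
    proof
      fix x assume x: "x \<in> {S (clamp u)<..<S (clamp v)}"
      have "S (clamp v) \<le> S b" using clamp by (intro S_mono) auto
      moreover have "S (clamp u) < x" "x < S (clamp v)" using x by auto
      ultimately have x0: "x \<in> {0..S b}"
        using S_nonneg[of "clamp u"] unfolding atLeastAtMost_iff by linarith
      have "\<not> T x \<le> u"
      proof
        assume "T x \<le> u"
        then have "S (clamp (T x)) \<le> S (clamp u)" using clamp clamp_mono by (intro S_mono) auto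
        then show False using x T[OF x0] by simp
      qed
      moreover have "\<not> v < T x"
      proof
        assume "v < T x"
        then have "S (clamp v) \<le> S (clamp (T x))" using clamp clamp_mono by (intro S_mono) auto
        then show False using x T[OF x0] by simp
      qed
      ultimately show "x \<in> ?A" using x0 by auto
    qed
    then have "emeasure lborel {S (clamp u)<..<S (clamp v)} \<le> emeasure lborel ?A"
      using A_lborel by (rule emeasure_mono)
    then show "ennreal (S (clamp v) - S (clamp u)) \<le> emeasure lborel ?A"
      using uv by simp
  qed
  finally show ?thesis .
qed

text \<open>Changing variables by \<open>T\<close> turns the arc-length integral into one against
  the Stieltjes measure of \<open>S\<close>, which is at most that of \<open>m\<close> because its
  increments are smaller. The function \<open>g\<close> extends the density along the path
  measurably to the line.\<close>

lemma closed_line_integral_le: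
  assumes g: "g \<in> borel_measurable borel" "\<And>t. t \<in> {a..b} \<Longrightarrow> \<rho> (\<gamma> t) = g t"
  shows "closed_line_integral X \<gamma> a b \<rho> \<le> (\<integral>\<^sup>+t. w t * indicator {a<..b} t * g t \<partial>lborel)"
proof -
  define \<nu> where "\<nu> = distr (restrict_space lborel {0..S b}) borel T"
  define \<mu> where "\<mu> = density lborel (\<lambda>t. w t * indicator {a<..b} t)"
  have wm: "(\<lambda>t. w t * indicator {a<..b} t) \<in> borel_measurable lborel"
    using w_meas by measurable
  have "\<nu> \<le> \<mu>"
  proof (rule Ioc_measure_le)
    show "sets \<nu> = sets borel" "sets \<mu> = sets borel" by (simp_all add: \<nu>_def \<mu>_def)
    show "continuous_on UNIV (\<lambda>x. S (clamp x))"
      by (rule continuous_clamp[OF S_mono S_diff_le])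
    show "continuous_on UNIV (\<lambda>x. m (clamp x))"
      by (rule continuous_clamp) (auto intro: m_mono)
    fix u v :: real assume uv: "u \<le> v"
    show "emeasure \<nu> {u<..v} = ennreal (S (clamp v) - S (clamp u))"
      unfolding \<nu>_def by (rule emeasure_distr_T[OF uv])
    have "emeasure \<mu> {u<..v} = (\<integral>\<^sup>+t. w t * indicator {a<..b} t * indicator {u<..v} t \<partial>lborel)"
      unfolding \<mu>_def using wm by (rule emeasure_density) simp
    also have "\<dots> = (\<integral>\<^sup>+t. w t * indicator {clamp u<..clamp v} t \<partial>lborel)"
      by (rule nn_integral_cong) (use ab uv in \<open>auto simp: indicator_def clamp_def\<close>)
    also have "\<dots> = ennreal (m (clamp v) - m (clamp u))"
      by (rule m_eq[symmetric, OF clamp_mono[OF uv]])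
    finally show "emeasure \<mu> {u<..v} = ennreal (m (clamp v) - m (clamp u))" .
    show "S (clamp u) \<le> S (clamp v)" "S (clamp v) - S (clamp u) \<le> m (clamp v) - m (clamp u)"
      using clamp clamp_mono[OF uv] by (auto intro!: S_mono S_diff_le)
  qed
  have "closed_line_integral X \<gamma> a b \<rho> = (\<integral>\<^sup>+x. \<rho> (\<gamma> (T x)) * indicator {0..S b} x \<partial>lborel)"
    unfolding closed_line_integral_def arclength_param_def T_def S_def ..
  also have "\<dots> = (\<integral>\<^sup>+x. g (T x) * indicator {0..S b} x \<partial>lborel)"
    using T_in_S_T g(2) by (intro nn_integral_cong) (auto simp: indicator_def)
  also have "\<dots> = (\<integral>\<^sup>+x. g (T x) \<partial>restrict_space lborel {0..S b})"
    by (rule nn_integral_restrict_space[symmetric]) simp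
  also have "\<dots> = (\<integral>\<^sup>+t. g t \<partial>\<nu>)"
    unfolding \<nu>_def by (rule nn_integral_distr[symmetric, OF T_measurable]) (use g(1) in simp)
  also have "\<dots> \<le> (\<integral>\<^sup>+t. g t \<partial>\<mu>)"
    using \<open>\<nu> \<le> \<mu>\<close> by (intro nn_integral_mono_measure) (simp_all add: \<nu>_def \<mu>_def)
  also have "\<dots> = (\<integral>\<^sup>+t. w t * indicator {a<..b} t * g t \<partial>lborel)"
    unfolding \<mu>_def using wm g(1) by (intro nn_integral_density) auto
  finally show ?thesis .
qed

end

section \<open>Hausdorff measure of the chain metric on the stopped set\<close>

lemma emeasure_stopped_le_hausdorff2:
  assumes A: "A \<in> sets (hausdorff2 chain_space)"
  shows "ennreal ((dist_const / 1024)\<^sup>2 / 8) * emeasure lborel (A \<inter> stopped) \<le> emeasure (hausdorff2 chain_space) A"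
proof -
  let ?H = "hausdorff2 chain_space" and ?k = "ennreal ((dist_const / 1024)\<^sup>2 / 8)"
  have sq: "square \<in> sets borel" by (simp add: borel_closed closed_Times)
  have sets_H: "sets ?H = sets (restrict_space borel square)"
    by (rule sets_hausdorff2_top_of_set) (simp_all add: sq)
  have sets_iff: "B \<in> sets ?H \<longleftrightarrow> B \<subseteq> square \<and> B \<in> sets borel" for B
    unfolding sets_H by (subst sets_restrict_space_iff) (use sq in auto)
  have A': "A \<subseteq> square" "A \<in> sets borel" using A by (simp_all add: sets_iff)
  define Z where "Z n = {p. point_exp n p = 0}" for n
  have Z_meas: "Z n \<in> sets borel" for n unfolding Z_def by measurable
  have piece: "?k * emeasure lborel (A \<inter> Z n) \<le> emeasure ?H A" for n
  proof -
    \<comment> \<open>The lower Lipschitz bound needs points that are near at the level where they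
      have stopped, so the set is divided among the countably many cells of that level.\<close>
    define P where "P i = A \<inter> Z n \<inter> cell n (fst i) (snd i)" for i
    have P_meas: "P i \<in> sets borel" "P i \<in> sets ?H" for i
      using A' Z_meas unfolding sets_iff P_def by (auto intro!: sets.Int)
    have disj: "disjoint_family P"
      by (auto simp: disjoint_family_on_def P_def cell_def)
    have un: "(\<Union>i. P i) = A \<inter> Z n"
      by (auto simp: P_def cell_def)
    have le: "?k * emeasure lborel (P i) \<le> emeasure ?H (P i)" for i
    proof -
      have "?k * emeasure lborel (P i) \<le> hausdorff2_outer chain_space (P i)"
      proof (rule lborel_le_hausdorff2_outer)
        show "P i \<subseteq> mspace chain_space" using A' by (auto simp: P_def)
        show "0 < dist_const / 1024" using dist_const_pos by simp
        fix p q assume pq: "p \<in> P i" "q \<in> P i"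
        then have sq: "p \<in> square" "q \<in> square" using A' by (auto simp: P_def)
        have "near 1 n p q"
          using pq by (auto simp: P_def cell_def near_def coord_def)
        then show "dist_const / 1024 * sup_dist p q \<le> mdist chain_space p q"
          unfolding mdist_chain_space[OF sq] using pq by (intro sup_dist_le_chain_dist_stopped[OF sq]) (auto simp: P_def Z_def)
      qed
      then show ?thesis by (simp add: emeasure_hausdorff2 P_meas)
    qed
    have "?k * emeasure lborel (A \<inter> Z n) = ?k * (\<integral>\<^sup>+i. emeasure lborel (P i) \<partial>count_space UNIV)"
      unfolding un[symmetric] using P_meas disj by (subst emeasure_UN_countable) auto
    also have "\<dots> = (\<integral>\<^sup>+i. ?k * emeasure lborel (P i) \<partial>count_space UNIV)"
      by (rule nn_integral_cmult[symmetric]) simp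
    also have "\<dots> \<le> (\<integral>\<^sup>+i. emeasure ?H (P i) \<partial>count_space UNIV)"
      by (intro nn_integral_mono le)
    also have "\<dots> = emeasure ?H (\<Union>i. P i)"
      using P_meas disj by (subst emeasure_UN_countable) auto
    also have "\<dots> \<le> emeasure ?H A"
      unfolding un using A by (intro emeasure_mono) auto
    finally show ?thesis .
  qed
  have "(\<Union>n. A \<inter> Z n) = A \<inter> stopped" by (auto simp: Z_def stopped_def)
  moreover have "incseq (\<lambda>n. A \<inter> Z n)"
    by (rule incseq_SucI) (auto simp: Z_def intro: point_exp_stopped)
  ultimately have "emeasure lborel (A \<inter> stopped) = (SUP n. emeasure lborel (A \<inter> Z n))"
    using A' Z_meas by (subst SUP_emeasure_incseq) (auto intro!: sets.Int)
  then show ?thesis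
    by (simp add: SUP_mult_left_ennreal) (intro SUP_least piece)
qed

text \<open>On a common sigma-algebra the bound for sets becomes an order relation between measures,
  and this can be integrated.\<close>

lemma nn_integral_stopped_le_hausdorff2:
  assumes \<rho>: "\<rho> \<in> borel_measurable (hausdorff2 chain_space)"
  shows "ennreal ((dist_const / 1024)\<^sup>2 / 8) * (\<integral>\<^sup>+p. (\<rho> p)\<^sup>2 * indicator (square \<inter> stopped) p \<partial>lborel)
    \<le> (\<integral>\<^sup>+p. (\<rho> p)\<^sup>2 \<partial>hausdorff2 chain_space)"
proof -
  let ?H = "hausdorff2 chain_space" and ?k = "ennreal ((dist_const / 1024)\<^sup>2 / 8)"
  have sq: "square \<in> sets borel" by (simp add: borel_closed closed_Times)
  have sets_H: "sets ?H = sets (restrict_space borel square)"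
    by (rule sets_hausdorff2_top_of_set) (simp_all add: sq)
  define N where "N = restrict_space (density lborel (indicator stopped)) square"
  have sets_N: "sets N = sets ?H"
    unfolding N_def sets_H by (intro sets_restrict_space_cong) simp
  have "scale_measure ?k N \<le> ?H"
  proof (subst le_measure)
    show "sets (scale_measure ?k N) = sets ?H" by (simp add: sets_N)
    show "\<forall>A\<in>sets (scale_measure ?k N). emeasure (scale_measure ?k N) A \<le> emeasure ?H A"
    proof
      fix A assume "A \<in> sets (scale_measure ?k N)"
      then have A: "A \<in> sets ?H" by (simp add: sets_N)
      then have A': "A \<subseteq> square" "A \<in> sets borel"
        unfolding sets_H using sq by (auto simp: sets_restrict_space_iff)
      have "emeasure N A = emeasure (density lborel (indicator stopped)) A"
        unfolding N_def using A' sq by (intro emeasure_restrict_space) auto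
      also have "\<dots> = (\<integral>\<^sup>+p. indicator stopped p * indicator A p \<partial>lborel)"
        using A' by (intro emeasure_density) auto
      also have "\<dots> = (\<integral>\<^sup>+p. indicator (A \<inter> stopped) p \<partial>lborel)"
        by (intro nn_integral_cong) (auto simp: indicator_def)
      also have "\<dots> = emeasure lborel (A \<inter> stopped)"
        using A' by (intro nn_integral_indicator) auto
      finally show "emeasure (scale_measure ?k N) A \<le> emeasure ?H A"
        using emeasure_stopped_le_hausdorff2[OF A] by simp
    qed
  qed
  then have "(\<integral>\<^sup>+p. (\<rho> p)\<^sup>2 \<partial>scale_measure ?k N) \<le> (\<integral>\<^sup>+p. (\<rho> p)\<^sup>2 \<partial>?H)"
    by (intro nn_integral_mono_measure) (simp_all add: sets_N)
  moreover have "(\<integral>\<^sup>+p. (\<rho> p)\<^sup>2 \<partial>scale_measure ?k N) = ?k * (\<integral>\<^sup>+p. (\<rho> p)\<^sup>2 \<partial>N)"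
    using \<rho> sets_N by (intro nn_integral_scale_measure) (simp cong: measurable_cong_sets)
  moreover have "(\<integral>\<^sup>+p. (\<rho> p)\<^sup>2 \<partial>N) = (\<integral>\<^sup>+p. (\<rho> p)\<^sup>2 * indicator square p \<partial>density lborel (indicator stopped))"
    unfolding N_def using sq by (intro nn_integral_restrict_space) simp
  moreover have "\<dots> = (\<integral>\<^sup>+p. indicator stopped p * ((\<rho> p)\<^sup>2 * indicator square p) \<partial>lborel)"
  proof (rule nn_integral_density)
    have "(\<lambda>p. (\<rho> p)\<^sup>2) \<in> borel_measurable (restrict_space borel square)"
      using \<rho> sets_H by (simp cong: measurable_cong_sets)
    then show "(\<lambda>p. (\<rho> p)\<^sup>2 * indicator square p) \<in> borel_measurable lborel"
      using sq by (simp add: borel_measurable_restrict_space_iff_ennreal)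
  qed simp
  moreover have "\<dots> = (\<integral>\<^sup>+p. (\<rho> p)\<^sup>2 * indicator (square \<inter> stopped) p \<partial>lborel)"
    by (intro nn_integral_cong) (auto simp: indicator_def)
  ultimately show ?thesis by simp
qed

section \<open>The chain metric along horizontal segments\<close>

lemma cell_index_of_int [simp]: "cell_index m (of_int k / 512 ^ m) = k"
  by (simp add: cell_index_def)

text \<open>The chain visits the left end points of the cells crossed. Cells strictly in between are
  paid for twice, once on arrival and once on departure. The first cell counts once and the last
  three times, since it represents both \<open>w l\<close> and \<open>v\<close>; these four terms
  are estimated by the Euclidean size.\<close>

lemma chain_dist_horizontal_le_sum:
  assumes y: "y \<in> {0..1}" and u: "0 \<le> u" and uv: "u \<le> v" and v: "v \<le> 1"
  shows "chain_dist (u, y) (v, y) \<le>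
    4 * (1 / 512) ^ m + (\<Sum>t\<in>{cell_index m u<..<cell_index m v}. 2 * cell_size m (of_int t / 512 ^ m, y))"
proof -
  define w where "w k = (of_int k / 512 ^ m :: real, y)" for k :: int
  define i l where "i = cell_index m u" and "l = cell_index m v"
  have il: "i \<le> l" unfolding i_def l_def cell_index_def using uv by (intro floor_mono mult_left_mono) auto
  have i0: "0 \<le> i" using u by (simp add: i_def cell_index_def)
  have adj: "near 1 m (s, y) (t, y)" if "\<bar>cell_index m s - cell_index m t\<bar> \<le> 1" for s t
    using that by (auto simp: near_def coord_def)
  have sq: "(u, y) \<in> square" "(v, y) \<in> square" using assms by auto
  have w_sq: "w k \<in> square" if "i \<le> k" "k \<le> l" for k
  proof -
    have "of_int l \<le> 512 ^ m * v" unfolding l_def cell_index_def by simp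
    then have "of_int k \<le> 512 ^ m * v" using that(2) by linarith
    then have "of_int k / 512 ^ m \<le> v" by (simp add: field_simps)
    moreover have "0 \<le> (of_int k :: real)" using that i0 by simp
    ultimately have "0 \<le> of_int k / (512 :: real) ^ m" "of_int k / (512 :: real) ^ m \<le> 1"
      using v by (simp, linarith)
    then show ?thesis using y by (simp only: w_def mem_Sigma_iff atLeastAtMost_iff simp_thms)
  qed
  show ?thesis
  proof (cases "i = l")
    case True
    then have "chain_dist (u, y) (v, y) \<le> cell_size m (u, y) + cell_size m (v, y)"
      by (intro chain_dist_le_near adj) (simp add: i_def l_def)
    moreover have "0 \<le> (\<Sum>t\<in>{cell_index m u<..<cell_index m v}. 2 * cell_size m (of_int t / 512 ^ m, y))"
      by (intro sum_nonneg) simp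
    moreover have "0 \<le> (1 / 512 :: real) ^ m" by simp
    ultimately show ?thesis
      using cell_size_le[of m "(u, y)"] cell_size_le[of m "(v, y)"] by linarith
  next
    case False
    have chain: "chain_dist (u, y) (w (i + 1 + int n)) \<le>
        cell_size m (u, y) + (\<Sum>t\<in>{i<..<i + 1 + int n}. 2 * cell_size m (w t)) + cell_size m (w (i + 1 + int n))"
      if "i + 1 + int n \<le> l" for n
      using that
    proof (induction n)
      case 0
      have "chain_dist (u, y) (w (i + 1)) \<le> cell_size m (u, y) + cell_size m (w (i + 1))"
        unfolding w_def by (intro chain_dist_le_near adj) (simp only: cell_index_of_int; simp add: i_def)
      moreover have "{i<..<i + 1} = {}" by auto
      ultimately show ?case by simp
    next
      case (Suc n)
      define k where "k = i + 1 + int n"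
      have k: "i < k" "k + 1 \<le> l" using Suc.prems by (simp_all add: k_def)
      have "chain_dist (u, y) (w (k + 1)) \<le> chain_dist (u, y) (w k) + chain_dist (w k) (w (k + 1))"
        using k sq by (intro chain_dist_triangle w_sq) auto
      also have "chain_dist (u, y) (w k) \<le> cell_size m (u, y) + (\<Sum>t\<in>{i<..<k}. 2 * cell_size m (w t)) + cell_size m (w k)"
        using Suc unfolding k_def by simp
      also have "chain_dist (w k) (w (k + 1)) \<le> cell_size m (w k) + cell_size m (w (k + 1))"
        unfolding w_def by (intro chain_dist_le_near adj) (simp only: cell_index_of_int; simp)
      also have "{i<..<k + 1} = insert k {i<..<k}" using k by auto
      then have "cell_size m (u, y) + (\<Sum>t\<in>{i<..<k}. 2 * cell_size m (w t)) + cell_size m (w k) + (cell_size m (w k) + cell_size m (w (k + 1)))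
          = cell_size m (u, y) + (\<Sum>t\<in>{i<..<k + 1}. 2 * cell_size m (w t)) + cell_size m (w (k + 1))"
        by simp
      finally show ?case by (simp add: k_def algebra_simps)
    qed
    define n where "n = nat (l - i - 1)"
    have n: "i + 1 + int n = l" using False il by (simp add: n_def)
    have "chain_dist (u, y) (v, y) \<le> chain_dist (u, y) (w l) + chain_dist (w l) (v, y)"
      using il sq by (intro chain_dist_triangle w_sq) auto
    moreover have "chain_dist (u, y) (w l) \<le> cell_size m (u, y) + (\<Sum>t\<in>{i<..<l}. 2 * cell_size m (w t)) + cell_size m (w l)"
      using chain[of n] unfolding n by simp
    moreover have "chain_dist (w l) (v, y) \<le> cell_size m (w l) + cell_size m (v, y)"
      unfolding w_def by (intro chain_dist_le_near adj) (simp add: l_def)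
    ultimately show ?thesis
      using cell_size_le[of m "(u, y)"] cell_size_le[of m "(v, y)"] cell_size_le[of m "w l"]
      unfolding w_def i_def l_def by linarith
  qed
qed

lemma point_exp_section_measurable [measurable]: "(\<lambda>x. point_exp m (x, y)) \<in> borel \<rightarrow>\<^sub>M count_space UNIV"
  unfolding point_exp_def fst_conv snd_conv by measurable

text \<open>A cell size is the integral of 256^-k over the horizontal extent of the cell. Where the
  exponent is 0 the integrand is 1 and the point is stopped; elsewhere the integrand is at most
  16^-k. Cells strictly between those of \<open>u\<close> and \<open>v\<close> lie inside the
  segment.\<close>

lemma sum_cell_size_le_integral:
  assumes "0 \<le> u" "v \<le> 1"
  shows "(\<Sum>t\<in>{cell_index m u<..<cell_index m v}. ennreal (cell_size m (of_int t / 512 ^ m, y)))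
    \<le> emeasure lborel ({x. (x, y) \<in> stopped} \<inter> {u<..v}) + unstopped_weight m y"
proof -
  let ?f = "\<lambda>x. ennreal ((1 / 256) ^ point_exp m (x, y))"
  have sec: "{x. (x, y) \<in> stopped} \<in> sets borel"
    unfolding stopped_def mem_Collect_eq by measurable
  have cell_size: "ennreal (cell_size m (of_int t / 512 ^ m, y)) = (\<integral>\<^sup>+x. ?f x * indicator {x. cell_index m x = t} x \<partial>lborel)" for t
  proof -
    have "(\<integral>\<^sup>+x. ?f x * indicator {x. cell_index m x = t} x \<partial>lborel)
        = (\<integral>\<^sup>+x. ennreal ((1 / 256) ^ point_exp m (of_int t / 512 ^ m, y)) * indicator {x. cell_index m x = t} x \<partial>lborel)"
      by (intro nn_integral_cong) (auto simp: point_exp_def indicator_def)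
    also have "\<dots> = ennreal ((1 / 256) ^ point_exp m (of_int t / 512 ^ m, y)) * emeasure lborel {x. cell_index m x = t}"
      by (rule nn_integral_cmult_indicator) simp
    also have "emeasure lborel {x. cell_index m x = t} = ennreal ((1 / 512) ^ m)"
    proof -
      have "{x. cell_index m x = t} = {of_int t / 512 ^ m..<(of_int t + 1) / 512 ^ m}"
        by (auto simp: cell_index_eq_iff)
      then show ?thesis by (simp only:) (subst emeasure_lborel_Ico, auto simp: field_simps)
    qed
    finally show ?thesis by (simp add: cell_size_def flip: ennreal_mult)
  qed
  have "(\<Sum>t\<in>{cell_index m u<..<cell_index m v}. ennreal (cell_size m (of_int t / 512 ^ m, y)))
      = (\<integral>\<^sup>+x. (\<Sum>t\<in>{cell_index m u<..<cell_index m v}. ?f x * indicator {x. cell_index m x = t} x) \<partial>lborel)"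
    unfolding cell_size by (rule nn_integral_sum[symmetric]) measurable
  also have "\<dots> \<le> (\<integral>\<^sup>+x. indicator ({x. (x, y) \<in> stopped} \<inter> {u<..v}) x
      + ennreal (exp_weight True (point_exp m (x, y))) * indicator {0..<1} x \<partial>lborel)"
  proof (rule nn_integral_mono)
    fix x :: real
    have "(\<Sum>t\<in>{cell_index m u<..<cell_index m v}. ?f x * indicator {x. cell_index m x = t} x)
        = (\<Sum>t\<in>{cell_index m u<..<cell_index m v}. if cell_index m x = t then ?f x else 0)"
      by (intro sum.cong) (auto simp: indicator_def)
    also have "\<dots> = (if cell_index m x \<in> {cell_index m u<..<cell_index m v} then ?f x else 0)"
      by (simp add: sum.delta)
    also have "\<dots> \<le> indicator ({x. (x, y) \<in> stopped} \<inter> {u<..v}) x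
        + ennreal (exp_weight True (point_exp m (x, y))) * indicator {0..<1} x"
    proof (cases "cell_index m x \<in> {cell_index m u<..<cell_index m v}")
      case True
      have mono: "s < t" if "cell_index m s < cell_index m t" for s t
      proof (rule ccontr)
        assume "\<not> s < t"
        then have "cell_index m t \<le> cell_index m s" unfolding cell_index_def by (intro floor_mono mult_left_mono) auto
        then show False using that by simp
      qed
      have x: "u < x" "x < v" using True mono by auto
      show ?thesis
      proof (cases "point_exp m (x, y) = 0")
        case True
        then have "(x, y) \<in> stopped" by (auto simp: stopped_def)
        then show ?thesis using x True by simp
      next
        case False
        have "(1 / 256 :: real) ^ point_exp m (x, y) \<le> (1 / 16) ^ point_exp m (x, y)"
          by (intro power_mono) auto
        then have "?f x \<le> ennreal (exp_weight True (point_exp m (x, y))) * indicator {0..<1} x"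
          using x assms False by (auto simp: exp_weight_def intro: ennreal_leI)
        then show ?thesis using True by (auto intro: add_increasing)
      qed
    qed auto
    finally show "(\<Sum>t\<in>{cell_index m u<..<cell_index m v}. ?f x * indicator {x. cell_index m x = t} x)
        \<le> indicator ({x. (x, y) \<in> stopped} \<inter> {u<..v}) x + ennreal (exp_weight True (point_exp m (x, y))) * indicator {0..<1} x" .
  qed
  also have "\<dots> = (\<integral>\<^sup>+x. indicator ({x. (x, y) \<in> stopped} \<inter> {u<..v}) x \<partial>lborel) + unstopped_weight m y"
    unfolding unstopped_weight_def using sec by (intro nn_integral_add) measurable
  also have "(\<integral>\<^sup>+x. indicator ({x. (x, y) \<in> stopped} \<inter> {u<..v}) x \<partial>lborel)
      = emeasure lborel ({x. (x, y) \<in> stopped} \<inter> {u<..v})"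
    using sec by (intro nn_integral_indicator) auto
  finally show ?thesis .
qed

text \<open>As \<open>m\<close> grows, both the end cells and the unstopped weight tend to 0, so
  only the stopped part of the segment remains; the factor 2 is that of the chain.\<close>

lemma chain_dist_horizontal_le:
  assumes y: "y \<in> {0..<1}" "(\<Sum>m. unstopped_weight m y) < \<infinity>"
    and u: "0 \<le> u" and uv: "u \<le> v" and v: "v \<le> 1"
  shows "ennreal (chain_dist (u, y) (v, y)) \<le> 2 * emeasure lborel ({x. (x, y) \<in> stopped} \<inter> {u<..v})"
proof (rule ennreal_le_epsilon)
  fix e :: real assume e: "0 < e"
  let ?E = "emeasure lborel ({x. (x, y) \<in> stopped} \<inter> {u<..v})"
  have "0 < e / 4" using e by simp
  from ennreal_suminf_tail_le[OF y(2) this] obtain n where n: "(\<Sum>k. unstopped_weight (k + n) y) \<le> ennreal (e / 4)"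
    by blast
  obtain k where k: "(1 / 512) ^ k < e / 8"
    using real_arch_pow_inv[of "e / 8" "1 / 512"] e by auto
  define m where "m = k + n"
  have "unstopped_weight (k + n) y \<le> (\<Sum>k. unstopped_weight (k + n) y)"
    using sum_le_suminf[of "\<lambda>k. unstopped_weight (k + n) y" "{k}"] by simp
  with n have um: "unstopped_weight m y \<le> ennreal (e / 4)" unfolding m_def by (rule order_trans[rotated])
  have "(1 / 512 :: real) ^ m \<le> (1 / 512) ^ k"
    by (intro power_decreasing) (auto simp: m_def)
  with k have small: "4 * (1 / 512) ^ m \<le> e / 2" by linarith
  have "ennreal (chain_dist (u, y) (v, y)) \<le> ennreal (e / 2 + (\<Sum>t\<in>{cell_index m u<..<cell_index m v}. 2 * cell_size m (of_int t / 512 ^ m, y)))"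
    using chain_dist_horizontal_le_sum[of y u v m] y u uv v small by (intro ennreal_leI) auto
  also have "\<dots> = ennreal (e / 2) + 2 * (\<Sum>t\<in>{cell_index m u<..<cell_index m v}. ennreal (cell_size m (of_int t / 512 ^ m, y)))"
    using e by (simp add: sum_nonneg sum_ennreal ennreal_mult flip: sum_distrib_left)
  also have "\<dots> \<le> ennreal (e / 2) + 2 * (?E + ennreal (e / 4))"
    using order_trans[OF sum_cell_size_le_integral[OF u v, of m y] add_left_mono[OF um]]
    by (intro add_left_mono mult_left_mono) auto
  also have "\<dots> = 2 * ?E + (ennreal (e / 2) + 2 * ennreal (e / 4))"
    by (simp add: distrib_left ac_simps)
  also have "ennreal (e / 2) + 2 * ennreal (e / 4) = ennreal e"
  proof -
    have "2 * ennreal (e / 4) = ennreal (2 * (e / 4))"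
      using e by (subst ennreal_mult) auto
    then show ?thesis using e by (simp flip: ennreal_plus)
  qed
  finally show "ennreal (chain_dist (u, y) (v, y)) \<le> 2 * ?E + ennreal e" .
qed

section \<open>Moduli of horizontal families\<close>

lemma locally_rectifiable_dominated:
  assumes "dominated_path X \<gamma> a b m w C"
  shows "mlength X \<gamma> a b < \<infinity>"
proof -
  interpret dominated_path X \<gamma> a b m w C by fact
  show ?thesis using mlength_le[of b] ab by (auto intro: le_less_trans)
qed

definition horizontal :: "real \<Rightarrow> real \<Rightarrow> real \<times> real" where
  "horizontal y = (\<lambda>x. (x, y))"

text \<open>The truncation at 1 keeps the function finite, increasing and Lipschitz on the whole
  line, as the locale \<open>dominated_path\<close> requires.\<close>

definition horizontal_bound :: "real \<Rightarrow> real \<Rightarrow> real" where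
  "horizontal_bound y v = 2 * measure lborel ({x. (x, y) \<in> stopped} \<inter> {0<..min 1 v})"

definition horizontal_density :: "real \<Rightarrow> real \<Rightarrow> ennreal" where
  "horizontal_density y x = 2 * indicator ({x. (x, y) \<in> stopped} \<inter> {0<..1}) x"

lemma section_measurable [measurable]: "{x. (x, y) \<in> stopped} \<in> sets borel"
  unfolding stopped_def mem_Collect_eq by measurable

lemma fmeasurable_Ioc: "{u<..v::real} \<in> fmeasurable lborel"
  by (cases "u \<le> v") (auto intro!: fmeasurableI)

lemma fmeasurable_unit: "A \<in> sets borel \<Longrightarrow> A \<subseteq> {0<..1::real} \<Longrightarrow> A \<in> fmeasurable lborel"
  using fmeasurableI2[OF fmeasurable_Ioc, of A 0 1] by simp

lemma horizontal_bound_diff: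
  assumes "u \<le> v"
  shows "horizontal_bound y v - horizontal_bound y u = 2 * measure lborel ({x. (x, y) \<in> stopped} \<inter> ({0<..1} \<inter> {u<..v}))"
proof -
  let ?A = "{x. (x, y) \<in> stopped}"
  have fin: "?A \<inter> {0<..min 1 u} \<in> fmeasurable lborel" "?A \<inter> ({0<..1} \<inter> {u<..v}) \<in> fmeasurable lborel"
    by (rule fmeasurable_unit; auto)+
  have "?A \<inter> {0<..min 1 v} = (?A \<inter> {0<..min 1 u}) \<union> (?A \<inter> ({0<..1} \<inter> {u<..v}))"
    using assms by auto
  then have "measure lborel (?A \<inter> {0<..min 1 v})
      = measure lborel (?A \<inter> {0<..min 1 u}) + measure lborel (?A \<inter> ({0<..1} \<inter> {u<..v}))"
    using fin by (simp only:) (rule measure_Un_AE, auto intro!: AE_I2 fmeasurableD)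
  then show ?thesis by (simp add: horizontal_bound_def)
qed

lemma ennreal_horizontal_bound_diff:
  assumes "u \<le> v"
  shows "ennreal (horizontal_bound y v - horizontal_bound y u) = 2 * emeasure lborel ({x. (x, y) \<in> stopped} \<inter> ({0<..1} \<inter> {u<..v}))"
proof -
  have "{x. (x, y) \<in> stopped} \<inter> ({0<..1} \<inter> {u<..v}) \<in> fmeasurable lborel"
    by (rule fmeasurable_unit) auto
  then show ?thesis
    unfolding horizontal_bound_diff[OF assms] by (simp add: ennreal_mult emeasure_eq_measure2)
qed

lemma dominated_path_chain_space:
  assumes y: "y \<in> {0..<1}" "(\<Sum>m. unstopped_weight m y) < \<infinity>"
    and ab: "0 \<le> a" "a \<le> b" "b \<le> 1"
  shows "dominated_path chain_space (horizontal y) a b (horizontal_bound y) (horizontal_density y) 2"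
proof
  show "horizontal y t \<in> mspace chain_space" if "t \<in> {a..b}" for t
    using that y ab by (auto simp: horizontal_def)
  show "inj_on (horizontal y) {a..b}" by (auto simp: horizontal_def inj_on_def)
  show "horizontal_bound y u \<le> horizontal_bound y v" if "u \<le> v" for u v
    using horizontal_bound_diff[OF that, of y] measure_nonneg[of lborel "{x. (x, y) \<in> stopped} \<inter> ({0<..1} \<inter> {u<..v})"] by linarith
  show "mdist chain_space (horizontal y u) (horizontal y v) \<le> horizontal_bound y v - horizontal_bound y u" if "a \<le> u" "u \<le> v" "v \<le> b" for u v
  proof -
    have sq: "horizontal y u \<in> square" "horizontal y v \<in> square" using that y ab by (auto simp: horizontal_def)
    have "{x. (x, y) \<in> stopped} \<inter> {u<..v} = {x. (x, y) \<in> stopped} \<inter> ({0<..1} \<inter> {u<..v})"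
      using that ab by auto
    then have "ennreal (chain_dist (u, y) (v, y)) \<le> ennreal (horizontal_bound y v - horizontal_bound y u)"
      using chain_dist_horizontal_le[OF y, of u v] that ab by (simp add: ennreal_horizontal_bound_diff)
    moreover have "0 \<le> horizontal_bound y v - horizontal_bound y u"
      unfolding horizontal_bound_diff[OF that(2)] by simp
    ultimately show ?thesis
      unfolding mdist_chain_space[OF sq] by (simp add: horizontal_def)
  qed
  show "horizontal_bound y v - horizontal_bound y u \<le> 2 * (v - u)" if "u \<le> v" for u v
  proof -
    have "measure lborel ({x. (x, y) \<in> stopped} \<inter> ({0<..1} \<inter> {u<..v})) \<le> measure lborel {u<..v}"
      using fmeasurable_Ioc by (intro measure_mono_fmeasurable) auto
    then show ?thesis using that by (simp add: horizontal_bound_diff)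
  qed
  show "horizontal_density y \<in> borel_measurable borel"
    unfolding horizontal_density_def by measurable
  show "ennreal (horizontal_bound y v - horizontal_bound y u) = (\<integral>\<^sup>+t. horizontal_density y t * indicator {u<..v} t \<partial>lborel)" if "u \<le> v" for u v
  proof -
    have "(\<integral>\<^sup>+t. horizontal_density y t * indicator {u<..v} t \<partial>lborel)
        = (\<integral>\<^sup>+t. 2 * indicator ({x. (x, y) \<in> stopped} \<inter> ({0<..1} \<inter> {u<..v})) t \<partial>lborel)"
      by (intro nn_integral_cong) (auto simp: horizontal_density_def indicator_def)
    also have "\<dots> = 2 * emeasure lborel ({x. (x, y) \<in> stopped} \<inter> ({0<..1} \<inter> {u<..v}))"
      by (rule nn_integral_cmult_indicator) auto
    finally show ?thesis using ennreal_horizontal_bound_diff[OF that] by simp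
  qed
qed (use ab in auto)

lemma dominated_path_unit_square:
  assumes "y \<in> {0..1}" "0 \<le> a" "a \<le> b" "b \<le> 1"
  shows "dominated_path unit_square (horizontal y) a b (\<lambda>t. t) (\<lambda>_. 1) 1"
proof
  show "horizontal y t \<in> mspace unit_square" if "t \<in> {a..b}" for t
    using that assms by (auto simp: horizontal_def)
  show "ennreal (v - u) = (\<integral>\<^sup>+t. 1 * indicator {u<..v} t \<partial>lborel)" if "u \<le> v" for u v :: real
    using that by simp
qed (use assms in \<open>auto simp: horizontal_def inj_on_def dist_prod_def dist_real_def\<close>)

lemma closed_line_integral_unit_square_ge:
  assumes "y \<in> {0..1}" "0 \<le> a" "a \<le> b" "b \<le> 1" and \<rho>: "\<And>t. t \<in> {a..b} \<Longrightarrow> c \<le> \<rho> (t, y)"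
  shows "c * ennreal (b - a) \<le> closed_line_integral unit_square (horizontal y) a b \<rho>"
proof -
  interpret dominated_path unit_square "horizontal y" a b "\<lambda>t. t" "\<lambda>_. 1" 1
    by (rule dominated_path_unit_square) fact+
  have "b - a = mdist unit_square (horizontal y a) (horizontal y b)"
    using assms by (simp add: horizontal_def dist_prod_def dist_real_def)
  then have Sb: "b - a \<le> S b" using S_diff_ge[of a b] ab by simp
  have "c * ennreal (b - a) \<le> c * ennreal (S b)"
    using Sb by (intro mult_left_mono ennreal_leI) auto
  also have "\<dots> = (\<integral>\<^sup>+u. c * indicator {0..S b} u \<partial>lborel)"
    by (subst nn_integral_cmult_indicator) auto
  also have "\<dots> \<le> (\<integral>\<^sup>+u. \<rho> (horizontal y (T u)) * indicator {0..S b} u \<partial>lborel)"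
    using T_in_S_T(1) \<rho> by (intro nn_integral_mono) (auto simp: indicator_def horizontal_def)
  also have "\<dots> = closed_line_integral unit_square (horizontal y) a b \<rho>"
    unfolding closed_line_integral_def arclength_param_def T_def S_def ..
  finally show ?thesis .
qed

text \<open>All digits are 256, far from the frame, so the exponent rises at every level: these are
  cells of arbitrarily large exponent.\<close>

primrec mid :: "nat \<Rightarrow> int" where
  "mid 0 = 0"
| "mid (Suc n) = 512 * mid n + 256"

lemma mid_nonneg: "0 \<le> mid n" and mid_less: "mid n < 512 ^ n"
  by (induction n) auto

lemma weight_exp_mid: "weight_exp n (mid n) (mid n) = Suc n"
  by (induction n) (auto simp: frame_def Let_def)

definition mid_lo :: "nat \<Rightarrow> real" where
  "mid_lo n = of_int (mid n) / 512 ^ n"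

definition mid_hi :: "nat \<Rightarrow> real" where
  "mid_hi n = mid_lo n + (1 / 512) ^ n"

lemma mid_lo_hi: "0 \<le> mid_lo n" "mid_lo n < mid_hi n" "mid_hi n \<le> 1"
proof -
  show "0 \<le> mid_lo n" "mid_lo n < mid_hi n" using mid_nonneg[of n] by (simp_all add: mid_lo_def mid_hi_def)
  have "mid n + 1 \<le> 512 ^ n" using mid_less[of n] by simp
  then have "real_of_int (mid n + 1) \<le> real_of_int (512 ^ n)"
    by (simp only: of_int_le_iff)
  then have "real_of_int (mid n) + 1 \<le> 512 ^ n" by simp
  then show "mid_hi n \<le> 1" by (simp add: mid_lo_def mid_hi_def field_simps)
qed

lemma cell_mid: "cell n (mid n) (mid n) = {mid_lo n..<mid_hi n} \<times> {mid_lo n..<mid_hi n}"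
proof -
  have "(of_int (mid n) + 1) / 512 ^ n = mid_hi n" by (simp add: mid_lo_def mid_hi_def add_divide_distrib power_divide)
  then show ?thesis by (simp add: cell_eq mid_lo_def)
qed

definition test_paths :: "nat \<Rightarrow> (real \<times> real) mpath set" where
  "test_paths n = (\<lambda>y. ({mid_lo n..mid_hi n}, horizontal y)) ` {mid_lo n..mid_hi n}"

lemma is_mpath_test_paths: "p \<in> test_paths n \<Longrightarrow> is_mpath unit_square p"
proof -
  assume "p \<in> test_paths n"
  then obtain y where y: "y \<in> {mid_lo n..mid_hi n}" "p = ({mid_lo n..mid_hi n}, horizontal y)"
    by (auto simp: test_paths_def)
  have "continuous_on {mid_lo n..mid_hi n} (horizontal y)"
    unfolding horizontal_def by (intro continuous_intros)
  moreover have "horizontal y ` {mid_lo n..mid_hi n} \<subseteq> square"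
    using y(1) mid_lo_hi[of n] by (auto simp: horizontal_def)
  ultimately show ?thesis
    using y mid_lo_hi[of n] by (auto simp: is_mpath_def is_interval_cc)
qed

text \<open>The density is the reciprocal side length on the closed cell, so the bound does not
  depend on \<open>n\<close>. The value 4 is the square of the factor in
  \<open>dist_le_sup_dist\<close>.\<close>

lemma modulus_test_paths_le: "modulus unit_square (test_paths n) \<le> 4"
proof -
  define h where "h = (1 / 512 :: real) ^ n"
  have h: "0 < h" "mid_hi n = mid_lo n + h" by (simp_all add: h_def mid_hi_def)
  define Q where "Q = {mid_lo n..mid_lo n + h} \<times> {mid_lo n..mid_lo n + h}"
  define \<rho> where "\<rho> p = ennreal (1 / h) * indicator Q p" for p
  have sq: "square \<in> sets borel" by (simp add: borel_closed closed_Times)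
  have Q: "Q \<subseteq> square" using mid_lo_hi[of n] h by (auto simp: Q_def)
  have Q_sets: "Q \<in> sets (hausdorff2 unit_square)"
  proof -
    have "Q \<in> sets borel" by (simp add: Q_def borel_closed closed_Times)
    then show ?thesis
      using Q sq by (subst sets_hausdorff2_top_of_set[where S = square]) (auto simp: sets_restrict_space_iff)
  qed
  have "admissible unit_square (test_paths n) \<rho>"
    unfolding admissible_def
  proof (intro conjI ballI impI)
    show "\<rho> \<in> borel_measurable (hausdorff2 unit_square)"
      unfolding \<rho>_def using Q_sets by measurable
    fix p assume "p \<in> test_paths n"
    then obtain y where y: "y \<in> {mid_lo n..mid_hi n}" "p = ({mid_lo n..mid_hi n}, horizontal y)"
      by (auto simp: test_paths_def)
    have "1 = ennreal (1 / h) * ennreal (mid_hi n - mid_lo n)"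
      using h by (simp flip: ennreal_mult)
    also have "\<dots> \<le> closed_line_integral unit_square (horizontal y) (mid_lo n) (mid_hi n) \<rho>"
      using y(1) mid_lo_hi[of n] h
      by (intro closed_line_integral_unit_square_ge) (auto simp: \<rho>_def Q_def)
    also have "\<dots> \<le> line_integral unit_square p \<rho>"
      unfolding line_integral_def y(2) prod.case using mid_lo_hi[of n]
      by (intro SUP_upper2[of "(mid_lo n, mid_hi n)"]) auto
    finally show "1 \<le> line_integral unit_square p \<rho>" .
  qed
  then have "modulus unit_square (test_paths n) \<le> (\<integral>\<^sup>+p. (\<rho> p)\<^sup>2 \<partial>hausdorff2 unit_square)"
    unfolding modulus_def by (intro INF_lower) simp
  also have "\<dots> = (\<integral>\<^sup>+p. ennreal ((1 / h)\<^sup>2) * indicator Q p \<partial>hausdorff2 unit_square)"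
    using h by (intro nn_integral_cong) (simp add: \<rho>_def indicator_def ennreal_power)
  also have "\<dots> = ennreal ((1 / h)\<^sup>2) * hausdorff2_outer unit_square Q"
    using Q_sets by (simp add: nn_integral_cmult_indicator emeasure_hausdorff2)
  also have "\<dots> \<le> ennreal ((1 / h)\<^sup>2) * ennreal (2\<^sup>2 * h\<^sup>2)"
    unfolding Q_def using Q h dist_le_sup_dist
    by (intro mult_left_mono hausdorff2_outer_box) (auto simp: Q_def)
  also have "\<dots> = ennreal 4"
    using h by (simp add: power_divide flip: ennreal_mult)
  finally show ?thesis by simp
qed

lemma line_integral_chain_space_le:
  assumes y: "y \<in> {0..<1}" "(\<Sum>m. unstopped_weight m y) < \<infinity>"
    and \<rho>: "\<rho> \<in> borel_measurable (hausdorff2 chain_space)"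
  shows "line_integral chain_space ({mid_lo n..mid_hi n}, horizontal y) \<rho>
    \<le> (\<integral>\<^sup>+x. 2 * (indicator (stopped \<inter> {mid_lo n..<mid_hi n} \<times> UNIV) (x, y) * (\<rho> (x, y) * indicator square (x, y))) \<partial>lborel)"
  unfolding line_integral_def prod.case
proof (rule SUP_least, clarify)
  have sq: "square \<in> sets borel" by (simp add: borel_closed closed_Times)
  have "\<rho> \<in> borel_measurable (restrict_space borel square)"
    using \<rho> sets_hausdorff2_top_of_set[of chain_space square] sq by (simp cong: measurable_cong_sets)
  then have "(\<lambda>p. \<rho> p * indicator square p) \<in> borel_measurable borel"
    using sq by (simp add: borel_measurable_restrict_space_iff_ennreal)
  then have "(\<lambda>p. \<rho> p * indicator square p) \<in> borel_measurable (borel \<Otimes>\<^sub>M borel)"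
    by (simp add: borel_prod)
  from measurable_compose[OF measurable_Pair2' this, of y]
  have g: "(\<lambda>x. \<rho> (x, y) * indicator square (x, y)) \<in> borel_measurable borel"
    by simp
  fix a b assume in_lo_hi: "a \<in> {mid_lo n..mid_hi n}" "b \<in> {mid_lo n..mid_hi n}" "a \<le> b"
  then have ab01: "0 \<le> a" "a \<le> b" "b \<le> 1" using mid_lo_hi[of n] by auto
  interpret dominated_path chain_space "horizontal y" a b "horizontal_bound y" "horizontal_density y" 2
    by (rule dominated_path_chain_space[OF y ab01])
  have "closed_line_integral chain_space (horizontal y) a b \<rho>
      \<le> (\<integral>\<^sup>+x. horizontal_density y x * indicator {a<..b} x * (\<rho> (x, y) * indicator square (x, y)) \<partial>lborel)"
    using y ab01 by (intro closed_line_integral_le[OF g]) (auto simp: horizontal_def)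
  also have "\<dots> \<le> (\<integral>\<^sup>+x. 2 * (indicator (stopped \<inter> {mid_lo n..<mid_hi n} \<times> UNIV) (x, y) * (\<rho> (x, y) * indicator square (x, y))) \<partial>lborel)"
  proof (rule nn_integral_mono_AE)
    \<comment> \<open>Cells are half-open while the paths run over a closed interval; the right end
      point is a null set.\<close>
    have "AE x in lborel. x \<noteq> mid_hi n" by (rule AE_lborel_singleton)
    then show "AE x in lborel. horizontal_density y x * indicator {a<..b} x * (\<rho> (x, y) * indicator square (x, y))
        \<le> 2 * (indicator (stopped \<inter> {mid_lo n..<mid_hi n} \<times> UNIV) (x, y) * (\<rho> (x, y) * indicator square (x, y)))"
      by eventually_elim (use in_lo_hi in \<open>auto simp: horizontal_density_def indicator_def\<close>)
  qed
  finally show "closed_line_integral chain_space (horizontal y) a b \<rho>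
      \<le> (\<integral>\<^sup>+x. 2 * (indicator (stopped \<inter> {mid_lo n..<mid_hi n} \<times> UNIV) (x, y) * (\<rho> (x, y) * indicator square (x, y))) \<partial>lborel)" .
qed

lemma locally_rectifiable_test_path:
  assumes y: "y \<in> {0..<1}" "(\<Sum>m. unstopped_weight m y) < \<infinity>"
  shows "locally_rectifiable chain_space ({mid_lo n..mid_hi n}, horizontal y)"
  unfolding locally_rectifiable_def prod.case
proof (intro ballI impI)
  fix a b assume "a \<in> {mid_lo n..mid_hi n}" "b \<in> {mid_lo n..mid_hi n}" "a \<le> b"
  then show "mlength chain_space (horizontal y) a b < \<infinity>"
    using mid_lo_hi[of n] by (intro locally_rectifiable_dominated[OF dominated_path_chain_space[OF y]]) auto
qed

text \<open>Admissibility on almost every horizontal segment gives \<open>h\<close> as a lower bound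
  for twice the integral of the density over the stopped part of the cell. Squaring and the
  Cauchy-Schwarz inequality bring in the area of that part, which is at most
  \<open>h\<^sup>2\<close> divided by 16^(n+1), as \<open>mid\<close> has exponent
  \<open>n + 1\<close>. The number 32 is 8, from the comparison with Lebesgue measure, times the
  square of the factor 2.\<close>

lemma modulus_image_ge:
  "ennreal ((dist_const / 1024)\<^sup>2 / 32 * 16 ^ Suc n) \<le> modulus chain_space (path_image_family id (test_paths n))"
  unfolding modulus_def
proof (rule INF_greatest)
  define h where "h = (1 / 512 :: real) ^ n"
  have h: "0 < h" "mid_hi n = mid_lo n + h" by (simp_all add: h_def mid_hi_def)
  define Q where "Q = cell n (mid n) (mid n)"
  have Q: "Q = {mid_lo n..<mid_hi n} \<times> {mid_lo n..<mid_hi n}" unfolding Q_def by (rule cell_mid)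
  fix \<rho> assume "\<rho> \<in> {\<rho>. admissible chain_space (path_image_family id (test_paths n)) \<rho>}"
  then have meas: "\<rho> \<in> borel_measurable (hausdorff2 chain_space)"
    and adm: "\<And>y. y \<in> {mid_lo n..mid_hi n} \<Longrightarrow> locally_rectifiable chain_space ({mid_lo n..mid_hi n}, horizontal y) \<Longrightarrow>
      1 \<le> line_integral chain_space ({mid_lo n..mid_hi n}, horizontal y) \<rho>"
    by (auto simp: admissible_def path_image_family_def test_paths_def)
  have sq: "square \<in> sets borel" by (simp add: borel_closed closed_Times)
  have "\<rho> \<in> borel_measurable (restrict_space borel square)"
    using meas sets_hausdorff2_top_of_set[of chain_space square] sq by (simp cong: measurable_cong_sets)
  then have \<rho>0: "(\<lambda>p. \<rho> p * indicator square p) \<in> borel_measurable borel"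
    using sq by (simp add: borel_measurable_restrict_space_iff_ennreal)
  define f where "f p = (indicator (stopped \<inter> Q) p :: ennreal)" for p
  define g where "g p = indicator stopped p * (\<rho> p * indicator square p)" for p
  have f_meas: "f \<in> borel_measurable lborel"
    unfolding f_def[abs_def] Q_def by measurable
  have g_meas: "g \<in> borel_measurable lborel"
    unfolding g_def[abs_def] using \<rho>0 by measurable
  have fg: "(\<lambda>p. f p * g p) \<in> borel_measurable (lborel \<Otimes>\<^sub>M lborel)"
    unfolding lborel_prod using f_meas g_meas by (rule borel_measurable_times_ennreal)
  have fg2: "(\<lambda>p. 2 * (f p * g p)) \<in> borel_measurable (lborel \<Otimes>\<^sub>M lborel)"
    by (rule borel_measurable_times_ennreal[OF _ fg]) simp
  have "ennreal h = (\<integral>\<^sup>+y. indicator {mid_lo n..<mid_hi n} y \<partial>lborel)"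
    using h by simp
  also have "\<dots> \<le> (\<integral>\<^sup>+y. (\<integral>\<^sup>+x. 2 * (f (x, y) * g (x, y)) \<partial>lborel) \<partial>lborel)"
  proof (rule nn_integral_mono_AE)
    show "AE y in lborel. indicator {mid_lo n..<mid_hi n} y \<le> (\<integral>\<^sup>+x. 2 * (f (x, y) * g (x, y)) \<partial>lborel)"
      using AE_unstopped_weight_summable
    proof eventually_elim
      fix y assume s: "y \<in> {0..<1} \<longrightarrow> (\<Sum>m. unstopped_weight m y) < \<infinity>"
      show "indicator {mid_lo n..<mid_hi n} y \<le> (\<integral>\<^sup>+x. 2 * (f (x, y) * g (x, y)) \<partial>lborel)"
      proof (cases "y \<in> {mid_lo n..<mid_hi n}")
        case True
        then have y: "y \<in> {0..<1}" using mid_lo_hi[of n] by auto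
        with s have s: "(\<Sum>m. unstopped_weight m y) < \<infinity>" by blast
        \<comment> \<open>Admissibility says nothing about paths that are not locally rectifiable,
          so rectifiability of the image has to be supplied here; it comes with the dominated
          path.\<close>
        have "1 \<le> line_integral chain_space ({mid_lo n..mid_hi n}, horizontal y) \<rho>"
          using True by (intro adm locally_rectifiable_test_path y s) auto
        also have "\<dots> \<le> (\<integral>\<^sup>+x. 2 * (indicator (stopped \<inter> {mid_lo n..<mid_hi n} \<times> UNIV) (x, y)
            * (\<rho> (x, y) * indicator square (x, y))) \<partial>lborel)"
          by (rule line_integral_chain_space_le[OF y s meas])
        also have "\<dots> = (\<integral>\<^sup>+x. 2 * (f (x, y) * g (x, y)) \<partial>lborel)"
          by (intro nn_integral_cong) (use True in \<open>auto simp: f_def g_def Q indicator_def\<close>)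
        finally show ?thesis using True by simp
      qed simp
    qed
  qed
  also have "\<dots> = (\<integral>\<^sup>+p. 2 * (f p * g p) \<partial>lborel)"
    unfolding lborel_prod[symmetric] by (rule lborel_pair.nn_integral_snd) (use fg2 in simp)
  also have "\<dots> = 2 * (\<integral>\<^sup>+p. f p * g p \<partial>lborel)"
    using fg unfolding lborel_prod by (rule nn_integral_cmult)
  finally have 1: "ennreal h \<le> 2 * (\<integral>\<^sup>+p. f p * g p \<partial>lborel)" .
  define I where "I = (\<integral>\<^sup>+p. (\<rho> p)\<^sup>2 * indicator (square \<inter> stopped) p \<partial>lborel)"
  have "ennreal (h\<^sup>2) = (ennreal h)\<^sup>2" using h by (simp add: ennreal_power)
  also have "\<dots> \<le> (2 * (\<integral>\<^sup>+p. f p * g p \<partial>lborel))\<^sup>2" using 1 by (rule power_mono) simp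
  also have "\<dots> = 4 * (\<integral>\<^sup>+p. f p * g p \<partial>lborel)\<^sup>2" by (simp add: power_mult_distrib)
  also have "\<dots> \<le> 4 * ((\<integral>\<^sup>+p. (f p)\<^sup>2 \<partial>lborel) * (\<integral>\<^sup>+p. (g p)\<^sup>2 \<partial>lborel))"
    by (intro mult_left_mono Cauchy_Schwarz_nn_integral f_meas g_meas) simp
  also have "(\<integral>\<^sup>+p. (g p)\<^sup>2 \<partial>lborel) = I"
    unfolding I_def by (intro nn_integral_cong) (auto simp: g_def indicator_def)
  also have "(\<integral>\<^sup>+p. (f p)\<^sup>2 \<partial>lborel) = (\<integral>\<^sup>+p. indicator (stopped \<inter> Q) p \<partial>lborel)"
    by (intro nn_integral_cong) (auto simp: f_def indicator_def)
  also have "\<dots> = emeasure lborel (stopped \<inter> Q)"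
    unfolding Q_def by (intro nn_integral_indicator) auto
  also have "4 * (emeasure lborel (stopped \<inter> Q) * I) \<le> 4 * (ennreal (h * h * (1 / 16) ^ Suc n) * I)"
    unfolding Q_def h_def weight_exp_mid[of n, symmetric]
    by (intro mult_left_mono mult_right_mono emeasure_stopped_cell) auto
  finally have 2: "ennreal (h\<^sup>2) \<le> 4 * (ennreal (h * h * (1 / 16) ^ Suc n) * I)" .
  let ?k = "(dist_const / 1024)\<^sup>2 / 8"
  \<comment> \<open>Chosen so that multiplying the inequality \<open>2\<close> by \<open>c\<close>
    leaves exactly the constant \<open>?k\<close> in front of \<open>I\<close>.\<close>
  define c where "c = ?k * 16 ^ Suc n / (4 * h\<^sup>2)"
  have c: "0 \<le> c" by (simp add: c_def)
  have "ennreal (c * h\<^sup>2) = ennreal c * ennreal (h\<^sup>2)" using c by (simp add: ennreal_mult)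
  also have "\<dots> \<le> ennreal c * (4 * (ennreal (h * h * (1 / 16) ^ Suc n) * I))"
    using 2 by (rule mult_left_mono) simp
  also have "\<dots> = ennreal (c * 4 * (h * h * (1 / 16) ^ Suc n)) * I"
  proof -
    have "ennreal (c * 4 * z) = ennreal c * 4 * ennreal z" if "0 \<le> z" for z
      using c that by (simp only: ennreal_mult mult_nonneg_nonneg zero_le_numeral ennreal_numeral)
    from this[of "h * h * (1 / 16) ^ Suc n"] h show ?thesis by (simp add: mult.assoc)
  qed
  also have "c * 4 * (h * h * (1 / 16) ^ Suc n) = ?k"
    using h by (simp add: c_def power2_eq_square power_divide)
  also have "ennreal ?k * I \<le> (\<integral>\<^sup>+p. (\<rho> p)\<^sup>2 \<partial>hausdorff2 chain_space)"
    unfolding I_def by (rule nn_integral_stopped_le_hausdorff2[OF meas])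
  also have "c * h\<^sup>2 = (dist_const / 1024)\<^sup>2 / 32 * 16 ^ Suc n"
    using h by (simp add: c_def)
  finally show "ennreal ((dist_const / 1024)\<^sup>2 / 32 * 16 ^ Suc n) \<le> (\<integral>\<^sup>+p. (\<rho> p)\<^sup>2 \<partial>hausdorff2 chain_space)" .
qed

lemma not_quasiconformal_chain_space: "\<not> quasiconformal unit_square chain_space id"
proof
  assume "quasiconformal unit_square chain_space id"
  then obtain K :: real where K: "K \<ge> 1" "\<And>\<Gamma>. (\<forall>p\<in>\<Gamma>. is_mpath unit_square p) \<Longrightarrow>
      modulus chain_space (path_image_family id \<Gamma>) \<le> ennreal K * modulus unit_square \<Gamma>"
    by (auto simp: quasiconformal_def)
  define k where "k = (dist_const / 1024)\<^sup>2 / 32"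
  have k: "0 < k" using dist_const_pos by (simp add: k_def)
  obtain n where n: "4 * K / k < 16 ^ n"
    using real_arch_pow[of 16 "4 * K / k"] by auto
  have "ennreal (k * 16 ^ Suc n) \<le> modulus chain_space (path_image_family id (test_paths n))"
    unfolding k_def by (rule modulus_image_ge)
  also have "\<dots> \<le> ennreal K * modulus unit_square (test_paths n)"
    using is_mpath_test_paths by (intro K) auto
  also have "\<dots> \<le> ennreal K * 4"
    by (intro mult_left_mono modulus_test_paths_le) simp
  also have "\<dots> = ennreal (K * 4)" using K(1) by (simp add: ennreal_mult)
  finally have "k * 16 ^ Suc n \<le> K * 4" using K(1) by simp
  moreover have "K * 4 < k * 16 ^ n" using n k by (simp add: field_simps)
  moreover have "k * 16 ^ n \<le> k * 16 ^ Suc n" using k by simp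
  ultimately show False by linarith
qed

theorem corollary1p3:
  shows "\<exists>(X :: (real \<times> real) metric) (f :: real \<times> real \<Rightarrow> real \<times> real).
           locally_finite_hausdorff2 X \<and> quasisymmetric unit_square X f \<and>
           \<not> quasiconformal unit_square X f"
  using locally_finite_chain_space quasisymmetric_chain_space not_quasiconformal_chain_space by blast

end
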